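(* Let $\boldsymbol{\Lambda}=(\Lambda_t,t\ge0)$ be a Lipschitz partition process on $\mathcal{L}_{\mathbb{N}:k}$. Then $\boldsymbol{\Lambda}$ is exchangeable if and only if its directing measure $\mu$ (1) is supported on $\mathcal{M}_{\mathbb{N}:k}$; (2) satisfies $\mu(\{I_\infty^k\})=0$ and $\mu_2(\{M\in\mathcal{M}_{[2]:k}: M\ne I_2^k\})<\infty$; and (3) for every permutation $\sigma:\mathbb{N}\to\mathbb{N}$ fixing all but finitely many $n\in\mathbb{N}$ and every measurable subset $A\subseteq\mathcal{M}_{\mathbb{N}:k}$, $\mu(A)=\mu(\{M^\sigma: M\in A\})$.
   Context: Fix $k\in\mathbb{N}$. Write $[n]=\{1,\dots,n\}$. For $A\subseteq\mathbb{N}$, a $k$-partition of $A$ is a vector $\lambda=(\lambda_1,\dots,\lambda_k)$ of pairwise disjoint (possibly empty) subsets of $A$ with union $A$; equivalently a map $\lambda:A\to[k]$ with $\lambda(i)=j$ iff $i\in\lambda_j$. $\mathcal{L}_{A:k}$ is the set of $k$-partitions of $A$. The restriction of $\lambda$ to $[n]$ is $\lambda_{|[n]}=(\lambda_1\cap[n],\dots,\lambda_k\cap[n])$. $\mathcal{L}_{\mathbb{N}:k}$ carries the ultrametric $d(\lambda,\lambda')=2^{-\mathbf{n}(\lambda,\lambda')}$, $\mathbf{n}(\lambda,\lambda')=\max\{n:\lambda_{|[n]}=\lambda'_{|[n]}\}$ (equal to $0$ if the restrictions to $[1]$ differ, and $\infty$ if $\lambda=\lambda'$, with $2^{-\infty}=0$),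 and the $\sigma$-field generated by the restriction maps. $\mathcal{L}_{[n]:k}$ carries the analogous metric. $\mathrm{Lip}(\mathcal{L}_{\mathbb{N}:k})$ is the set of maps $F:\mathcal{L}_{\mathbb{N}:k}\to\mathcal{L}_{\mathbb{N}:k}$ with $d(F(\lambda),F(\lambda'))\le d(\lambda,\lambda')$ for all $\lambda,\lambda'$; $\mathrm{Lip}(\mathcal{L}_{[n]:k})$ is defined likewise. For $F\in\mathrm{Lip}(\mathcal{L}_{\mathbb{N}:k})$, its restriction $F_{[n]}\in\mathrm{Lip}(\mathcal{L}_{[n]:k})$ is $F_{[n]}(\lambda)=F(\lambda^* )_{|[n]}$ for any $\lambda^*$ with $\lambda^*_{|[n]}=\lambda$. $\mathcal{F}$ is the $\sigma$-field generated by the maps $F\mapsto F_{[n]}$, $n\in\mathbb{N}$. For a measure $\varphi$ on $(\mathrm{Lip}(\mathcal{L}_{\mathbb{N}:k}),\mathcal{F})$, $\varphi_n$ is its image under $F\mapsto F_{[n]}$. $\mathbf{Id}_n$, $\mathbf{Id}_\infty$ are the identity maps on $\mathcal{L}_{[n]:k}$, $\mathcal{L}_{\mathbb{N}:k}$. Lipschitz partition process with directing measure $\varphi$: $\varphi$ is a measure on $(\mathrm{Lip}(\mathcal{L}_{\mathbb{N}:k}),\mathcal{F})$ with $\varphi(\{\mathbf{Id}_\infty\})=0$ and $\varphi_n(\mathrm{Lip}(\mathcal{L}_{[n]:k})\setminus\{\mathbf{Id}_n\})<\infty$ for all $n$; $\mathbf{F}=\{(t,F^t)\}$ is a Poisson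 point process on $\mathbb{R}^+\times\mathrm{Lip}(\mathcal{L}_{\mathbb{N}:k})$ with intensity $\mathrm{d}t\otimes\varphi$; $\lambda_0$ is a (possibly random, independent of $\mathbf{F}$) initial state; and $\boldsymbol{\Lambda}$ is the process whose restrictions $\Lambda^{[n]}_t=\Lambda_{t|[n]}$ satisfy $\Lambda^{[n]}_0=\lambda_{0|[n]}$, $\Lambda^{[n]}_t=F^t_{[n]}(\Lambda^{[n]}_{t-})$ if $t>0$ is an atom time of $\mathbf{F}$ with $F^t_{[n]}\neq\mathbf{Id}_n$, and $\Lambda^{[n]}_t=\Lambda^{[n]}_{t-}$ otherwise. For a permutation $\sigma$, $\lambda^\sigma=\lambda\circ\sigma$. $\boldsymbol{\Lambda}$ is exchangeable if $(\Lambda_t^\sigma,t\ge0)$ equals $\boldsymbol{\Lambda}$ in law for all permutations $\sigma:\mathbb{N}\to\mathbb{N}$ fixing all but finitely many elements. For $n\in\mathbb{N}\cup\{\infty\}$ ($[\infty]=\mathbb{N}$), $\mathcal{M}_{[n]:k}$ is the set of partition operators over $[n]$: $k\times k$ matrices $M=(M_{ij})$ of subsets of $[n]$ each of whose columns $M^j=(M_{1j},\dots,M_{kj})$ is in $\mathcal{L}_{[n]:k}$. $M$ acts on $\mathcal{L}_{[n]:k}$ by $(M\lambda)_i=\bigcup_{j=1}^k(M_{ij}\cap\lambda_j)$, and $\mathcal{M}_{\mathbb{N}:k}$ is identified in this way with a subset of $\mathrm{Lip}(\mathcal{L}_{\mathbb{N}:k})$. $I_n^k$ is the partition operator with diagonal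 entries $[n]$ and off-diagonal entries $\emptyset$ (it acts as the identity). The restriction of $M$ to $\mathcal{M}_{[n]:k}$ has entries $M_{ij}\cap[n]$, and $\mu_n$ is the image of $\mu$ under this restriction. $M^\sigma$ is the matrix with columns $(M^1)^\sigma,\dots,(M^k)^\sigma$. The $\sigma$-field on $\mathcal{M}_{\mathbb{N}:k}$ is generated by the restrictions to $\mathcal{M}_{[n]:k}$, $n\in\mathbb{N}$.
   Formalization: "Exchangeable" is read jointly over all initial states driven by the same F: the relabelled family agrees in law with the family started from relabelled states; then Λ from a random λ_0 is exchangeable iff λ_0 is. For a single λ_0 the claim fails in both directions. *)

theory Defs
  imports "HOL-Probability.Probability"
begin

text \<open>
  The colours \<open>1, \<dots>, k\<close> are the elements of a finite type \<open>'k\<close>. The ground set of positive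
  integers is represented by \<^typ>\<open>nat\<close>, the integer \<open>i + 1\<close> by \<open>i\<close>; so \<open>[n]\<close> is
  \<^term>\<open>{..<n}\<close>. A \<open>k\<close>-partition is the map sending each element to the index of its block;
  one of \<open>[n]\<close> is such a map that is \<^const>\<open>undefined\<close> outside \<^term>\<open>{..<n}\<close>.
\<close>

type_synonym 'k part = "nat \<Rightarrow> 'k"

definition block :: "'k part \<Rightarrow> 'k \<Rightarrow> nat set" where
  "block x j = {i. x i = j}"

definition parts_on :: "nat \<Rightarrow> 'k part set" where
  "parts_on n = {..<n} \<rightarrow>\<^sub>E UNIV"

definition part_restr :: "nat \<Rightarrow> 'k part \<Rightarrow> 'k part" where
  "part_restr n x = restrict x {..<n}"

definition part_space :: "'k part measure" where
  "part_space = sigma UNIV {part_restr n -` B | n B. B \<subseteq> parts_on n}"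

text \<open>
  On \<^term>\<open>parts_on n\<close> the same formula is the metric of the \<open>k\<close>-partitions of \<open>[n]\<close>: two
  different elements already differ below \<open>n\<close>.
\<close>

definition part_dist :: "'k part \<Rightarrow> 'k part \<Rightarrow> real" where
  "part_dist x y =
    (if x = y then 0 else (1/2) ^ Max {n. part_restr n x = part_restr n y})"

definition lip_maps :: "('k part \<Rightarrow> 'k part) set" where
  "lip_maps = {F. \<forall>x y. part_dist (F x) (F y) \<le> part_dist x y}"

definition lip_maps_on :: "nat \<Rightarrow> ('k part \<Rightarrow> 'k part) set" where
  "lip_maps_on n = {f \<in> parts_on n \<rightarrow>\<^sub>E parts_on n.
     \<forall>x\<in>parts_on n. \<forall>y\<in>parts_on n. part_dist (f x) (f y) \<le> part_dist x y}"

text \<open>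
  An element of \<^term>\<open>parts_on n\<close> is itself a total function extending it, and can serve as the
  extension \<open>x\<^sup>*\<close> in the definition of \<open>F\<^bsub>[n]\<^esub>\<close>; see \<open>lip_restr_part_restr\<close> below.
\<close>

definition lip_restr :: "nat \<Rightarrow> ('k part \<Rightarrow> 'k part) \<Rightarrow> 'k part \<Rightarrow> 'k part" where
  "lip_restr n F = (\<lambda>x\<in>parts_on n. part_restr n (F x))"

definition id_on :: "nat \<Rightarrow> 'k part \<Rightarrow> 'k part" where
  "id_on n = (\<lambda>x\<in>parts_on n. x)"

definition lip_space :: "('k part \<Rightarrow> 'k part) measure" where
  "lip_space = sigma lip_maps {lip_restr n -` B \<inter> lip_maps | n B. B \<subseteq> lip_maps_on n}"

definition directing_measure :: "('k part \<Rightarrow> 'k part) measure \<Rightarrow> bool" where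
  "directing_measure \<phi> \<longleftrightarrow>
     sets \<phi> = sets lip_space \<and>
     emeasure \<phi> {id} = 0 \<and>
     (\<forall>n. emeasure (distr \<phi> (count_space (lip_maps_on n)) (lip_restr n))
            (lip_maps_on n - {id_on n}) < \<infinity>)"

text \<open>
  A point process on \<open>\<nu>\<close> is a random set of points of \<^term>\<open>space \<nu>\<close>. (Only intensities without
  atoms are used below, for which a Poisson process almost surely has no multiple points.)
\<close>

definition config_space :: "'a measure \<Rightarrow> 'a set measure" where
  "config_space \<nu> = sigma (Pow (space \<nu>))
     {{S \<in> Pow (space \<nu>). emeasure (count_space UNIV) (S \<inter> B) = of_nat m} | B m. B \<in> sets \<nu>}"

definition poisson_point_process ::
    "'w measure \<Rightarrow> 'a measure \<Rightarrow> ('w \<Rightarrow> 'a set) \<Rightarrow> bool" where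
  "poisson_point_process P \<nu> S \<longleftrightarrow>
     prob_space P \<and>
     S \<in> P \<rightarrow>\<^sub>M config_space \<nu> \<and>
     (\<forall>B\<in>sets \<nu>. emeasure \<nu> B < \<infinity> \<longrightarrow>
        (\<forall>m. measure P {\<omega> \<in> space P. emeasure (count_space UNIV) (S \<omega> \<inter> B) = of_nat m} =
               exp (- measure \<nu> B) * measure \<nu> B ^ m / fact m)) \<and>
     (\<forall>B\<in>sets \<nu>. emeasure \<nu> B = \<infinity> \<longrightarrow>
        (AE \<omega> in P. emeasure (count_space UNIV) (S \<omega> \<inter> B) = \<infinity>)) \<and>
     (\<forall>(B :: nat \<Rightarrow> 'a set) l.
        (\<forall>i<l. B i \<in> sets \<nu>) \<and> disjoint_family_on B {..<l} \<longrightarrow>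
        prob_space.indep_vars P (\<lambda>_. borel)
          (\<lambda>i \<omega>. emeasure (count_space UNIV) (S \<omega> \<inter> B i)) {..<l})"

text \<open>
  The path \<open>X\<close> driven by the points \<open>S\<close> from \<open>x\<close>. Restrictions to \<open>[n]\<close> take values in a finite
  discrete set, so a left or right limit is a value taken on a punctured one-sided neighbourhood;
  \<open>y\<close> is the value at \<open>t-\<close>. Right continuity is part of the usual reading of the jump
  description, which would otherwise admit spurious jumps immediately after a time \<open>t\<close>.
\<close>

definition driven_path ::
    "(real \<times> ('k part \<Rightarrow> 'k part)) set \<Rightarrow> 'k part \<Rightarrow> (real \<Rightarrow> 'k part) \<Rightarrow> bool" where
  "driven_path S x X \<longleftrightarrow>
     (\<forall>n. part_restr n (X 0) = part_restr n x \<and>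
       (\<forall>t\<ge>0. \<forall>\<^sub>F s in at_right t. part_restr n (X s) = part_restr n (X t)) \<and>
       (\<forall>t>0. \<exists>y. (\<forall>\<^sub>F s in at_left t. part_restr n (X s) = y) \<and>
          (\<forall>F. (t, F) \<in> S \<and> lip_restr n F \<noteq> id_on n \<longrightarrow>
             part_restr n (X t) = lip_restr n F y) \<and>
          ((\<nexists>F. (t, F) \<in> S \<and> lip_restr n F \<noteq> id_on n) \<longrightarrow> part_restr n (X t) = y)))"

definition lipschitz_partition_process ::
    "'w measure \<Rightarrow> ('k part \<Rightarrow> 'k part) measure \<Rightarrow> ('w \<Rightarrow> (real \<times> ('k part \<Rightarrow> 'k part)) set) \<Rightarrow>
     ('w \<Rightarrow> 'k part) \<Rightarrow> (real \<Rightarrow> 'w \<Rightarrow> 'k part) \<Rightarrow> bool" where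
  "lipschitz_partition_process P \<phi> S x\<^sub>0 X \<longleftrightarrow>
     directing_measure \<phi> \<and>
     poisson_point_process P (restrict_space lborel {0..} \<Otimes>\<^sub>M \<phi>) S \<and>
     x\<^sub>0 \<in> P \<rightarrow>\<^sub>M part_space \<and>
     prob_space.indep_set P {x\<^sub>0 -` A \<inter> space P | A. A \<in> sets part_space}
       {S -` B \<inter> space P | B. B \<in> sets (config_space (restrict_space lborel {0..} \<Otimes>\<^sub>M \<phi>))} \<and>
     (\<forall>t\<ge>0. X t \<in> P \<rightarrow>\<^sub>M part_space) \<and>
     (AE \<omega> in P. driven_path (S \<omega>) (x\<^sub>0 \<omega>) (\<lambda>t. X t \<omega>))"

definition law :: "'w measure \<Rightarrow> 'i set \<Rightarrow> ('i \<Rightarrow> 'w \<Rightarrow> 'k part) \<Rightarrow> ('i \<Rightarrow> 'k part) measure" where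
  "law P I X = distr P (Pi\<^sub>M I (\<lambda>_. part_space)) (\<lambda>\<omega>. \<lambda>i\<in>I. X i \<omega>)"

definition finitary_perm :: "(nat \<Rightarrow> nat) \<Rightarrow> bool" where
  "finitary_perm \<sigma> \<longleftrightarrow> bij \<sigma> \<and> finite {i. \<sigma> i \<noteq> i}"

definition relabel :: "(nat \<Rightarrow> nat) \<Rightarrow> 'k part \<Rightarrow> 'k part" where
  "relabel \<sigma> x = x \<circ> \<sigma>"

definition exchangeable_state :: "'w measure \<Rightarrow> ('w \<Rightarrow> 'k part) \<Rightarrow> bool" where
  "exchangeable_state P x\<^sub>0 \<longleftrightarrow>
     (\<forall>\<sigma>. finitary_perm \<sigma> \<longrightarrow>
        distr P part_space (\<lambda>\<omega>. relabel \<sigma> (x\<^sub>0 \<omega>)) = distr P part_space x\<^sub>0)"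

definition exchangeable_process :: "'w measure \<Rightarrow> (real \<Rightarrow> 'w \<Rightarrow> 'k part) \<Rightarrow> bool" where
  "exchangeable_process P X \<longleftrightarrow>
     (\<forall>\<sigma>. finitary_perm \<sigma> \<longrightarrow>
        law P {0..} (\<lambda>t \<omega>. relabel \<sigma> (X t \<omega>)) = law P {0..} X)"

text \<open>
  The process with its initial state left free is the family \<open>X x\<close>, \<open>x\<close> ranging over all initial
  states, with all members driven by the same point process. Relabelling the member started from
  \<open>x\<close> gives a process started from \<open>relabel \<sigma> x\<close>, and the law of the relabelled family is compared
  with that of the members having those initial states. The law is the joint one over all \<open>x\<close>
  and \<open>t\<close>: the laws of the single processes \<open>X x\<close> do not determine the directing measure. For
  instance, the rate-one process jumping to a uniformly random colouring independent of the past is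
  exchangeable, and is directed both by random constant maps and by random maps
  \<open>F x i = c (i, x 0, \<dots>, x i)\<close> with all \<open>c (i, x 0, \<dots>, x i)\<close> independent and uniform.
\<close>

definition lipschitz_partition_system ::
    "'w measure \<Rightarrow> ('k part \<Rightarrow> 'k part) measure \<Rightarrow> ('w \<Rightarrow> (real \<times> ('k part \<Rightarrow> 'k part)) set) \<Rightarrow>
     ('k part \<Rightarrow> real \<Rightarrow> 'w \<Rightarrow> 'k part) \<Rightarrow> bool" where
  "lipschitz_partition_system P \<phi> S X \<longleftrightarrow>
     (\<forall>x. lipschitz_partition_process P \<phi> S (\<lambda>_. x) (X x))"

definition exchangeable_system ::
    "'w measure \<Rightarrow> ('k part \<Rightarrow> real \<Rightarrow> 'w \<Rightarrow> 'k part) \<Rightarrow> bool" where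
  "exchangeable_system P X \<longleftrightarrow>
     (\<forall>\<sigma>. finitary_perm \<sigma> \<longrightarrow>
        law P (UNIV \<times> {0..}) (\<lambda>(x, t) \<omega>. relabel \<sigma> (X x t \<omega>)) =
        law P (UNIV \<times> {0..}) (\<lambda>(x, t) \<omega>. X (relabel \<sigma> x) t \<omega>))"

text \<open>
  A partition operator is given by the family of its columns, \<open>M j\<close> being the \<open>j\<close>-th one.
\<close>

type_synonym 'k operator = "'k \<Rightarrow> 'k part"

definition entry :: "'k operator \<Rightarrow> 'k \<Rightarrow> 'k \<Rightarrow> nat set" where
  "entry M i j = block (M j) i"

text \<open>Written blockwise, the action is \<open>(M x)\<^sub>i = (\<Union>j. M\<^sub>i\<^sub>j \<inter> x\<^sub>j)\<close>; see \<open>block_act\<close> below.\<close>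

definition act :: "'k operator \<Rightarrow> 'k part \<Rightarrow> 'k part" where
  "act M x = (\<lambda>r. M (x r) r)"

definition operators_on :: "nat \<Rightarrow> 'k operator set" where
  "operators_on n = {M. \<forall>j. M j \<in> parts_on n}"

definition op_restr :: "nat \<Rightarrow> 'k operator \<Rightarrow> 'k operator" where
  "op_restr n M = (\<lambda>j. part_restr n (M j))"

definition op_space :: "'k operator measure" where
  "op_space = sigma UNIV {op_restr n -` B | n B. B \<subseteq> operators_on n}"

definition op_id :: "'k operator" where
  "op_id = (\<lambda>j r. j)"

definition op_id_on :: "nat \<Rightarrow> 'k operator" where
  "op_id_on n = (\<lambda>j. \<lambda>r\<in>{..<n}. j)"

definition op_relabel :: "(nat \<Rightarrow> nat) \<Rightarrow> 'k operator \<Rightarrow> 'k operator" where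
  "op_relabel \<sigma> M = (\<lambda>j. relabel \<sigma> (M j))"

text \<open>
  The part of \<open>\<phi>\<close> carried by \<^term>\<open>range act\<close>, as a measure on operators under the
  identification of an operator \<open>M\<close> with the map \<^term>\<open>act M\<close>.
\<close>

definition op_measure :: "('k part \<Rightarrow> 'k part) measure \<Rightarrow> 'k operator measure" where
  "op_measure \<phi> = distr (restrict_space \<phi> (range act)) op_space (the_inv act)"

lemma block_act: "block (act M x) i = (\<Union>j. entry M i j \<inter> block x j)"
  by (auto simp: block_def act_def entry_def)

lemma entry_op_restr: "entry (op_restr n M) i j \<inter> {..<n} = entry M i j \<inter> {..<n}"
  by (auto simp: entry_def block_def op_restr_def part_restr_def)

lemma act_op_id: "act op_id = id"
  by (auto simp: act_def op_id_def)

lemma op_restr_op_id: "op_restr n op_id = op_id_on n"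
  by (auto simp: op_restr_def part_restr_def op_id_def op_id_on_def)

lemma inj_act: "inj act"
proof (rule injI)
  fix M N :: "'k operator" assume "act M = act N"
  then have "act M (\<lambda>_. j) r = act N (\<lambda>_. j) r" for j r by simp
  then show "M = N" by (auto simp: act_def)
qed

lemma act_relabel: "act (op_relabel \<sigma> M) (relabel \<sigma> x) = relabel \<sigma> (act M x)"
  by (auto simp: act_def op_relabel_def relabel_def)

lemma part_restr_eq_iff: "part_restr n x = part_restr n y \<longleftrightarrow> (\<forall>i<n. x i = y i)"
  by (auto simp: part_restr_def restrict_def fun_eq_iff)

lemma part_restr_eq_iff_le:
  assumes "x \<noteq> y"
  shows "part_restr n x = part_restr n y \<longleftrightarrow> n \<le> (LEAST i. x i \<noteq> y i)"
proof -
  obtain i where "x i \<noteq> y i" using assms by blast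
  then have *: "x (LEAST i. x i \<noteq> y i) \<noteq> y (LEAST i. x i \<noteq> y i)" by (rule LeastI)
  show ?thesis
  proof
    assume "part_restr n x = part_restr n y"
    with * show "n \<le> (LEAST i. x i \<noteq> y i)"
      unfolding part_restr_eq_iff by (meson leI)
  next
    assume le: "n \<le> (LEAST i. x i \<noteq> y i)"
    have "x i = y i" if "i < n" for i
      using not_less_Least[OF less_le_trans[OF that le]] by simp
    then show "part_restr n x = part_restr n y" by (simp add: part_restr_eq_iff)
  qed
qed

lemma part_dist_neq:
  assumes "x \<noteq> y"
  shows "part_dist x y = (1/2) ^ (LEAST i. x i \<noteq> y i)"
proof -
  have "{n. part_restr n x = part_restr n y} = {..(LEAST i. x i \<noteq> y i)}"
    using part_restr_eq_iff_le[OF assms] by blast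
  moreover have "Max {..m} = m" for m :: nat by (rule Max_eqI) simp_all
  ultimately show ?thesis using assms by (simp add: part_dist_def)
qed

lemma part_dist_le_iff:
  "part_dist x' y' \<le> part_dist x y \<longleftrightarrow>
     (\<forall>n. part_restr n x = part_restr n y \<longrightarrow> part_restr n x' = part_restr n y')"
proof -
  consider "x' = y'" | "x = y" "x' \<noteq> y'" | "x \<noteq> y" "x' \<noteq> y'" by blast
  then show ?thesis
  proof cases
    case 1
    then show ?thesis by (simp add: part_dist_def)
  next
    case 2
    then have "\<not> part_dist x' y' \<le> part_dist x y"
      by (simp add: part_dist_def not_le)
    moreover obtain i where "x' i \<noteq> y' i" using 2 by blast
    then have "part_restr (Suc i) x' \<noteq> part_restr (Suc i) y'" by (auto simp: part_restr_eq_iff)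
    ultimately show ?thesis using 2 by auto
  next
    case 3
    have "part_dist x' y' \<le> part_dist x y \<longleftrightarrow>
        (LEAST i. x i \<noteq> y i) \<le> (LEAST i. x' i \<noteq> y' i)"
      unfolding part_dist_neq[OF 3(1)] part_dist_neq[OF 3(2)]
      by (rule power_decreasing_iff) simp_all
    then show ?thesis
      unfolding part_restr_eq_iff_le[OF 3(1)] part_restr_eq_iff_le[OF 3(2)]
      by (meson order_refl order_trans)
  qed
qed

lemma lip_maps_iff:
  "F \<in> lip_maps \<longleftrightarrow>
     (\<forall>n x y. part_restr n x = part_restr n y \<longrightarrow> part_restr n (F x) = part_restr n (F y))"
  unfolding lip_maps_def part_dist_le_iff by blast

lemma act_lip: "act M \<in> lip_maps"
  unfolding lip_maps_iff part_restr_eq_iff act_def by simp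

lemma part_restr_in: "part_restr n x \<in> parts_on n"
  by (simp add: part_restr_def parts_on_def)

lemma part_restr_idem: "part_restr m (part_restr n x) = part_restr (min m n) x"
  by (auto simp: part_restr_def restrict_def)

lemma lip_restr_part_restr:
  assumes "F \<in> lip_maps"
  shows "lip_restr n F (part_restr n x) = part_restr n (F x)"
proof -
  have "part_restr n (part_restr n x) = part_restr n x" by (simp add: part_restr_idem)
  then have "part_restr n (F (part_restr n x)) = part_restr n (F x)"
    using assms lip_maps_iff by blast
  then show ?thesis by (simp add: lip_restr_def part_restr_in)
qed

lemma lip_restr_in:
  assumes "F \<in> lip_maps"
  shows "lip_restr n F \<in> lip_maps_on n"
proof -
  have "part_restr m (part_restr n (F x)) = part_restr m (part_restr n (F y))"
    if "part_restr m x = part_restr m y" for m x y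
  proof -
    have "part_restr (min m n) x = part_restr (min m n) y"
      using that by (simp add: part_restr_eq_iff)
    then have "part_restr (min m n) (F x) = part_restr (min m n) (F y)"
      using assms lip_maps_iff by blast
    then show ?thesis by (simp only: part_restr_idem)
  qed
  then have "part_dist (part_restr n (F x)) (part_restr n (F y)) \<le> part_dist x y" for x y
    unfolding part_dist_le_iff by blast
  then show ?thesis by (simp add: lip_maps_on_def lip_restr_def part_restr_in)
qed

lemma op_restr_in: "op_restr n M \<in> operators_on n"
  by (simp add: op_restr_def operators_on_def part_restr_in)

lemma space_lip_space: "space lip_space = lip_maps"
  unfolding lip_space_def by (rule space_measure_of) auto

lemma lip_restr_measurable: "lip_restr n \<in> lip_space \<rightarrow>\<^sub>M count_space (lip_maps_on n)"
proof (rule measurableI)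
  fix F :: "'a part \<Rightarrow> 'a part" assume "F \<in> space lip_space"
  then show "lip_restr n F \<in> space (count_space (lip_maps_on n))"
    by (simp add: space_lip_space lip_restr_in)
next
  fix B :: "('a part \<Rightarrow> 'a part) set" assume "B \<in> sets (count_space (lip_maps_on n))"
  then have "lip_restr n -` B \<inter> lip_maps \<in>
      {lip_restr n -` B \<inter> lip_maps | n B. B \<subseteq> lip_maps_on n}" by auto
  then show "lip_restr n -` B \<inter> space lip_space \<in> sets lip_space"
    unfolding space_lip_space unfolding lip_space_def by (subst sets_measure_of) auto
qed

lemma op_restr_measurable: "op_restr n \<in> op_space \<rightarrow>\<^sub>M count_space (operators_on n)"
proof (rule measurableI)
  fix M :: "'a operator"
  show "op_restr n M \<in> space (count_space (operators_on n))" by (simp add: op_restr_in)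
next
  fix B :: "'a operator set" assume "B \<in> sets (count_space (operators_on n))"
  then have "op_restr n -` B \<in> {op_restr n -` B | n B. B \<subseteq> operators_on n}" by auto
  then show "op_restr n -` B \<inter> space op_space \<in> sets op_space"
    unfolding op_space_def by (subst sets_measure_of) auto
qed

lemma the_inv_act_measurable:
  assumes "sets \<phi> = sets lip_space"
  shows "the_inv act \<in> restrict_space \<phi> (range act) \<rightarrow>\<^sub>M op_space"
  unfolding op_space_def
proof (rule measurable_measure_of)
  show "{op_restr n -` B | n B. B \<subseteq> operators_on n} \<subseteq> Pow UNIV" by auto
  show "the_inv act \<in> space (restrict_space \<phi> (range act)) \<rightarrow> UNIV" by auto
next
  fix A :: "'a operator set" assume "A \<in> {op_restr n -` B | n B. B \<subseteq> operators_on n}"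
  then obtain n B where A: "A = op_restr n -` B" by auto
  define C where "C = lip_restr n ` act ` A"
  have C: "C \<subseteq> lip_maps_on n" using lip_restr_in act_lip by (auto simp: C_def)
  have sp: "space \<phi> = lip_maps" using assms sets_eq_imp_space_eq space_lip_space by metis
  have eq: "op_restr n M = op_restr n N" if "lip_restr n (act M) = lip_restr n (act N)"
    for M N :: "'a operator"
  proof
    fix j
    have "part_restr n (act M (\<lambda>_. j)) = part_restr n (act N (\<lambda>_. j))"
      using that act_lip lip_restr_part_restr by metis
    then show "op_restr n M j = op_restr n N j" by (simp add: op_restr_def act_def)
  qed
  have "the_inv act -` A \<inter> space (restrict_space \<phi> (range act)) =
      range act \<inter> (lip_restr n -` C \<inter> space lip_space)"
  proof (intro equalityI subsetI)
    fix F assume "F \<in> the_inv act -` A \<inter> space (restrict_space \<phi> (range act))"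
    then obtain M where "F = act M" "the_inv act F \<in> A" by (auto simp: space_restrict_space)
    then show "F \<in> range act \<inter> (lip_restr n -` C \<inter> space lip_space)"
      using act_lip by (auto simp: the_inv_f_f[OF inj_act] C_def space_lip_space)
  next
    fix F assume F: "F \<in> range act \<inter> (lip_restr n -` C \<inter> space lip_space)"
    then obtain M N where "F = act M" "N \<in> A" "lip_restr n (act M) = lip_restr n (act N)"
      by (auto simp: C_def)
    then have "F = act M" "M \<in> A" using eq[of M N] by (auto simp: A)
    then show "F \<in> the_inv act -` A \<inter> space (restrict_space \<phi> (range act))"
      using act_lip by (auto simp: the_inv_f_f[OF inj_act] space_restrict_space sp)
  qed
  moreover have "lip_restr n -` C \<inter> space lip_space \<in> sets lip_space"
    using measurable_sets[OF lip_restr_measurable] C by auto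
  ultimately show "the_inv act -` A \<inter> space (restrict_space \<phi> (range act))
      \<in> sets (restrict_space \<phi> (range act))"
    using assms by (auto simp: sets_restrict_space)
qed

end

theory Submission
  imports Defs "HOL-Combinatorics.Permutations"
begin

text \<open>
  Both sides of the equivalence say that for every \<open>n\<close> the finite measure \<open>\<phi>\<^sub>n\<close> on the maps
  \<open>f \<noteq> Id\<^sub>n\<close> is invariant under conjugation by the permutations of \<open>[n]\<close>.

  Over \<open>[n]\<close> the states and maps form finite sets. Cut time into cells of length \<open>h\<close>. Up to an event
  of probability \<open>O(h)\<close>, every cell contains at most one active point, and then the states at the
  chosen times are determined by which pairs (cell, map) are hit by the point process. These hits are
  independent with probabilities depending only on the rates \<open>\<phi>\<^sub>n(f)\<close>, so invariance of the rates
  gives exchangeability as \<open>h\<close> tends to \<open>0\<close>. Conversely \<open>\<phi>\<^sub>n(f)\<close> is the derivative at \<open>t = 0\<close> of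
  the probability that all initial states have been moved by \<open>f\<close> at time \<open>t\<close>, hence it is
  determined by the joint law.

  If the rates are invariant, a map whose conjugate is not Lipschitz has rate \<open>0\<close>. So almost every
  \<open>F\<close> remains Lipschitz when \<open>i\<close> is moved to the first position, that is, \<open>F x i\<close> depends only on
  \<open>x i\<close>, and \<open>F\<close> is a partition operator.
\<close>

section \<open>Finite-level maps\<close>

text \<open>The Lipschitz property is not stable under conjugation, because a permutation of
  \<open>[n]\<close> disturbs the order in which coordinates may influence each other. Rates are
  therefore indexed by all maps of the finite state set except the identity, on which conjugation is
  a bijection; a map that is not Lipschitz has rate 0.

  The discretised states are an explicit function of finitely many independent hit events, so laws
  are always compared through them, up to an error vanishing with the mesh. With total rate
  \<open>r\<close>, a cell contains two active points with probability at most
  \<open>(r h)^2\<close>, and there are about \<open>T / h\<close> cells; rounding an observation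
  time up to the grid costs \<open>r h\<close>. The expansion at \<open>t = 0\<close> requires an
  error of order \<open>h^2\<close>, so there the observation time is itself a grid point. It also
  requires all initial states to be driven by the same points: only then is the map \<open>f\<close>
  visible.

  A random initial state is independent of the points, so at each level its process is a mixture of
  the members of the system, weighted by the law of the restricted initial state.\<close>

lemma relabel_inv:
  assumes "\<sigma> permutes A"
  shows "relabel \<sigma> (relabel (inv \<sigma>) x) = x" "relabel (inv \<sigma>) (relabel \<sigma> x) = x"
  using permutes_inv_o[OF assms] by (auto simp: relabel_def fun_eq_iff)

lemma permutes_less_iff:
  fixes n :: nat
  assumes "\<sigma> permutes {..<n}"
  shows "\<sigma> i < n \<longleftrightarrow> i < n"
  using permutes_in_image[OF assms, of i] by simp

lemma part_restr_relabel:
  assumes "\<sigma> permutes {..<n}"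
  shows "part_restr n (relabel \<sigma> x) = relabel \<sigma> (part_restr n x)"
  using permutes_less_iff[OF assms] by (auto simp: part_restr_def relabel_def restrict_def fun_eq_iff)

lemma part_restr_id: "x \<in> parts_on n \<Longrightarrow> part_restr n x = x"
  by (auto simp: part_restr_def parts_on_def)

lemma relabel_in_parts_on:
  assumes "\<sigma> permutes {..<n}" "x \<in> parts_on n"
  shows "relabel \<sigma> x \<in> parts_on n"
  by (metis assms part_restr_id part_restr_in part_restr_relabel)

lemma relabel_eq_iff:
  assumes "\<sigma> permutes A"
  shows "relabel \<sigma> x = y \<longleftrightarrow> x = relabel (inv \<sigma>) y"
  using relabel_inv[OF assms] by metis

lemma finite_parts_on: "finite (parts_on n :: 'k::finite part set)"
  by (simp add: parts_on_def finite_PiE)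

text \<open>Only finitely many points move, so \<sigma> preserves \<open>{..<n}\<close> for all
  large \<open>n\<close>. Smaller levels are later reached by refining cylinders.\<close>

lemma finitary_perm_permutes:
  assumes "finitary_perm \<sigma>"
  obtains N where "\<And>n. N \<le> n \<Longrightarrow> \<sigma> permutes {..<n}"
proof -
  obtain N where N: "\<forall>i\<in>{i. \<sigma> i \<noteq> i}. i < N"
    using assms finite_nat_set_iff_bounded unfolding finitary_perm_def by blast
  have "\<sigma> permutes {..<n}" if "N \<le> n" for n
    using assms N that unfolding permutes_def finitary_perm_def bij_iff by force
  then show thesis using that by blast
qed

lemma permutes_finitary_perm:
  assumes "\<sigma> permutes {..<n::nat}"
  shows "finitary_perm \<sigma>"
proof -
  have "{i. \<sigma> i \<noteq> i} \<subseteq> {..<n}" using permutes_not_in[OF assms] by blast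
  then show ?thesis
    using permutes_bij[OF assms] finite_subset unfolding finitary_perm_def by blast
qed

definition labels :: "nat \<Rightarrow> ('k part \<Rightarrow> 'k part) set" where
  "labels n = (parts_on n \<rightarrow>\<^sub>E parts_on n) - {id_on n}"

definition conj_map :: "nat \<Rightarrow> (nat \<Rightarrow> nat) \<Rightarrow> ('k part \<Rightarrow> 'k part) \<Rightarrow> 'k part \<Rightarrow> 'k part" where
  "conj_map n \<sigma> f = (\<lambda>x\<in>parts_on n. relabel \<sigma> (f (relabel (inv \<sigma>) x)))"

lemma finite_labels: "finite (labels n :: ('k::finite part \<Rightarrow> 'k part) set)"
  by (simp add: labels_def finite_PiE finite_parts_on)

lemma labels_in: "f \<in> labels n \<Longrightarrow> x \<in> parts_on n \<Longrightarrow> f x \<in> parts_on n"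
  by (auto simp: labels_def)

lemma conj_map_relabel:
  assumes "\<sigma> permutes {..<n}" "x \<in> parts_on n"
  shows "conj_map n \<sigma> f (relabel \<sigma> x) = relabel \<sigma> (f x)"
  using assms by (simp add: conj_map_def relabel_in_parts_on relabel_inv)

lemma conj_map_inv:
  assumes "\<sigma> permutes {..<n}" "f \<in> parts_on n \<rightarrow>\<^sub>E parts_on n"
  shows "conj_map n (inv \<sigma>) (conj_map n \<sigma> f) = f"
proof
  fix x show "conj_map n (inv \<sigma>) (conj_map n \<sigma> f) x = f x"
    using assms PiE_arb[OF assms(2)] permutes_inv_inv[OF assms(1)]
    by (auto simp: conj_map_def relabel_inv relabel_in_parts_on)
qed

lemma conj_map_id_on:
  assumes "\<sigma> permutes {..<n}"
  shows "conj_map n \<sigma> (id_on n) = id_on n"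
  using relabel_in_parts_on[OF permutes_inv[OF assms]] relabel_inv[OF assms]
  unfolding conj_map_def id_on_def by (intro restrict_ext) auto

lemma conj_map_funcset:
  assumes "\<sigma> permutes {..<n}" "f \<in> parts_on n \<rightarrow>\<^sub>E parts_on n"
  shows "conj_map n \<sigma> f \<in> parts_on n \<rightarrow>\<^sub>E parts_on n"
  using assms relabel_in_parts_on[OF permutes_inv[OF assms(1)]] relabel_in_parts_on[OF assms(1)]
  by (auto simp: conj_map_def PiE_iff)

lemma conj_map_labels:
  assumes "\<sigma> permutes {..<n}" "f \<in> labels n"
  shows "conj_map n \<sigma> f \<in> labels n"
proof -
  have f: "f \<in> parts_on n \<rightarrow>\<^sub>E parts_on n" "f \<noteq> id_on n" using assms by (auto simp: labels_def)
  moreover have "conj_map n \<sigma> f \<noteq> id_on n"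
    using conj_map_inv[OF assms(1) f(1)] f(2) conj_map_id_on[OF permutes_inv[OF assms(1)]] by metis
  ultimately show ?thesis
    unfolding labels_def using conj_map_funcset[OF assms(1) f(1)] by blast
qed

lemma conj_map_inv':
  assumes "\<sigma> permutes {..<n}" "f \<in> parts_on n \<rightarrow>\<^sub>E parts_on n"
  shows "conj_map n \<sigma> (conj_map n (inv \<sigma>) f) = f"
  using conj_map_inv[OF permutes_inv[OF assms(1)] assms(2)] permutes_inv_inv[OF assms(1)] by simp

text \<open>
  The first component of a mark counts time steps; the maps marked at a step act only if there is
  exactly one of them.
\<close>

primrec chain :: "(nat \<times> ('k part \<Rightarrow> 'k part)) set \<Rightarrow> nat \<Rightarrow> 'k part \<Rightarrow> 'k part" where
  "chain V 0 x = x"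
| "chain V (Suc l) x =
    (if is_singleton (V `` {l}) then the_elem (V `` {l}) (chain V l x) else chain V l x)"

lemma chain_in_parts_on:
  assumes "V \<subseteq> UNIV \<times> labels n" "x \<in> parts_on n"
  shows "chain V l x \<in> parts_on n"
proof (induction l)
  case (Suc l)
  have "the_elem (V `` {l}) \<in> labels n" if "is_singleton (V `` {l})"
    using that assms(1) by (auto simp: is_singleton_def)
  then show ?case using Suc labels_in by auto
qed (simp add: assms)

text \<open>Conjugation is injective on labels, so a step carries exactly one mark in
  \<open>V\<close> iff it does in the conjugated set, and the two acting maps are then
  conjugate.\<close>

lemma chain_relabel:
  assumes \<sigma>: "\<sigma> permutes {..<n}" and V: "V \<subseteq> UNIV \<times> labels n" and x: "x \<in> parts_on n"
  shows "chain (apsnd (conj_map n \<sigma>) ` V) l (relabel \<sigma> x) = relabel \<sigma> (chain V l x)"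
proof (induction l)
  case (Suc l)
  let ?c = "conj_map n \<sigma>"
  have im: "(apsnd ?c ` V) `` {l} = ?c ` (V `` {l})" by force
  have inj: "inj_on ?c (V `` {l})"
    by (rule inj_on_inverseI[where g = "conj_map n (inv \<sigma>)"])
      (use V in \<open>auto simp: labels_def intro!: conj_map_inv[OF \<sigma>]\<close>)
  show ?case
  proof (cases "is_singleton (V `` {l})")
    case True
    then obtain f where f: "V `` {l} = {f}" by (auto simp: is_singleton_def)
    then show ?thesis
      using conj_map_relabel[OF \<sigma> chain_in_parts_on[OF V x]] Suc by (simp add: im)
  next
    case False
    then have "\<not> is_singleton (?c ` (V `` {l}))"
      using card_image[OF inj] by (simp add: is_singleton_altdef)
    then show ?thesis using False Suc by (simp add: im)
  qed
qed simp

lemma id_on_funcset: "id_on n \<in> parts_on n \<rightarrow>\<^sub>E parts_on n"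
  by (auto simp: id_on_def)

lemma lip_restr_funcset:
  assumes "F \<in> lip_maps"
  shows "lip_restr n F \<in> parts_on n \<rightarrow>\<^sub>E parts_on n"
  using lip_restr_in[OF assms, of n] by (simp add: lip_maps_on_def)

section \<open>Driven paths\<close>

text \<open>Trades the left limit \<open>y\<close> of \<open>driven_path\<close> for the values at
  ordinary times \<open>s\<close> shortly before \<open>t\<close>. How close \<open>s\<close> must
  be depends on the level \<open>n\<close>.\<close>

lemma driven_path_left_limit:
  assumes "driven_path S x X" "t > 0"
  obtains l where "l < t" "\<And>s F. l < s \<Longrightarrow> s < t \<Longrightarrow> (t, F) \<in> S \<Longrightarrow> lip_restr n F \<noteq> id_on n \<Longrightarrow>
      part_restr n (X t) = lip_restr n F (part_restr n (X s))"
    "\<And>s. l < s \<Longrightarrow> s < t \<Longrightarrow> (\<nexists>F. (t, F) \<in> S \<and> lip_restr n F \<noteq> id_on n) \<Longrightarrow>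
      part_restr n (X t) = part_restr n (X s)"
proof -
  obtain y where y: "\<forall>\<^sub>F s in at_left t. part_restr n (X s) = y"
      "\<And>F. (t, F) \<in> S \<Longrightarrow> lip_restr n F \<noteq> id_on n \<Longrightarrow> part_restr n (X t) = lip_restr n F y"
      "(\<nexists>F. (t, F) \<in> S \<and> lip_restr n F \<noteq> id_on n) \<Longrightarrow> part_restr n (X t) = y"
    using assms unfolding driven_path_def by metis
  obtain l where "l < t" "\<And>s. l < s \<Longrightarrow> s < t \<Longrightarrow> part_restr n (X s) = y"
    using y(1) eventually_at_left[of "t - 1" t] by auto
  then show thesis using that[of l] y(2,3) by metis
qed

text \<open>The path at level \<open>n\<close> is locally constant on the connected interval
  \<open>{a..b}\<close>: right continuity covers the times after \<open>t\<close>, and the absence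
  of a jump at \<open>t\<close> those before it. Jump times are never enumerated. A point at time
  \<open>a\<close> itself is harmless, since only values from \<open>a\<close> on are
  compared.\<close>

lemma driven_path_constant:
  assumes path: "driven_path S x X" and "0 \<le> a" "a \<le> b"
    and quiet: "\<And>t F. (t, F) \<in> S \<Longrightarrow> a < t \<Longrightarrow> t \<le> b \<Longrightarrow> lip_restr n F = id_on n"
  shows "part_restr n (X b) = part_restr n (X a)"
proof -
  have "(\<lambda>t. part_restr n (X t)) constant_on {a..b}"
  proof (rule locally_constant_imp_constant)
    fix t assume t: "t \<in> {a..b}"
    have "\<forall>\<^sub>F s in at_right t. part_restr n (X s) = part_restr n (X t)"
      using path t \<open>0 \<le> a\<close> by (auto simp: driven_path_def)
    then obtain u where u: "t < u" "\<And>s. t < s \<Longrightarrow> s < u \<Longrightarrow> part_restr n (X s) = part_restr n (X t)"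
      using eventually_at_right[of t "t + 1"] by auto
    have "\<exists>l<t. \<forall>s. l < s \<and> s < t \<and> a \<le> s \<longrightarrow> part_restr n (X s) = part_restr n (X t)"
    proof (cases "t = a")
      \<comment> \<open>No part of the interval lies to the left of \<open>a\<close>, so any
        \<open>l\<close> below \<open>a\<close> will do.\<close>
      case True
      then show ?thesis by (intro exI[of _ "t - 1"]) auto
    next
      case False
      then have "0 < t" "\<nexists>F. (t, F) \<in> S \<and> lip_restr n F \<noteq> id_on n" using t quiet \<open>0 \<le> a\<close> by auto
      then show ?thesis using driven_path_left_limit[OF path, of t n] by metis
    qed
    then obtain l where l: "l < t"
        "\<And>s. l < s \<Longrightarrow> s < t \<Longrightarrow> a \<le> s \<Longrightarrow> part_restr n (X s) = part_restr n (X t)"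
      by auto
    have "\<forall>s\<in>{a..b} \<inter> {l<..<u}. part_restr n (X s) = part_restr n (X t)"
      using l u by (metis Int_iff atLeastAtMost_iff greaterThanLessThan_iff linorder_neqE)
    moreover have "openin (top_of_set {a..b}) ({a..b} \<inter> {l<..<u})"
      by (rule openin_open_Int) simp
    moreover have "t \<in> {a..b} \<inter> {l<..<u}" using t l(1) u(1) by simp
    ultimately show "\<exists>T. openin (top_of_set {a..b}) T \<and> t \<in> T \<and>
        (\<forall>s\<in>T. part_restr n (X s) = part_restr n (X t))"
      by blast
  qed simp
  then show ?thesis using \<open>a \<le> b\<close> unfolding constant_on_def
    by (metis atLeastAtMost_iff order_refl)
qed

text \<open>The path rests until a time \<open>r\<close> just before \<open>s\<close>, jumps by
  \<open>F\<close>, and rests again until \<open>b\<close>.\<close>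

lemma driven_path_jump:
  assumes path: "driven_path S x X" and "0 \<le> a" "a < s" "s \<le> b"
    and jump: "(s, F) \<in> S" "lip_restr n F \<noteq> id_on n"
    and unique: "\<And>t G. (t, G) \<in> S \<Longrightarrow> a < t \<Longrightarrow> t \<le> b \<Longrightarrow> lip_restr n G \<noteq> id_on n \<Longrightarrow> t = s"
  shows "part_restr n (X b) = lip_restr n F (part_restr n (X a))"
proof -
  have "0 < s" using \<open>0 \<le> a\<close> \<open>a < s\<close> by linarith
  then obtain l where l: "l < s"
      "\<And>r. l < r \<Longrightarrow> r < s \<Longrightarrow> part_restr n (X s) = lip_restr n F (part_restr n (X r))"
    using driven_path_left_limit[OF path, of s n] jump by metis
  obtain r where r: "max l a < r" "r < s" using l(1) \<open>a < s\<close> dense[of "max l a" s] by auto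
  have "lip_restr n G = id_on n" if "(t, G) \<in> S" "a < t" "t \<le> b" "t \<noteq> s" for t G
    using unique that by blast
  note quiet = this
  have "part_restr n (X r) = part_restr n (X a)"
    using path \<open>0 \<le> a\<close>
  proof (rule driven_path_constant)
    show "lip_restr n G = id_on n" if "(t, G) \<in> S" "a < t" "t \<le> r" for t G
      using quiet[OF that(1,2)] that(3) r(2) \<open>s \<le> b\<close> by linarith
  qed (use r in simp)
  moreover have "part_restr n (X b) = part_restr n (X s)"
    using path _ \<open>s \<le> b\<close>
  proof (rule driven_path_constant)
    show "lip_restr n G = id_on n" if "(t, G) \<in> S" "s < t" "t \<le> b" for t G
      using quiet[OF that(1) _ that(3)] that(2) \<open>a < s\<close> by linarith
  qed (use \<open>0 < s\<close> in simp)
  ultimately show ?thesis using l(2)[of r] r by simp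
qed

section \<open>Time cells and the marks hit in them\<close>

definition level :: "nat \<Rightarrow> ('k part \<Rightarrow> 'k part) \<Rightarrow> ('k part \<Rightarrow> 'k part) set" where
  "level n f = {F \<in> lip_maps. lip_restr n F = f}"

definition active :: "nat \<Rightarrow> ('k part \<Rightarrow> 'k part) set" where
  "active n = {F \<in> lip_maps. lip_restr n F \<noteq> id_on n}"

text \<open>The time intervals are open on the left: they tile the positive times, and a point at
  time \<open>0\<close>, which never moves a driven path, lies in no cell.\<close>

definition cell :: "nat \<Rightarrow> real \<Rightarrow> nat \<times> ('k part \<Rightarrow> 'k part) \<Rightarrow> (real \<times> ('k part \<Rightarrow> 'k part)) set" where
  "cell n h = (\<lambda>(j, f). {real j * h <.. real (Suc j) * h} \<times> level n f)"

definition hits :: "('i \<Rightarrow> 'a set) \<Rightarrow> 'i set \<Rightarrow> 'a set \<Rightarrow> 'i set" where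
  "hits B I S = {i \<in> I. S \<inter> B i \<noteq> {}}"

text \<open>A step with at most one active point leaves two cases. Without one, no label is hit and
  the path rests; with one point \<open>(s, F)\<close>, exactly the label
  \<open>lip_restr n F\<close> is hit and the path jumps by it. Hits are recorded up to a common
  horizon \<open>l'\<close>, so that one set of marks serves several observation times.\<close>

lemma driven_path_chain:
  assumes path: "driven_path S x X" and lip: "S \<subseteq> UNIV \<times> lip_maps" and h: "0 < h"
    and sparse: "\<And>j. j < l \<Longrightarrow> \<exists>p. S \<inter> ({real j * h <.. real (Suc j) * h} \<times> active n) \<subseteq> {p}"
    and "l \<le> l'"
  shows "part_restr n (X (real l * h)) =
    chain (hits (cell n h) ({..<l'} \<times> labels n) S) l (part_restr n x)"
  using sparse \<open>l \<le> l'\<close>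
proof (induction l)
  case 0
  then show ?case using path by (simp add: driven_path_def)
next
  case (Suc l)
  let ?V = "hits (cell n h) ({..<l'} \<times> labels n) S"
  define a b where "a = real l * h" and "b = real (Suc l) * h"
  have ab: "0 \<le> a" "a \<le> b" using h by (auto simp: a_def b_def algebra_simps)
  have V: "?V `` {l} = {f \<in> labels n. S \<inter> ({a<..b} \<times> level n f) \<noteq> {}}"
    using Suc.prems(2) by (auto simp: hits_def cell_def a_def b_def)
  have l: "\<exists>p. S \<inter> ({a<..b} \<times> active n) \<subseteq> {p}" using Suc.prems(1)[of l] by (simp only: a_def b_def lessI)
  have IH: "part_restr n (X a) = chain ?V l (part_restr n x)"
    using Suc by (simp add: a_def)
  have "part_restr n (X b) = chain ?V (Suc l) (part_restr n x)"
  proof (cases "S \<inter> ({a<..b} \<times> active n) = {}")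
    case True
    then have "?V `` {l} = {}" unfolding V by (auto simp: level_def active_def labels_def)
    moreover have "part_restr n (X b) = part_restr n (X a)"
      using path ab by (rule driven_path_constant) (use True lip in \<open>auto simp: active_def\<close>)
    ultimately show ?thesis using IH by (simp add: is_singleton_def)
  next
    case False
    moreover obtain p where "S \<inter> ({a<..b} \<times> active n) \<subseteq> {p}" using l by blast
    ultimately obtain s F where sF: "S \<inter> ({a<..b} \<times> active n) = {(s, F)}"
      by (metis subset_singletonD surj_pair)
    then have "(s, F) \<in> S \<inter> ({a<..b} \<times> active n)" by blast
    then have s: "(s, F) \<in> S" "a < s" "s \<le> b" "F \<in> active n" by auto
    have "t = s \<and> G = F" if "(t, G) \<in> S" "a < t" "t \<le> b" "lip_restr n G \<noteq> id_on n" for t G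
    proof -
      have "G \<in> lip_maps" using that(1) lip by blast
      then have "(t, G) \<in> S \<inter> ({a<..b} \<times> active n)" using that by (simp add: active_def)
      then show ?thesis unfolding sF by simp
    qed
    note unique = this
    have "?V `` {l} = {lip_restr n F}"
    proof (intro equalityI subsetI)
      fix f assume "f \<in> ?V `` {l}"
      then have f: "f \<in> labels n" "S \<inter> ({a<..b} \<times> level n f) \<noteq> {}" unfolding V by blast+
      then obtain t G where "(t, G) \<in> S" "a < t" "t \<le> b" "G \<in> level n f" by auto
      then show "f \<in> {lip_restr n F}"
        using unique[of t G] f(1) by (simp add: level_def labels_def)
    next
      fix f assume "f \<in> {lip_restr n F}"
      then have "F \<in> level n f" "f \<in> labels n"
        using s(4) lip_restr_funcset[of F n] by (simp_all add: level_def active_def labels_def)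
      then show "f \<in> ?V `` {l}" unfolding V using s(1-3) by fastforce
    qed
    moreover have "part_restr n (X b) = lip_restr n F (part_restr n (X a))"
    proof (rule driven_path_jump[OF path ab(1) s(2,3,1)])
      show "lip_restr n F \<noteq> id_on n" using s(4) by (simp add: active_def)
    qed (use unique in blast)
    ultimately show ?thesis using IH by simp
  qed
  then show ?case by (simp only: b_def)
qed

section \<open>Discretisation of the Poisson process\<close>

lemma (in prob_space) abs_prob_diff_le:
  assumes ev: "A \<in> events" "C \<in> events" "G \<in> events"
    and eq: "AE \<omega> in M. \<omega> \<in> G \<longrightarrow> (\<omega> \<in> A \<longleftrightarrow> \<omega> \<in> C)"
  shows "\<bar>prob A - prob C\<bar> \<le> 1 - prob G"
proof -
  have *: "prob A' \<le> prob C' + (1 - prob G)"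
    if "A' \<in> events" "C' \<in> events" "AE \<omega> in M. \<omega> \<in> G \<longrightarrow> (\<omega> \<in> A' \<longleftrightarrow> \<omega> \<in> C')" for A' C'
  proof -
    have "AE \<omega> in M. \<omega> \<in> A' \<longrightarrow> \<omega> \<in> C' \<union> (space M - G)"
      using that(3) AE_space by eventually_elim auto
    then have "prob A' \<le> prob (C' \<union> (space M - G))"
      by (rule finite_measure_mono_AE) (use that ev in auto)
    also have "\<dots> \<le> prob C' + prob (space M - G)"
      by (rule measure_Un_le) (use that ev in auto)
    finally show ?thesis using prob_compl[OF ev(3)] by simp
  qed
  have "AE \<omega> in M. \<omega> \<in> G \<longrightarrow> (\<omega> \<in> C \<longleftrightarrow> \<omega> \<in> A)"
    using eq by eventually_elim blast
  then show ?thesis using *[OF ev(1,2) eq] *[OF ev(2,1)] by linarith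
qed

text \<open>The bound has the shape of the discretisation error: \<open>c\<close> roundings to the
  grid and at most \<open>T / h + 1\<close> cells that may hold two points. Multiplied out, every
  summand contains a positive power of \<open>h\<close>.\<close>

lemma le_zero_if_le_mesh_error:
  fixes D :: real
  assumes "\<And>h. 0 < h \<Longrightarrow> D \<le> c * (r * h) + (T / h + 1) * (r * h)\<^sup>2"
  shows "D \<le> 0"
proof -
  have "((\<lambda>h. c * (r * h) + T * r\<^sup>2 * h + (r * h)\<^sup>2) \<longlongrightarrow> c * (r * 0) + T * r\<^sup>2 * 0 + (r * 0)\<^sup>2)
      (at_right 0)"
    by (intro tendsto_intros)
  moreover have "D \<le> c * (r * h) + T * r\<^sup>2 * h + (r * h)\<^sup>2" if "0 < h" for h
  proof -
    have "(T / h + 1) * (r * h)\<^sup>2 = T * r\<^sup>2 * h + (r * h)\<^sup>2"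
      using that by (simp add: power2_eq_square field_simps)
    then show ?thesis using assms[OF that] by simp
  qed
  then have "\<forall>\<^sub>F h in at_right 0. D \<le> c * (r * h) + T * r\<^sup>2 * h + (r * h)\<^sup>2"
    by (auto simp: eventually_at_filter)
  ultimately show ?thesis
    using tendsto_lowerbound[of _ _ "at_right (0::real)" D] by fastforce
qed

lemma emeasure_count_space_eq_1_iff:
  "emeasure (count_space UNIV) A = of_nat 1 \<longleftrightarrow> (\<exists>p. A = {p})"
proof
  assume *: "emeasure (count_space UNIV) A = of_nat 1"
  then have "card A = 1" by (cases "finite A") (auto simp: emeasure_count_space)
  then show "\<exists>p. A = {p}" by (rule card_1_singletonE) blast
qed (auto simp: emeasure_count_space)

lemma cell_eq: "cell n h (j, f) = {real j * h <.. real (Suc j) * h} \<times> level n f"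
  by (simp add: cell_def)

lemma disjoint_cells:
  assumes "0 < h"
  shows "disjoint_family_on (cell n h) I"
  unfolding disjoint_family_on_def
proof (intro ballI impI)
  fix p q :: "nat \<times> ('a part \<Rightarrow> 'a part)" assume "p \<noteq> q"
  obtain i f j g where pq: "p = (i, f)" "q = (j, g)" by fastforce
  show "cell n h p \<inter> cell n h q = {}"
  proof (cases "f = g")
    case False
    then show ?thesis by (auto simp: pq cell_def level_def)
  next
    case True
    have *: "{real a * h <.. real (Suc a) * h} \<inter> {real b * h <.. real (Suc b) * h} = {}"
      if "a < b" for a b :: nat
    proof -
      have "real (Suc a) * h \<le> real b * h" using that assms by (intro mult_right_mono) auto
      then show ?thesis by auto
    qed
    have "i \<noteq> j" using True \<open>p \<noteq> q\<close> pq by simp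
    then have "{real i * h <.. real (Suc i) * h} \<inter> {real j * h <.. real (Suc j) * h} = {}"
      using *[of i j] *[of j i] by (metis Int_commute linorder_neqE_nat)
    then show ?thesis unfolding pq cell_eq by blast
  qed
qed

text \<open>Only the driving noise is fixed here. Paths and initial states enter as hypotheses of
  single lemmas, so that the same noise can drive the whole system and a process with random initial
  state.\<close>

locale lipschitz_driver = prob_space P for P :: "'w measure" +
  fixes \<phi> :: "('k::finite part \<Rightarrow> 'k part) measure"
    and S :: "'w \<Rightarrow> (real \<times> ('k part \<Rightarrow> 'k part)) set"
  assumes directing: "directing_measure \<phi>"
    and poisson: "poisson_point_process P (restrict_space lborel {0..} \<Otimes>\<^sub>M \<phi>) S"
begin

abbreviation \<nu> :: "(real \<times> ('k part \<Rightarrow> 'k part)) measure" where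
  "\<nu> \<equiv> restrict_space lborel {0..} \<Otimes>\<^sub>M \<phi>"

section \<open>Measurability and finiteness at each level\<close>

lemma sets_phi: "sets \<phi> = sets lip_space"
  using directing by (simp add: directing_measure_def)

lemma space_phi: "space \<phi> = lip_maps"
  using sets_eq_imp_space_eq[OF sets_phi] by (simp add: space_lip_space)

lemma lip_restr_vimage_sets: "lip_restr n -` B \<inter> lip_maps \<in> sets \<phi>"
proof -
  have "lip_restr n -` (B \<inter> lip_maps_on n) \<inter> space lip_space \<in> sets lip_space"
    by (rule measurable_sets[OF lip_restr_measurable]) simp
  moreover have "lip_restr n -` (B \<inter> lip_maps_on n) \<inter> space lip_space = lip_restr n -` B \<inter> lip_maps"
    using lip_restr_in by (auto simp: space_lip_space)
  ultimately show ?thesis by (simp add: sets_phi)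
qed

lemma level_sets: "level n f \<in> sets \<phi>"
proof -
  have "level n f = lip_restr n -` {f} \<inter> lip_maps" by (auto simp: level_def)
  then show ?thesis using lip_restr_vimage_sets by metis
qed

lemma active_sets: "active n \<in> sets \<phi>"
proof -
  have "active n = lip_restr n -` (- {id_on n}) \<inter> lip_maps" by (auto simp: active_def)
  then show ?thesis using lip_restr_vimage_sets by metis
qed

lemma emeasure_active: "emeasure \<phi> (active n) < \<infinity>"
proof -
  have "lip_restr n \<in> \<phi> \<rightarrow>\<^sub>M count_space (lip_maps_on n)"
    using lip_restr_measurable measurable_cong_sets[OF sets_phi refl] by blast
  then have "emeasure (distr \<phi> (count_space (lip_maps_on n)) (lip_restr n)) (lip_maps_on n - {id_on n}) =
      emeasure \<phi> (lip_restr n -` (lip_maps_on n - {id_on n}) \<inter> space \<phi>)"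
    by (rule emeasure_distr) auto
  also have "lip_restr n -` (lip_maps_on n - {id_on n}) \<inter> space \<phi> = active n"
    using lip_restr_in by (auto simp: space_phi active_def)
  finally have "emeasure \<phi> (active n) =
      emeasure (distr \<phi> (count_space (lip_maps_on n)) (lip_restr n)) (lip_maps_on n - {id_on n})" ..
  also have "\<dots> < \<infinity>" using directing unfolding directing_measure_def by blast
  finally show ?thesis .
qed

lemma level_subset_active: "f \<in> labels n \<Longrightarrow> level n f \<subseteq> active n"
  by (auto simp: labels_def level_def active_def)

lemma emeasure_level: "f \<in> labels n \<Longrightarrow> emeasure \<phi> (level n f) < \<infinity>"
  using emeasure_mono[OF level_subset_active active_sets] emeasure_active[of n]
  by (metis infinity_ennreal_def order_le_less_trans)

lemma in_active:
  assumes "F \<in> lip_maps" "F \<noteq> id"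
  shows "\<exists>n. F \<in> active n"
proof -
  obtain x i where xi: "F x i \<noteq> x i" using assms(2) by (auto simp: fun_eq_iff)
  have "lip_restr (Suc i) F \<noteq> id_on (Suc i)"
  proof
    assume "lip_restr (Suc i) F = id_on (Suc i)"
    then have "lip_restr (Suc i) F (part_restr (Suc i) x) = part_restr (Suc i) x"
      by (simp add: id_on_def part_restr_in)
    then have "part_restr (Suc i) (F x) = part_restr (Suc i) x"
      by (simp add: lip_restr_part_restr[OF assms(1)])
    then show False using xi by (auto simp: part_restr_eq_iff)
  qed
  then show ?thesis using assms(1) by (auto simp: active_def)
qed

lemma emeasure_id: "emeasure \<phi> {id} = 0"
  using directing by (simp add: directing_measure_def)

lemma lip_restr_id: "lip_restr n id = id_on n"
  by (auto simp: lip_restr_def id_on_def part_restr_id)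

lemma id_lip: "id \<in> lip_maps"
  using act_lip[of op_id] by (simp add: act_op_id)

text \<open>The identity is the only Lipschitz map that is inactive at every level.\<close>

lemma id_sets: "{id} \<in> sets \<phi>"
proof -
  have "{id} = space \<phi> - (\<Union>n. active n)"
    using in_active id_lip by (force simp: space_phi active_def lip_restr_id)
  also have "\<dots> \<in> sets \<phi>" using active_sets by (intro sets.compl_sets sets.countable_UN) auto
  finally show ?thesis .
qed

text \<open>The sets \<open>active n\<close> have finite mass and miss only the identity, which is
  null. Sigma-finiteness is what allows the product intensity to be evaluated on rectangles.\<close>

sublocale phi: sigma_finite_measure \<phi>
proof
  have "\<Union> (insert {id} (range active)) = space \<phi>"
    using in_active id_lip by (force simp: space_phi active_def)
  then show "\<exists>A. countable A \<and> A \<subseteq> sets \<phi> \<and> \<Union> A = space \<phi> \<and> (\<forall>a\<in>A. emeasure \<phi> a \<noteq> \<infinity>)"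
    using active_sets id_sets emeasure_active emeasure_id
    by (intro exI[of _ "insert {id} (range active)"]) (auto simp: less_top[symmetric])
qed

lemma window_sets:
  assumes "0 \<le> a" "C \<in> sets \<phi>"
  shows "{a<..b} \<times> C \<in> sets \<nu>"
proof -
  have "{a<..b} = {0..} \<inter> {a<..b}" using assms by auto
  then have "{a<..b} \<in> sets (restrict_space lborel {0..})" by (auto simp: sets_restrict_space)
  then show ?thesis using assms by auto
qed

lemma emeasure_window:
  assumes "0 \<le> a" "a \<le> b" "C \<in> sets \<phi>"
  shows "emeasure \<nu> ({a<..b} \<times> C) = ennreal (b - a) * emeasure \<phi> C"
proof -
  have *: "{a<..b} = {0..} \<inter> {a<..b}" using assms by auto
  then have s: "{a<..b} \<in> sets (restrict_space lborel {0..})" by (auto simp: sets_restrict_space)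
  have "emeasure (restrict_space lborel {0..}) {a<..b} = ennreal (b - a)"
    using * assms by (subst emeasure_restrict_space) auto
  then show ?thesis using phi.emeasure_pair_measure_Times[OF s assms(3)] by simp
qed

lemma emeasure_window_finite:
  assumes "0 \<le> a" "a \<le> b" "C \<in> sets \<phi>" "C \<subseteq> active n"
  shows "emeasure \<nu> ({a<..b} \<times> C) < \<infinity>"
proof -
  have "emeasure \<phi> C < \<infinity>"
    using emeasure_mono[OF assms(4) active_sets] emeasure_active[of n]
    by (metis infinity_ennreal_def order_le_less_trans)
  then show ?thesis using assms by (simp add: emeasure_window ennreal_mult_less_top)
qed

lemma measure_window:
  assumes "0 \<le> a" "a \<le> b" "C \<in> sets \<phi>"
  shows "measure \<nu> ({a<..b} \<times> C) = (b - a) * measure \<phi> C"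
  using assms by (simp add: measure_def emeasure_window enn2real_mult)

section \<open>Counting and hitting events of the Poisson process\<close>

lemma points_measurable: "S \<in> P \<rightarrow>\<^sub>M config_space \<nu>"
  using poisson by (simp add: poisson_point_process_def)

lemma space_config: "space (config_space \<nu>) = Pow (space \<nu>)"
  unfolding config_space_def by (rule space_measure_of) auto

lemma count_sets:
  assumes "B \<in> sets \<nu>"
  shows "{C \<in> Pow (space \<nu>). emeasure (count_space UNIV) (C \<inter> B) = of_nat m} \<in> sets (config_space \<nu>)"
  unfolding config_space_def using assms
  by (subst sets_measure_of) (auto intro!: sigma_sets.Basic)

lemma points_lip: "\<omega> \<in> space P \<Longrightarrow> S \<omega> \<subseteq> UNIV \<times> lip_maps"
  using measurable_space[OF points_measurable]
  by (force simp: space_config space_pair_measure space_phi)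

lemma count_event:
  assumes "B \<in> sets \<nu>"
  shows "{\<omega> \<in> space P. emeasure (count_space UNIV) (S \<omega> \<inter> B) = of_nat m} \<in> events"
proof -
  have "{\<omega> \<in> space P. emeasure (count_space UNIV) (S \<omega> \<inter> B) = of_nat m} =
      S -` {C \<in> Pow (space \<nu>). emeasure (count_space UNIV) (C \<inter> B) = of_nat m} \<inter> space P"
    using measurable_space[OF points_measurable] by (auto simp: space_config)
  then show ?thesis using measurable_sets[OF points_measurable count_sets[OF assms]] by simp
qed

lemma prob_count:
  assumes "B \<in> sets \<nu>" "emeasure \<nu> B < \<infinity>"
  shows "prob {\<omega> \<in> space P. emeasure (count_space UNIV) (S \<omega> \<inter> B) = of_nat m} =
    exp (- measure \<nu> B) * measure \<nu> B ^ m / fact m"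
  using poisson assms by (auto simp: poisson_point_process_def)

lemma empty_event:
  assumes "B \<in> sets \<nu>"
  shows "{\<omega> \<in> space P. S \<omega> \<inter> B = {}} \<in> events"
  using count_event[OF assms, of 0] by (simp add: emeasure_count_space_eq_0)

lemma prob_empty:
  assumes "B \<in> sets \<nu>" "emeasure \<nu> B < \<infinity>"
  shows "prob {\<omega> \<in> space P. S \<omega> \<inter> B = {}} = exp (- measure \<nu> B)"
  using prob_count[OF assms, of 0] by (simp add: emeasure_count_space_eq_0)

lemma sparse_event_eq:
  "{\<omega> \<in> space P. \<exists>p. S \<omega> \<inter> B \<subseteq> {p}} =
    {\<omega> \<in> space P. emeasure (count_space UNIV) (S \<omega> \<inter> B) = of_nat 0} \<union>
    {\<omega> \<in> space P. emeasure (count_space UNIV) (S \<omega> \<inter> B) = of_nat 1}"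
  unfolding emeasure_count_space_eq_1_iff by (auto simp: emeasure_count_space_eq_0 subset_singleton_iff)

lemma sparse_event:
  assumes "B \<in> sets \<nu>"
  shows "{\<omega> \<in> space P. \<exists>p. S \<omega> \<inter> B \<subseteq> {p}} \<in> events"
  unfolding sparse_event_eq using count_event[OF assms] by (rule sets.Un) (rule count_event[OF assms])

text \<open>A Poisson variable of mean \<open>c\<close> is at least 2 with probability
  \<open>1 - (1 + c) * exp (- c)\<close>, and \<open>exp (- c) \<ge> 1 - c\<close> bounds this by
  \<open>1 - (1 + c) * (1 - c) = c^2\<close>.\<close>

lemma prob_not_sparse:
  assumes "B \<in> sets \<nu>" "emeasure \<nu> B < \<infinity>"
  shows "prob (space P - {\<omega> \<in> space P. \<exists>p. S \<omega> \<inter> B \<subseteq> {p}}) \<le> (measure \<nu> B)\<^sup>2"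
proof -
  let ?c = "measure \<nu> B"
  have "prob {\<omega> \<in> space P. \<exists>p. S \<omega> \<inter> B \<subseteq> {p}} = exp (- ?c) + exp (- ?c) * ?c"
    unfolding sparse_event_eq
    by (subst finite_measure_Union)
      (use count_event[OF assms(1), of 0] count_event[OF assms(1), of 1]
        prob_count[OF assms, of 0] prob_count[OF assms, of 1] in auto)
  moreover have "(1 - ?c) * (1 + ?c) \<le> exp (- ?c) * (1 + ?c)"
    using exp_ge_add_one_self[of "- ?c"] by (intro mult_right_mono) auto
  ultimately show ?thesis
    using prob_compl[OF sparse_event[OF assms(1)]] by (simp add: algebra_simps power2_eq_square)
qed

text \<open>The predicate \<open>Q\<close> may be arbitrary because only finitely many hit patterns
  \<open>K\<close> exist, each of them a finite combination of emptiness conditions. Measurability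
  is shown on configurations, not just on \<open>P\<close>, because independence from a random
  initial state is stated in terms of \<open>config_space\<close>.\<close>

lemma hits_config_sets:
  assumes "finite I" "\<And>i. i \<in> I \<Longrightarrow> B i \<in> sets \<nu>"
  shows "{C \<in> Pow (space \<nu>). Q (hits B I C)} \<in> sets (config_space \<nu>)"
proof -
  let ?E = "\<lambda>i. {C \<in> space (config_space \<nu>). C \<inter> B i = {}}"
  have E: "?E i \<in> sets (config_space \<nu>)" if "i \<in> I" for i
    using count_sets[OF assms(2)[OF that], of 0] by (simp add: emeasure_count_space_eq_0 space_config)
  have E': "{C \<in> space (config_space \<nu>). (C \<inter> B i = {}) = (i \<notin> K)} \<in> sets (config_space \<nu>)"
    if "i \<in> I" for i K
    using E[OF that] sets.sets_Collect_neg[OF E[OF that]] by (cases "i \<in> K") auto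
  have "{C \<in> space (config_space \<nu>). \<exists>K\<in>{K \<in> Pow I. Q K}. \<forall>i\<in>I. (C \<inter> B i = {}) = (i \<notin> K)}
      \<in> sets (config_space \<nu>)"
    using assms(1) by (intro sets.sets_Collect_finite_Ex sets.sets_Collect_finite_All E') auto
  also have "{C \<in> space (config_space \<nu>). \<exists>K\<in>{K \<in> Pow I. Q K}. \<forall>i\<in>I. (C \<inter> B i = {}) = (i \<notin> K)} =
      {C \<in> Pow (space \<nu>). Q (hits B I C)}"
  proof -
    have "(\<exists>K\<in>{K \<in> Pow I. Q K}. \<forall>i\<in>I. (C \<inter> B i = {}) = (i \<notin> K)) \<longleftrightarrow> Q (hits B I C)" for C
    proof
      assume "\<exists>K\<in>{K \<in> Pow I. Q K}. \<forall>i\<in>I. (C \<inter> B i = {}) = (i \<notin> K)"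
      then obtain K where K: "K \<subseteq> I" "Q K" "\<forall>i\<in>I. (C \<inter> B i = {}) = (i \<notin> K)" by blast
      then have "hits B I C = K" by (auto simp: hits_def)
      then show "Q (hits B I C)" using K by simp
    next
      assume "Q (hits B I C)"
      then show "\<exists>K\<in>{K \<in> Pow I. Q K}. \<forall>i\<in>I. (C \<inter> B i = {}) = (i \<notin> K)"
        by (intro bexI[of _ "hits B I C"]) (auto simp: hits_def)
    qed
    then show ?thesis by (simp add: space_config)
  qed
  finally show ?thesis .
qed

lemma hits_event_eq:
  "{\<omega> \<in> space P. Q (hits B I (S \<omega>))} = S -` {C \<in> Pow (space \<nu>). Q (hits B I C)} \<inter> space P"
  using measurable_space[OF points_measurable] by (auto simp: space_config)

lemma hits_event:
  assumes "finite I" "\<And>i. i \<in> I \<Longrightarrow> B i \<in> sets \<nu>"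
  shows "{\<omega> \<in> space P. Q (hits B I (S \<omega>))} \<in> events"
  unfolding hits_event_eq by (rule measurable_sets[OF points_measurable hits_config_sets[OF assms]])

text \<open>Counts in disjoint sets are independent, and each vanishes with probability
  \<open>exp (- measure \<nu> (B i))\<close>. The enumeration \<open>e\<close> matches the families
  indexed by initial segments for which \<open>poisson_point_process\<close> provides
  independence.\<close>

lemma prob_hits_eq:
  assumes I: "finite I" "disjoint_family_on B I" and K: "K \<subseteq> I"
    and B: "\<And>i. i \<in> I \<Longrightarrow> B i \<in> sets \<nu>" "\<And>i. i \<in> I \<Longrightarrow> emeasure \<nu> (B i) < \<infinity>"
  shows "prob {\<omega> \<in> space P. hits B I (S \<omega>) = K} =
    (\<Prod>i\<in>I. if i \<in> K then 1 - exp (- measure \<nu> (B i)) else exp (- measure \<nu> (B i)))"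
proof (cases "I = {}")
  \<comment> \<open>Over no indices the intersection below would be \<open>UNIV\<close> instead of
    \<open>space P\<close>.\<close>
  case True
  then show ?thesis using K prob_space by (simp add: hits_def)
next
  case False
  obtain e where e: "bij_betw e {..<card I} I"
    using ex_bij_betw_nat_finite[OF I(1)] by (auto simp: atLeast0LessThan)
  let ?L = "{..<card I}"
  have L: "?L \<noteq> {}" using False I(1) by (simp add: lessThan_empty_iff)
  have eI: "e j \<in> I" if "j \<in> ?L" for j using e that by (auto simp: bij_betw_def)
  define X where "X j \<omega> = emeasure (count_space UNIV) (S \<omega> \<inter> B (e j))" for j \<omega>
  \<comment> \<open>A hit means any nonzero count, infinite ones included; a miss means count
    zero.\<close>
  define A where "A j = (if e j \<in> K then - {0} else {0::ennreal})" for j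
  have "disjoint_family_on (\<lambda>j. B (e j)) ?L"
    unfolding disjoint_family_on_def
  proof (intro ballI impI)
    fix i j assume "i \<in> ?L" "j \<in> ?L" "i \<noteq> j"
    then have "e i \<in> I" "e j \<in> I" "e i \<noteq> e j"
      using e by (auto simp: bij_betw_def inj_on_def)
    then show "B (e i) \<inter> B (e j) = {}" using I(2) by (auto simp: disjoint_family_on_def)
  qed
  then have "indep_vars (\<lambda>_. borel) X ?L"
    using poisson B(1) eI unfolding poisson_point_process_def X_def by auto
  then have "prob (\<Inter>j\<in>?L. X j -` A j \<inter> space P) = (\<Prod>j\<in>?L. prob (X j -` A j \<inter> space P))"
    by (rule indep_varsD_finite) (use L in \<open>auto simp: A_def\<close>)
  also have "(\<Inter>j\<in>?L. X j -` A j \<inter> space P) = {\<omega> \<in> space P. hits B I (S \<omega>) = K}"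
  proof -
    have "(\<forall>j\<in>?L. X j \<omega> \<in> A j) \<longleftrightarrow> hits B I (S \<omega>) = K" for \<omega>
    proof -
      have "(\<forall>j\<in>?L. X j \<omega> \<in> A j) \<longleftrightarrow> (\<forall>j\<in>?L. (S \<omega> \<inter> B (e j) \<noteq> {}) = (e j \<in> K))"
        by (intro ball_cong refl) (auto simp: X_def A_def emeasure_count_space_eq_0)
      also have "\<dots> \<longleftrightarrow> (\<forall>i\<in>I. (S \<omega> \<inter> B i \<noteq> {}) = (i \<in> K))"
        using e by (metis bij_betw_imp_surj_on image_iff)
      also have "\<dots> \<longleftrightarrow> hits B I (S \<omega>) = K" using K by (auto simp: hits_def)
      finally show ?thesis .
    qed
    then show ?thesis using L by auto
  qed
  also have "(\<Prod>j\<in>?L. prob (X j -` A j \<inter> space P)) =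
      (\<Prod>j\<in>?L. if e j \<in> K then 1 - exp (- measure \<nu> (B (e j))) else exp (- measure \<nu> (B (e j))))"
  proof (rule prod.cong[OF refl])
    fix j assume j: "j \<in> ?L"
    let ?E = "{\<omega> \<in> space P. S \<omega> \<inter> B (e j) = {}}"
    note E = empty_event[OF B(1)[OF eI[OF j]]] prob_empty[OF B(1)[OF eI[OF j]] B(2)[OF eI[OF j]]]
    have "X j -` A j \<inter> space P = (if e j \<in> K then space P - ?E else ?E)"
      by (auto simp: X_def A_def emeasure_count_space_eq_0)
    then show "prob (X j -` A j \<inter> space P) =
        (if e j \<in> K then 1 - exp (- measure \<nu> (B (e j))) else exp (- measure \<nu> (B (e j))))"
      using prob_compl[OF E(1)] E(2) by simp
  qed
  also have "\<dots> = (\<Prod>i\<in>I. if i \<in> K then 1 - exp (- measure \<nu> (B i)) else exp (- measure \<nu> (B i)))"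
    by (rule prod.reindex_bij_betw[OF e])
  finally show ?thesis .
qed

text \<open>By \<open>prob_hits_eq\<close> the law of the hit pattern depends on the sets only
  through their intensities; an event \<open>Q\<close> is a finite disjoint union of
  patterns.\<close>

lemma prob_hits_cong:
  assumes I: "finite I" "disjoint_family_on B I" "disjoint_family_on B' I"
    and B: "\<And>i. i \<in> I \<Longrightarrow> B i \<in> sets \<nu>" "\<And>i. i \<in> I \<Longrightarrow> emeasure \<nu> (B i) < \<infinity>"
    and B': "\<And>i. i \<in> I \<Longrightarrow> B' i \<in> sets \<nu>" "\<And>i. i \<in> I \<Longrightarrow> emeasure \<nu> (B' i) < \<infinity>"
    and eq: "\<And>i. i \<in> I \<Longrightarrow> measure \<nu> (B i) = measure \<nu> (B' i)"
  shows "prob {\<omega> \<in> space P. Q (hits B I (S \<omega>))} = prob {\<omega> \<in> space P. Q (hits B' I (S \<omega>))}"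
proof -
  have *: "prob {\<omega> \<in> space P. Q (hits D I (S \<omega>))} =
      (\<Sum>K\<in>{K \<in> Pow I. Q K}. prob {\<omega> \<in> space P. hits D I (S \<omega>) = K})"
    if D: "\<And>i. i \<in> I \<Longrightarrow> D i \<in> sets \<nu>" for D
  proof -
    have "{\<omega> \<in> space P. Q (hits D I (S \<omega>))} =
        (\<Union>K\<in>{K \<in> Pow I. Q K}. {\<omega> \<in> space P. hits D I (S \<omega>) = K})"
      by (auto simp: hits_def)
    also have "prob \<dots> = (\<Sum>K\<in>{K \<in> Pow I. Q K}. prob {\<omega> \<in> space P. hits D I (S \<omega>) = K})"
      by (rule finite_measure_finite_Union)
        (use I(1) hits_event[of I D, OF I(1) D] in \<open>auto simp: disjoint_family_on_def\<close>)
    finally show ?thesis .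
  qed
  have "prob {\<omega> \<in> space P. hits B I (S \<omega>) = K} = prob {\<omega> \<in> space P. hits B' I (S \<omega>) = K}"
    if "K \<in> {K \<in> Pow I. Q K}" for K
    using that I B B' by (simp add: prob_hits_eq) (rule prod.cong, simp_all add: eq)
  then show ?thesis using *[of B] *[of B'] B(1) B'(1) by simp
qed

section \<open>Approximating paths by chains of hits\<close>

abbreviation total_rate :: "nat \<Rightarrow> real" where
  "total_rate n \<equiv> measure \<phi> (active n)"

abbreviation hit_cells :: "nat \<Rightarrow> real \<Rightarrow> nat \<Rightarrow> 'w \<Rightarrow> (nat \<times> ('k part \<Rightarrow> 'k part)) set" where
  "hit_cells n h l \<omega> \<equiv> hits (cell n h) ({..<l} \<times> labels n) (S \<omega>)"

text \<open>The good event \<open>G\<close> excludes two active points in one cell, of probability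
  at most \<open>(r h)^2\<close> per cell, and an active point between \<open>t i\<close> and the
  next grid time, of probability at most the rate times the gap. The gaps are kept explicit because
  they vanish at grid times, which leaves a second-order error when \<open>t i = h\<close>.\<close>

lemma driven_path_chain_whp:
  fixes X :: "'i \<Rightarrow> real \<Rightarrow> 'w \<Rightarrow> 'k part" and x :: "'i \<Rightarrow> 'w \<Rightarrow> 'k part"
  assumes "finite J" "0 < h" and times: "\<forall>i\<in>J. 0 \<le> t i \<and> t i \<le> T"
    and path: "\<forall>i\<in>J. AE \<omega> in P. driven_path (S \<omega>) (x i \<omega>) (\<lambda>s. X i s \<omega>)"
    and "0 \<le> T"
  shows "\<exists>G. G \<in> events \<and>
    1 - prob G \<le> (\<Sum>i\<in>J. (real (nat \<lceil>t i / h\<rceil>) * h - t i) * total_rate n) +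
       (T / h + 1) * (total_rate n * h)\<^sup>2 \<and>
    (AE \<omega> in P. \<omega> \<in> G \<longrightarrow> (\<forall>i\<in>J. part_restr n (X i (t i) \<omega>) =
       chain (hit_cells n h (nat \<lceil>T / h\<rceil>) \<omega>) (nat \<lceil>t i / h\<rceil>) (part_restr n (x i \<omega>))))"
proof -
  let ?r = "total_rate n"
  have t: "0 \<le> t i" "t i \<le> T" if "i \<in> J" for i using times that by auto
  define l where "l = nat \<lceil>T / h\<rceil>"
  define k where "k i = nat \<lceil>t i / h\<rceil>" for i
  have k: "k i \<le> l" "t i \<le> real (k i) * h" if "i \<in> J" for i
  proof -
    have "t i / h \<le> T / h" using t[OF that] \<open>0 < h\<close> by (simp add: divide_right_mono)
    then show "k i \<le> l" unfolding k_def l_def by (intro nat_mono ceiling_mono)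
    have "0 \<le> t i / h" using t[OF that] \<open>0 < h\<close> by simp
    then have "t i / h \<le> real (k i)" unfolding k_def by linarith
    then show "t i \<le> real (k i) * h" using \<open>0 < h\<close> by (simp add: field_simps)
  qed
  have l: "real l \<le> T / h + 1"
  proof -
    have "0 \<le> T / h" using \<open>0 \<le> T\<close> \<open>0 < h\<close> by simp
    then show ?thesis unfolding l_def by linarith
  qed
  \<comment> \<open>\<open>W j\<close> is the \<open>j\<close>-th time cell with all active maps,
    \<open>V i\<close> the gap from \<open>t i\<close> up to the grid. On \<open>G\<close> the
    former hold at most one point and the latter none.\<close>
  define W where "W j = {real j * h <.. real (Suc j) * h} \<times> (active n :: ('k part \<Rightarrow> 'k part) set)" for j
  define V where "V i = {t i <.. real (k i) * h} \<times> (active n :: ('k part \<Rightarrow> 'k part) set)" for i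
  have W: "W j \<in> sets \<nu>" "emeasure \<nu> (W j) < \<infinity>" "measure \<nu> (W j) = h * ?r" for j
  proof -
    have j: "0 \<le> real j * h" "real j * h \<le> real (Suc j) * h" "real (Suc j) * h - real j * h = h"
      using \<open>0 < h\<close> by (auto simp: algebra_simps)
    show "W j \<in> sets \<nu>" "emeasure \<nu> (W j) < \<infinity>" "measure \<nu> (W j) = h * ?r"
      unfolding W_def using window_sets[OF j(1) active_sets]
        emeasure_window_finite[OF j(1,2) active_sets order_refl] measure_window[OF j(1,2) active_sets] j(3)
      by simp_all
  qed
  have V: "V i \<in> sets \<nu>" "emeasure \<nu> (V i) < \<infinity>" "measure \<nu> (V i) = (real (k i) * h - t i) * ?r" if i: "i \<in> J" for i
  proof -
    show "V i \<in> sets \<nu>" "emeasure \<nu> (V i) < \<infinity>"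
      unfolding V_def using window_sets[OF t(1)[OF i] active_sets]
        emeasure_window_finite[OF t(1)[OF i] k(2)[OF i] active_sets order_refl] by simp_all
    show "measure \<nu> (V i) = (real (k i) * h - t i) * ?r"
      unfolding V_def by (rule measure_window[OF t(1)[OF i] k(2)[OF i] active_sets])
  qed
  define E where "E j = {\<omega> \<in> space P. \<exists>p. S \<omega> \<inter> W j \<subseteq> {p}}" for j
  define D where "D i = {\<omega> \<in> space P. S \<omega> \<inter> V i = {}}" for i
  have E: "E j \<in> events" "prob (space P - E j) \<le> (?r * h)\<^sup>2" for j
    unfolding E_def using sparse_event[OF W(1)] prob_not_sparse[OF W(1,2), of j] W(3)
    by (simp_all add: mult.commute)
  have D: "D i \<in> events" "prob (space P - D i) \<le> (real (k i) * h - t i) * ?r" if "i \<in> J" for i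
  proof -
    show De: "D i \<in> events" unfolding D_def by (rule empty_event[OF V(1)[OF that]])
    have "prob (D i) = exp (- measure \<nu> (V i))"
      unfolding D_def by (rule prob_empty[OF V(1,2)[OF that]])
    then show "prob (space P - D i) \<le> (real (k i) * h - t i) * ?r"
      using prob_compl[OF De] exp_ge_add_one_self[of "- measure \<nu> (V i)"] V(3)[OF that] by linarith
  qed
  define G where "G = space P - ((\<Union>j<l. space P - E j) \<union> (\<Union>i\<in>J. space P - D i))"
  have bad: "(\<Union>j<l. space P - E j) \<in> events" "(\<Union>i\<in>J. space P - D i) \<in> events"
    using E(1) D(1) \<open>finite J\<close> by (intro sets.finite_UN sets.compl_sets; simp)+
  have G: "G \<in> events" unfolding G_def using bad by auto
  have "1 - prob G = prob ((\<Union>j<l. space P - E j) \<union> (\<Union>i\<in>J. space P - D i))"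
    unfolding G_def using prob_compl[OF sets.Un[OF bad]] by simp
  also have "\<dots> \<le> prob (\<Union>j<l. space P - E j) + prob (\<Union>i\<in>J. space P - D i)"
    using bad by (rule measure_Un_le)
  also have "\<dots> \<le> (\<Sum>j<l. prob (space P - E j)) + (\<Sum>i\<in>J. prob (space P - D i))"
    using E(1) D(1) \<open>finite J\<close> by (intro add_mono finite_measure_subadditive_finite) auto
  also have "\<dots> \<le> (\<Sum>j<l. (?r * h)\<^sup>2) + (\<Sum>i\<in>J. (real (k i) * h - t i) * ?r)"
    using E(2) D(2) by (intro add_mono sum_mono) auto
  also have "\<dots> \<le> (T / h + 1) * (?r * h)\<^sup>2 + (\<Sum>i\<in>J. (real (k i) * h - t i) * ?r)"
    using l by (simp add: mult_right_mono)
  finally have bound: "1 - prob G \<le> (\<Sum>i\<in>J. (real (k i) * h - t i) * ?r) + (T / h + 1) * (?r * h)\<^sup>2"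
    by simp
  have "AE \<omega> in P. \<forall>i\<in>J. driven_path (S \<omega>) (x i \<omega>) (\<lambda>s. X i s \<omega>)"
    using path \<open>finite J\<close> by (simp add: AE_finite_all)
  then have "AE \<omega> in P. \<omega> \<in> G \<longrightarrow> (\<forall>i\<in>J. part_restr n (X i (t i) \<omega>) =
       chain (hit_cells n h l \<omega>) (k i) (part_restr n (x i \<omega>)))"
  proof eventually_elim
    case (elim \<omega>)
    show ?case
    proof (intro impI ballI)
      fix i assume \<omega>: "\<omega> \<in> G" and i: "i \<in> J"
      have p: "driven_path (S \<omega>) (x i \<omega>) (\<lambda>s. X i s \<omega>)" using elim i by blast
      have lip: "S \<omega> \<subseteq> UNIV \<times> lip_maps" using \<omega> points_lip by (simp add: G_def)
      have V0: "S \<omega> \<inter> V i = {}" using \<omega> i by (auto simp: G_def D_def)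
      have "part_restr n (X i (real (k i) * h) \<omega>) = part_restr n (X i (t i) \<omega>)"
      proof (rule driven_path_constant[OF p t(1)[OF i] k(2)[OF i]])
        fix s F assume s: "(s, F) \<in> S \<omega>" "t i < s" "s \<le> real (k i) * h"
        have "F \<in> lip_maps" using s(1) lip by blast
        moreover have "(s, F) \<notin> V i" using V0 s(1) by blast
        ultimately show "lip_restr n F = id_on n" using s(2,3) by (simp add: V_def active_def)
      qed
      moreover have "part_restr n (X i (real (k i) * h) \<omega>) =
          chain (hit_cells n h l \<omega>) (k i) (part_restr n (x i \<omega>))"
      proof (rule driven_path_chain[OF p lip \<open>0 < h\<close> _ k(1)[OF i]])
        fix j assume "j < k i"
        then have "j < l" using k(1)[OF i] by simp
        then show "\<exists>p. S \<omega> \<inter> ({real j * h <.. real (Suc j) * h} \<times> active n) \<subseteq> {p}"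
          using \<omega> unfolding G_def E_def W_def by blast
      qed
      ultimately show "part_restr n (X i (t i) \<omega>) =
          chain (hit_cells n h l \<omega>) (k i) (part_restr n (x i \<omega>))" by simp
    qed
  qed
  then show ?thesis
    using G bound unfolding l_def k_def by (intro exI[of _ G] conjI)
qed

text \<open>Every gap to the next grid time is at most \<open>h\<close>.\<close>

lemma driven_path_chain_whp_uniform:
  fixes X :: "'i \<Rightarrow> real \<Rightarrow> 'w \<Rightarrow> 'k part" and x :: "'i \<Rightarrow> 'w \<Rightarrow> 'k part"
  assumes "finite J" "0 < h" and times: "\<forall>i\<in>J. 0 \<le> t i \<and> t i \<le> T"
    and path: "\<forall>i\<in>J. AE \<omega> in P. driven_path (S \<omega>) (x i \<omega>) (\<lambda>s. X i s \<omega>)"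
    and "0 \<le> T"
  shows "\<exists>G. G \<in> events \<and>
    1 - prob G \<le> card J * (total_rate n * h) + (T / h + 1) * (total_rate n * h)\<^sup>2 \<and>
    (AE \<omega> in P. \<omega> \<in> G \<longrightarrow> (\<forall>i\<in>J. part_restr n (X i (t i) \<omega>) =
       chain (hit_cells n h (nat \<lceil>T / h\<rceil>) \<omega>) (nat \<lceil>t i / h\<rceil>) (part_restr n (x i \<omega>))))"
proof -
  obtain G where G: "G \<in> events"
    "1 - prob G \<le> (\<Sum>i\<in>J. (real (nat \<lceil>t i / h\<rceil>) * h - t i) * total_rate n) +
       (T / h + 1) * (total_rate n * h)\<^sup>2"
    "AE \<omega> in P. \<omega> \<in> G \<longrightarrow> (\<forall>i\<in>J. part_restr n (X i (t i) \<omega>) =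
       chain (hit_cells n h (nat \<lceil>T / h\<rceil>) \<omega>) (nat \<lceil>t i / h\<rceil>) (part_restr n (x i \<omega>)))"
    using driven_path_chain_whp[where J = J and h = h and t = t and T = T and X = X and x = x and n = n,
        OF assms] by (elim exE conjE)
  have "(\<Sum>i\<in>J. (real (nat \<lceil>t i / h\<rceil>) * h - t i) * total_rate n) \<le> (\<Sum>i\<in>J. h * total_rate n)"
  proof (rule sum_mono, rule mult_right_mono)
    fix i assume "i \<in> J"
    then have "0 \<le> t i / h" using times \<open>0 < h\<close> by simp
    then have "real (nat \<lceil>t i / h\<rceil>) \<le> t i / h + 1" by linarith
    then have "real (nat \<lceil>t i / h\<rceil>) * h \<le> (t i / h + 1) * h"
      using \<open>0 < h\<close> by (intro mult_right_mono) auto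
    also have "(t i / h + 1) * h = t i + h" using \<open>0 < h\<close> by (simp add: field_simps)
    finally show "real (nat \<lceil>t i / h\<rceil>) * h - t i \<le> h" by simp
  qed simp
  then have "1 - prob G \<le> card J * (total_rate n * h) + (T / h + 1) * (total_rate n * h)\<^sup>2"
    using G(2) by (simp add: mult.commute)
  then show ?thesis using G(1,3) by (intro exI[of _ G] conjI)
qed

lemma cell_props:
  assumes "0 < h" "f \<in> labels n"
  shows "cell n h (j, f) \<in> sets \<nu>" "emeasure \<nu> (cell n h (j, f)) < \<infinity>"
    "measure \<nu> (cell n h (j, f)) = h * measure \<phi> (level n f)"
proof -
  have j: "0 \<le> real j * h" "real j * h \<le> real (Suc j) * h" "real (Suc j) * h - real j * h = h"
    using \<open>0 < h\<close> by (auto simp: algebra_simps)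
  show "cell n h (j, f) \<in> sets \<nu>" "emeasure \<nu> (cell n h (j, f)) < \<infinity>"
    "measure \<nu> (cell n h (j, f)) = h * measure \<phi> (level n f)"
    unfolding cell_eq using window_sets[OF j(1) level_sets]
      emeasure_window_finite[OF j(1,2) level_sets level_subset_active[OF assms(2)]]
      measure_window[OF j(1,2) level_sets] j(3)
    by simp_all
qed

lemma hit_cells_event:
  assumes "0 < h"
  shows "{\<omega> \<in> space P. Q (hit_cells n h l \<omega>)} \<in> events"
  by (rule hits_event) (use cell_props[OF assms] in \<open>auto simp: finite_labels\<close>)

end

section \<open>Finite-dimensional laws\<close>

lemma space_part_space: "space part_space = UNIV"
  unfolding part_space_def by (rule space_measure_of) auto

lemma part_restr_vimage_sets: "part_restr n -` B \<in> sets part_space"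
proof -
  have "part_restr n -` B = part_restr n -` (B \<inter> parts_on n)" using part_restr_in by auto
  then have "part_restr n -` B \<in> {part_restr n -` B | n B. B \<subseteq> parts_on n}"
    by (intro CollectI exI[of _ n] exI[of _ "B \<inter> parts_on n"]) simp
  then show ?thesis unfolding part_space_def by (subst sets_measure_of) auto
qed

lemma part_restr_event:
  assumes "X \<in> M \<rightarrow>\<^sub>M part_space"
  shows "{\<omega> \<in> space M. part_restr n (X \<omega>) \<in> B} \<in> sets M"
proof -
  have "{\<omega> \<in> space M. part_restr n (X \<omega>) \<in> B} = X -` (part_restr n -` B) \<inter> space M" by auto
  then show ?thesis using measurable_sets[OF assms part_restr_vimage_sets] by simp
qed

lemma part_restr_All_event:
  assumes "finite J" "\<And>i. i \<in> J \<Longrightarrow> X i \<in> M \<rightarrow>\<^sub>M part_space"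
  shows "{\<omega> \<in> space M. \<forall>i\<in>J. part_restr n (X i \<omega>) \<in> B i} \<in> sets M"
  using part_restr_event[OF assms(2)] assms(1) by (intro sets.sets_Collect_finite_All) auto

lemma part_restr_min: "n \<le> m \<Longrightarrow> part_restr n (part_restr m x) = part_restr n x"
  by (simp add: part_restr_idem min_def)

text \<open>At a level \<open>m \<ge> n\<close> at which \<sigma> permutes \<open>{..<m}\<close>,
  the restriction of \<open>x\<close> to \<open>m\<close> determines that of
  \<open>relabel \<sigma> x\<close> to \<open>n\<close>; so a cylinder of level \<open>n\<close>
  pulls back to one of level \<open>m\<close>.\<close>

lemma relabel_measurable:
  assumes "finitary_perm \<sigma>"
  shows "relabel \<sigma> \<in> part_space \<rightarrow>\<^sub>M part_space"
  unfolding part_space_def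
proof (rule measurable_sigma_sets[OF sets_measure_of])
  obtain N where N: "\<And>n. N \<le> n \<Longrightarrow> \<sigma> permutes {..<n}" using finitary_perm_permutes[OF assms] by blast
  fix A :: "'a part set" assume "A \<in> {part_restr n -` B | n B. B \<subseteq> parts_on n}"
  then obtain n B where A: "A = part_restr n -` B" by auto
  define m where "m = max n N"
  have "part_restr n (relabel \<sigma> x) = part_restr n (relabel \<sigma> (part_restr m x))" for x :: "'a part"
    using part_restr_relabel[OF N, of m x] part_restr_min[of n m] unfolding m_def
    by (metis max.cobounded1 max.cobounded2)
  then have "relabel \<sigma> -` A = part_restr m -` {y. part_restr n (relabel \<sigma> y) \<in> B}"
    unfolding A by auto
  then have "relabel \<sigma> -` A \<inter> space part_space \<in> sets part_space"
    by (simp only: part_restr_vimage_sets space_part_space Int_UNIV_right)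
  then show "relabel \<sigma> -` A \<inter> space (sigma UNIV {part_restr n -` B | n B. B \<subseteq> parts_on n})
      \<in> sets (sigma UNIV {part_restr n -` B | n B. B \<subseteq> parts_on n})"
    unfolding part_space_def .
qed auto

lemma law_family_measurable:
  assumes "\<And>i. i \<in> I \<Longrightarrow> X i \<in> P \<rightarrow>\<^sub>M part_space"
  shows "(\<lambda>\<omega>. \<lambda>i\<in>I. X i \<omega>) \<in> P \<rightarrow>\<^sub>M Pi\<^sub>M I (\<lambda>_. part_space)"
  using assms by (rule measurable_restrict)

lemma law_eqD:
  assumes X: "\<And>i. i \<in> I \<Longrightarrow> X i \<in> P \<rightarrow>\<^sub>M part_space"
    and Y: "\<And>i. i \<in> I \<Longrightarrow> Y i \<in> P \<rightarrow>\<^sub>M part_space"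
    and eq: "law P I X = law P I Y" and J: "finite J" "J \<subseteq> I"
  shows "measure P {\<omega> \<in> space P. \<forall>i\<in>J. part_restr n (X i \<omega>) \<in> B i} =
    measure P {\<omega> \<in> space P. \<forall>i\<in>J. part_restr n (Y i \<omega>) \<in> B i}"
proof -
  let ?A = "{f \<in> space (Pi\<^sub>M I (\<lambda>_. part_space)). \<forall>i\<in>J. part_restr n (f i) \<in> B i}"
  have A: "?A \<in> sets (Pi\<^sub>M I (\<lambda>_. part_space))"
    by (rule part_restr_All_event[OF J(1)]) (use J(2) in \<open>auto intro: measurable_component_singleton\<close>)
  have *: "measure (law P I Z) ?A = measure P {\<omega> \<in> space P. \<forall>i\<in>J. part_restr n (Z i \<omega>) \<in> B i}"
    if "\<And>i. i \<in> I \<Longrightarrow> Z i \<in> P \<rightarrow>\<^sub>M part_space" for Z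
  proof -
    have "(\<lambda>\<omega>. \<lambda>i\<in>I. Z i \<omega>) -` ?A \<inter> space P =
        {\<omega> \<in> space P. \<forall>i\<in>J. part_restr n (Z i \<omega>) \<in> B i}"
      using J(2) by (auto simp: space_PiM space_part_space)
    then show ?thesis
      unfolding law_def using measure_distr[OF law_family_measurable[OF that] A] by simp
  qed
  show ?thesis using *[of X, OF X] *[of Y, OF Y] eq by simp
qed

text \<open>Cylinders over finitely many indices form an intersection-stable generator, and a coarse
  cylinder can be rewritten at any finer level, so levels from \<open>N\<close> on suffice. This
  leaves room to choose \<open>N\<close> so large that \<sigma> permutes \<open>{..<n}\<close>.
  Since there are finitely many colours, a cylinder is a finite disjoint union of events with
  prescribed restrictions, and comparing point probabilities is enough.\<close>

lemma law_eqI: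
  fixes X Y :: "'i \<Rightarrow> 'w \<Rightarrow> 'k::finite part"
  assumes "prob_space P"
    and X: "\<And>i. i \<in> I \<Longrightarrow> X i \<in> P \<rightarrow>\<^sub>M part_space"
    and Y: "\<And>i. i \<in> I \<Longrightarrow> Y i \<in> P \<rightarrow>\<^sub>M part_space"
    and eq: "\<And>n J z. N \<le> n \<Longrightarrow> finite J \<Longrightarrow> J \<subseteq> I \<Longrightarrow>
      measure P {\<omega> \<in> space P. \<forall>i\<in>J. part_restr n (X i \<omega>) = z i} =
      measure P {\<omega> \<in> space P. \<forall>i\<in>J. part_restr n (Y i \<omega>) = z i}"
  shows "law P I X = law P I Y"
proof -
  interpret prob_space P by fact
  let ?\<Omega> = "I \<rightarrow>\<^sub>E (UNIV :: 'k part set)"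
  let ?C = "\<lambda>n J B. {f \<in> ?\<Omega>. \<forall>i\<in>J. part_restr n (f i) \<in> B i}"
  define G where "G = {?C n J B | n J B. finite J \<and> J \<subseteq> I \<and> N \<le> n}"
  have GI: "?C n J B \<in> G" if "finite J" "J \<subseteq> I" "N \<le> n" for n J B
    unfolding G_def using that by (intro CollectI exI[of _ n] exI[of _ J] exI[of _ B]) simp
  have GE: thesis if "D \<in> G"
    "\<And>n J B. D = ?C n J B \<Longrightarrow> finite J \<Longrightarrow> J \<subseteq> I \<Longrightarrow> N \<le> n \<Longrightarrow> thesis" for D thesis
    using that unfolding G_def by (elim CollectE exE conjE)
  have refine: "?C n J B = ?C m J (\<lambda>i. {y. part_restr n y \<in> B i})" if "n \<le> m" for n m J B
    by (simp add: part_restr_min[OF that])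
  have sets: "sets (Pi\<^sub>M I (\<lambda>_. part_space)) = sigma_sets ?\<Omega> G"
  proof -
    define E where "E = ({part_restr n -` B | n B. B \<subseteq> parts_on n} :: 'k part set set)"
    let ?P = "{{f \<in> ?\<Omega>. \<forall>i\<in>j. f i \<in> A i} | A j. j \<in> {j. finite j \<and> j \<subseteq> I} \<and> A \<in> Pi j (\<lambda>_. E)}"
    have cyl: "part_restr n -` (B \<inter> parts_on n) \<in> E" for n B
      unfolding E_def by (intro CollectI exI[of _ n] exI[of _ "B \<inter> parts_on n"]) simp
    have "part_restr 0 -` (UNIV \<inter> parts_on 0) = (UNIV :: 'k part set)" by (auto simp: part_restr_in)
    then have "UNIV \<in> E" using cyl[of 0 UNIV] by simp
    then have "\<exists>S\<subseteq>E. countable S \<and> UNIV = \<Union>S" by (intro exI[of _ "{UNIV}"]) simp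
    moreover have "\<Union>{j. finite j \<and> j \<subseteq> I} = I"
    proof (intro equalityI subsetI)
      fix i assume "i \<in> I"
      then show "i \<in> \<Union>{j. finite j \<and> j \<subseteq> I}" by (intro UnionI[of "{i}"]) auto
    qed blast
    ultimately have "sets (Pi\<^sub>M I (\<lambda>_. part_space)) = sets (sigma ?\<Omega> ?P)"
      unfolding part_space_def E_def[symmetric] by (intro sets_PiM_sigma) simp_all
    also have "?P = G"
    proof (intro equalityI subsetI)
      fix D assume "D \<in> ?P"
      then obtain A j where D: "D = {f \<in> ?\<Omega>. \<forall>i\<in>j. f i \<in> A i}" "finite j" "j \<subseteq> I"
        "A \<in> Pi j (\<lambda>_. E)" by (elim CollectE exE conjE)
      have "\<forall>i\<in>j. \<exists>n B. A i = part_restr n -` B" using D(4) unfolding E_def Pi_iff by blast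
      then obtain n B where AB: "\<And>i. i \<in> j \<Longrightarrow> A i = part_restr (n i) -` B i" by metis
      \<comment> \<open>One level that dominates those of all constrained coordinates, and
        \<open>N\<close>.\<close>
      define m where "m = Max (insert N (n ` j))"
      have m: "N \<le> m" "\<And>i. i \<in> j \<Longrightarrow> n i \<le> m" using D(2) by (auto simp: m_def)
      have "D = ?C m j (\<lambda>i. {y. part_restr (n i) y \<in> B i})"
        unfolding D(1) using AB by (simp add: part_restr_min[OF m(2)])
      then show "D \<in> G" by (simp only: GI[OF D(2,3) m(1)])
    next
      fix D assume "D \<in> G"
      then obtain n J B where D: "D = ?C n J B" "finite J" "J \<subseteq> I"
        by (rule GE)
      have "D = {f \<in> ?\<Omega>. \<forall>i\<in>J. f i \<in> part_restr n -` (B i \<inter> parts_on n)}"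
        unfolding D(1) by (simp add: part_restr_in)
      moreover have "(\<lambda>i. part_restr n -` (B i \<inter> parts_on n)) \<in> Pi J (\<lambda>_. E)" using cyl by simp
      ultimately show "D \<in> ?P" using D(2,3) by (intro CollectI exI conjI)
    qed
    also have "sets (sigma ?\<Omega> G) = sigma_sets ?\<Omega> G"
      by (rule sets_measure_of) (auto simp: G_def)
    finally show ?thesis .
  qed
  have emeas: "emeasure (law P I Z) (?C n J B) =
      (\<Sum>z\<in>Pi\<^sub>E J (\<lambda>i. B i \<inter> parts_on n). measure P {\<omega> \<in> space P. \<forall>i\<in>J. part_restr n (Z i \<omega>) = z i})"
    if J: "finite J" "J \<subseteq> I" and Z: "\<And>i. i \<in> I \<Longrightarrow> Z i \<in> P \<rightarrow>\<^sub>M part_space" for Z n J B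
  proof -
    \<comment> \<open>Extensional patterns, so that different ones differ at an index of
      \<open>J\<close> and give disjoint events.\<close>
    let ?Z = "Pi\<^sub>E J (\<lambda>i. B i \<inter> parts_on n)"
    let ?e = "\<lambda>z. {\<omega> \<in> space P. \<forall>i\<in>J. part_restr n (Z i \<omega>) = z i}"
    have ev: "?e z \<in> events" for z
      using part_restr_All_event[OF J(1), of Z P n "\<lambda>i. {z i}"] Z J(2) by auto
    have C: "?C n J B \<in> sets (Pi\<^sub>M I (\<lambda>_. part_space))"
      using part_restr_All_event[OF J(1), of "\<lambda>i f. f i" "Pi\<^sub>M I (\<lambda>_. part_space)" n B] J(2)
      by (auto simp: space_PiM space_part_space intro: measurable_component_singleton)
    have "emeasure (law P I Z) (?C n J B) = emeasure P ((\<lambda>\<omega>. \<lambda>i\<in>I. Z i \<omega>) -` ?C n J B \<inter> space P)"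
      unfolding law_def by (rule emeasure_distr[OF law_family_measurable[OF Z] C])
    also have "(\<lambda>\<omega>. \<lambda>i\<in>I. Z i \<omega>) -` ?C n J B \<inter> space P =
        {\<omega> \<in> space P. \<forall>i\<in>J. part_restr n (Z i \<omega>) \<in> B i}"
    proof -
      have "(\<forall>i\<in>J. part_restr n ((\<lambda>i\<in>I. Z i \<omega>) i) \<in> B i) \<longleftrightarrow> (\<forall>i\<in>J. part_restr n (Z i \<omega>) \<in> B i)" for \<omega>
        by (intro ball_cong refl) (use J(2) in auto)
      then show ?thesis by auto
    qed
    also have "{\<omega> \<in> space P. \<forall>i\<in>J. part_restr n (Z i \<omega>) \<in> B i} = (\<Union>z\<in>?Z. ?e z)"
    proof (intro equalityI subsetI)
      fix \<omega> assume "\<omega> \<in> {\<omega> \<in> space P. \<forall>i\<in>J. part_restr n (Z i \<omega>) \<in> B i}"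
      then have "\<omega> \<in> ?e (\<lambda>i\<in>J. part_restr n (Z i \<omega>))" "(\<lambda>i\<in>J. part_restr n (Z i \<omega>)) \<in> ?Z"
        by (auto simp: part_restr_in)
      then show "\<omega> \<in> (\<Union>z\<in>?Z. ?e z)" by blast
    next
      fix \<omega> assume "\<omega> \<in> (\<Union>z\<in>?Z. ?e z)"
      then obtain z where z: "z \<in> ?Z" "\<omega> \<in> ?e z" by blast
      then show "\<omega> \<in> {\<omega> \<in> space P. \<forall>i\<in>J. part_restr n (Z i \<omega>) \<in> B i}" by (auto simp: PiE_iff)
    qed
    also have "emeasure P \<dots> = measure P (\<Union>z\<in>?Z. ?e z)" by (rule emeasure_eq_measure)
    also have "measure P (\<Union>z\<in>?Z. ?e z) = (\<Sum>z\<in>?Z. measure P (?e z))"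
    proof (rule finite_measure_finite_Union)
      show "finite ?Z" using J(1) finite_parts_on by (intro finite_PiE) auto
      show "?e ` ?Z \<subseteq> events" using ev by auto
      show "disjoint_family_on ?e ?Z"
        unfolding disjoint_family_on_def
      proof (intro ballI impI)
        fix y z assume "y \<in> ?Z" "z \<in> ?Z" "y \<noteq> z"
        then obtain i where "i \<in> J" "y i \<noteq> z i" by (metis PiE_ext)
        then show "?e y \<inter> ?e z = {}" by auto
      qed
    qed
    finally show ?thesis .
  qed
  show ?thesis
  \<comment> \<open>With no index constrained the cylinder is the whole space, so a constant
    sequence exhausts it.\<close>
  proof (rule measure_eqI_generator_eq[where E = G and \<Omega> = ?\<Omega> and A = "\<lambda>_. ?C N {} (\<lambda>_. UNIV)"])
    show "Int_stable G"
    proof (rule Int_stableI)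
      fix D D' assume "D \<in> G" "D' \<in> G"
      obtain n J B where D: "D = ?C n J B" "finite J" "J \<subseteq> I" "N \<le> n"
        using \<open>D \<in> G\<close> by (rule GE)
      obtain n' J' B' where D': "D' = ?C n' J' B'" "finite J'" "J' \<subseteq> I" "N \<le> n'"
        using \<open>D' \<in> G\<close> by (rule GE)
      define b where "b i = {y. part_restr n y \<in> B i}" for i
      define b' where "b' i = {y. part_restr n' y \<in> B' i}" for i
      have b: "D = ?C (max n n') J b" unfolding D(1) b_def by (rule refine) simp
      have b': "D' = ?C (max n n') J' b'" unfolding D'(1) b'_def by (rule refine) simp
      have "D \<inter> D' = ?C (max n n') (J \<union> J')
          (\<lambda>i. (if i \<in> J then b i else UNIV) \<inter> (if i \<in> J' then b' i else UNIV))"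
        unfolding b b' by auto
      moreover have "\<dots> \<in> G" using D(2-4) D'(2-4) by (intro GI) auto
      ultimately show "D \<inter> D' \<in> G" by simp
    qed
    show "G \<subseteq> Pow ?\<Omega>" by (auto simp: G_def)
    show "sets (law P I X) = sigma_sets ?\<Omega> G" "sets (law P I Y) = sigma_sets ?\<Omega> G"
      by (simp_all add: law_def sets)
    show "emeasure (law P I X) D = emeasure (law P I Y) D" if "D \<in> G" for D
    proof -
      obtain n J B where D: "D = ?C n J B" "finite J" "J \<subseteq> I" "N \<le> n"
        using \<open>D \<in> G\<close> by (rule GE)
      show ?thesis
        unfolding D(1) using D(2-4) X Y by (simp add: emeas eq)
    qed
    show "range (\<lambda>_. ?C N {} (\<lambda>_. UNIV)) \<subseteq> G" using GI[of "{}" N] by simp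
    show "(\<Union>i. ?C N {} (\<lambda>_. UNIV)) = ?\<Omega>" by simp
    show "emeasure (law P I X) (?C N {} (\<lambda>_. UNIV)) \<noteq> \<infinity>"
      using emeas[of "{}" X] X by simp
  qed
qed

section \<open>Exchangeability of the system and the jump rates\<close>

text \<open>The real-valued \<open>measure\<close> is adequate here: for a directing measure the
  level of a label has finite mass.\<close>

definition rates_invariant :: "('k part \<Rightarrow> 'k part) measure \<Rightarrow> bool" where
  "rates_invariant \<phi> \<longleftrightarrow> (\<forall>n \<sigma> f. \<sigma> permutes {..<n} \<longrightarrow> f \<in> labels n \<longrightarrow>
     measure \<phi> (level n (conj_map n \<sigma> f)) = measure \<phi> (level n f))"

text \<open>To first order in \<open>h\<close> the left side is
  \<open>h * \<bar>a - b\<bar>\<close>, while the right side is of second order, so dividing by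
  \<open>h\<close> and letting \<open>h\<close> tend to 0 gives equality. Each inequality follows
  from \<open>exp y \<ge> 1 + y\<close> and \<open>exp (h * u) \<ge> 1\<close>.\<close>

lemma rates_eqI:
  fixes a b r R :: real
  assumes "\<And>h. 0 < h \<Longrightarrow> \<bar>exp (h * a) - exp (h * b)\<bar> \<le> 4 * (r * h)\<^sup>2 * exp (h * R)"
    and "0 \<le> a" "0 \<le> b"
  shows "a = b"
proof -
  have le: "v - u \<le> 0" if "0 \<le> u" and *: "\<And>h. 0 < h \<Longrightarrow> \<bar>exp (h * u) - exp (h * v)\<bar> \<le> 4 * (r * h)\<^sup>2 * exp (h * R)"
    for u v
  proof (rule ccontr)
    assume "\<not> v - u \<le> 0"
    then have uv: "0 < v - u" by simp
    have "((\<lambda>h. 4 * r\<^sup>2 * h * exp (h * R)) \<longlongrightarrow> 4 * r\<^sup>2 * 0 * exp (0 * R)) (at_right 0)"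
      by (intro tendsto_intros)
    moreover have "v - u \<le> 4 * r\<^sup>2 * h * exp (h * R)" if "0 < h" for h
    proof -
      have "h * (v - u) \<le> exp (h * (v - u)) - 1" using exp_ge_add_one_self[of "h * (v - u)"] by linarith
      also have "\<dots> \<le> exp (h * u) * (exp (h * (v - u)) - 1)"
        using mult_right_mono[of 1 "exp (h * u)" "exp (h * (v - u)) - 1"] that \<open>0 \<le> u\<close> uv by simp
      also have "\<dots> = exp (h * v) - exp (h * u)" by (simp add: algebra_simps flip: exp_add)
      also have "\<dots> \<le> 4 * (r * h)\<^sup>2 * exp (h * R)" using *[OF that] by linarith
      also have "\<dots> = h * (4 * r\<^sup>2 * h * exp (h * R))" by (simp add: power2_eq_square)
      finally show ?thesis using that by simp
    qed
    then have "\<forall>\<^sub>F h in at_right 0. v - u \<le> 4 * r\<^sup>2 * h * exp (h * R)"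
      by (auto simp: eventually_at_filter)
    ultimately have "v - u \<le> 4 * r\<^sup>2 * 0 * exp (0 * R)"
      by (rule tendsto_lowerbound) simp
    then show False using uv by simp
  qed
  have "b - a \<le> 0" using assms(1) by (rule le[OF \<open>0 \<le> a\<close>])
  moreover have "a - b \<le> 0" using assms(1) by (intro le[OF \<open>0 \<le> b\<close>]) (simp add: abs_minus_commute)
  ultimately show ?thesis by simp
qed

section \<open>Transfer between rates and finite-dimensional laws\<close>

context lipschitz_driver
begin

text \<open>A conjugated mark \<open>f\<close> is present iff the cell of the label conjugated back
  is hit. Those cells are again disjoint and, by invariance, have the same intensities, so the hit
  pattern has the same law.\<close>

lemma prob_hit_cells_conj:
  assumes inv: "rates_invariant \<phi>" and \<sigma>: "\<sigma> permutes {..<n}" and "0 < h"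
  shows "prob {\<omega> \<in> space P. Q (apsnd (conj_map n \<sigma>) ` hit_cells n h l \<omega>)} =
    prob {\<omega> \<in> space P. Q (hit_cells n h l \<omega>)}"
proof -
  let ?c = "conj_map n \<sigma>" and ?d = "conj_map n (inv \<sigma>)"
  let ?I = "{..<l} \<times> (labels n :: ('k part \<Rightarrow> 'k part) set)"
  note \<sigma>' = permutes_inv[OF \<sigma>]
  have cd: "?c (?d f) = f" "?d (?c f) = f" if "f \<in> labels n" for f :: "'k part \<Rightarrow> 'k part"
    using that conj_map_inv[OF \<sigma>] conj_map_inv'[OF \<sigma>] by (auto simp: labels_def)
  have "apsnd ?c ` hits (cell n h) ?I A = hits (\<lambda>p. cell n h (apsnd ?d p)) ?I A" for A
  proof (intro equalityI subsetI)
    fix p assume "p \<in> apsnd ?c ` hits (cell n h) ?I A"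
    then obtain q where q: "p = apsnd ?c q" "q \<in> hits (cell n h) ?I A" by blast
    then obtain j f where p: "p = (j, ?c f)" "j < l" "f \<in> labels n" "A \<inter> cell n h (j, f) \<noteq> {}"
      by (cases q) (simp add: hits_def)
    then show "p \<in> hits (\<lambda>p. cell n h (apsnd ?d p)) ?I A"
      using conj_map_labels[OF \<sigma>, of f] cd(2)[of f] by (simp add: hits_def)
  next
    fix p assume "p \<in> hits (\<lambda>p. cell n h (apsnd ?d p)) ?I A"
    then obtain j f where p: "p = (j, f)" "j < l" "f \<in> labels n" "A \<inter> cell n h (j, ?d f) \<noteq> {}"
      by (cases p) (simp add: hits_def)
    then have "(j, ?d f) \<in> hits (cell n h) ?I A" "p = apsnd ?c (j, ?d f)"
      using conj_map_labels[OF \<sigma>', of f] cd(1)[of f] by (simp_all add: hits_def)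
    then show "p \<in> apsnd ?c ` hits (cell n h) ?I A" by blast
  qed
  note im = this
  have "prob {\<omega> \<in> space P. Q (hits (\<lambda>p. cell n h (apsnd ?d p)) ?I (S \<omega>))} =
      prob {\<omega> \<in> space P. Q (hits (cell n h) ?I (S \<omega>))}"
  proof (rule prob_hits_cong)
    show "finite ?I" by (simp add: finite_labels)
    show "disjoint_family_on (cell n h) ?I" by (rule disjoint_cells[OF \<open>0 < h\<close>])
    show "disjoint_family_on (\<lambda>p. cell n h (apsnd ?d p)) ?I"
      unfolding disjoint_family_on_def
    proof (intro ballI impI)
      fix p q assume "p \<in> ?I" "q \<in> ?I" "p \<noteq> q"
      then have "apsnd ?d p \<noteq> apsnd ?d q" using cd(1) by (cases p, cases q) (auto, metis)
      then show "cell n h (apsnd ?d p) \<inter> cell n h (apsnd ?d q) = {}"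
        using disjoint_cells[OF \<open>0 < h\<close>, of n UNIV] unfolding disjoint_family_on_def by blast
    qed
    fix p assume "p \<in> ?I"
    then obtain j f where p: "p = (j, f)" "f \<in> labels n" by blast
    note f' = conj_map_labels[OF \<sigma>' p(2)]
    show "cell n h p \<in> sets \<nu>" "emeasure \<nu> (cell n h p) < \<infinity>"
      using cell_props[OF \<open>0 < h\<close> p(2)] by (simp_all add: p)
    show "cell n h (apsnd ?d p) \<in> sets \<nu>" "emeasure \<nu> (cell n h (apsnd ?d p)) < \<infinity>"
      using cell_props[OF \<open>0 < h\<close> f'] by (simp_all add: p)
    have "measure \<phi> (level n (?d f)) = measure \<phi> (level n f)"
      using inv \<sigma>' p(2) unfolding rates_invariant_def by blast
    then show "measure \<nu> (cell n h (apsnd ?d p)) = measure \<nu> (cell n h p)"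
      using cell_props(3)[OF \<open>0 < h\<close> f'] cell_props(3)[OF \<open>0 < h\<close> p(2)] by (simp add: p)
  qed
  then show ?thesis unfolding im .
qed

lemma hit_cells_subset: "hit_cells n h l \<omega> \<subseteq> UNIV \<times> labels n"
  by (auto simp: hits_def)

text \<open>Both events are approximated by events about the same hit cells. Relabelling the chain
  amounts to conjugating its marks and relabelling its start, and conjugated marks have the law of
  the original ones; so only the mesh error separates the two probabilities.\<close>

lemma rates_invariant_fidi:
  assumes inv: "rates_invariant \<phi>" and \<sigma>: "\<sigma> permutes {..<n}"
    and path: "\<And>x. AE \<omega> in P. driven_path (S \<omega>) x (\<lambda>t. X x t \<omega>)"
    and X: "\<And>x t. 0 \<le> t \<Longrightarrow> X x t \<in> P \<rightarrow>\<^sub>M part_space"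
    and J: "finite J" "J \<subseteq> UNIV \<times> {0..}"
  shows "prob {\<omega> \<in> space P. \<forall>i\<in>J. part_restr n (relabel \<sigma> (X (fst i) (snd i) \<omega>)) = z i} =
    prob {\<omega> \<in> space P. \<forall>i\<in>J. part_restr n (X (relabel \<sigma> (fst i)) (snd i) \<omega>) = z i}"
    (is "prob ?A = prob ?A'")
proof -
  define T where "T = Max (insert 0 (snd ` J))"
  have T: "0 \<le> T" "\<And>i. i \<in> J \<Longrightarrow> snd i \<le> T" using J(1) by (auto simp: T_def)
  have t: "0 \<le> snd i" if "i \<in> J" for i using J(2) that by auto
  then have times: "\<forall>i\<in>J. 0 \<le> snd i \<and> snd i \<le> T" using T(2) by blast
  have fin: "finitary_perm \<sigma>" using permutes_finitary_perm[OF \<sigma>] .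
  have evA: "?A \<in> events"
  proof -
    have "(\<lambda>\<omega>. relabel \<sigma> (X (fst i) (snd i) \<omega>)) \<in> P \<rightarrow>\<^sub>M part_space" if "i \<in> J" for i
      using measurable_compose[OF X relabel_measurable[OF fin]] t[OF that] by blast
    then show ?thesis using part_restr_All_event[OF J(1), of _ P n "\<lambda>i. {z i}"] by simp
  qed
  have evA': "?A' \<in> events"
    using part_restr_All_event[OF J(1), of "\<lambda>i. X (relabel \<sigma> (fst i)) (snd i)" P n "\<lambda>i. {z i}"] X t
    by simp
  have half: "u / 2 \<le> v" if "u \<le> v + v" for u v :: real using that by simp
  \<comment> \<open>The error occurs once for each of the two families; halving gives the form of
    \<open>le_zero_if_le_mesh_error\<close>.\<close>
  have "\<bar>prob ?A - prob ?A'\<bar> / 2 \<le> card J * (total_rate n * h) + (T / h + 1) * (total_rate n * h)\<^sup>2"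
    if h: "0 < h" for h
  proof -
    let ?err = "card J * (total_rate n * h) + (T / h + 1) * (total_rate n * h)\<^sup>2"
    let ?V = "hit_cells n h (nat \<lceil>T / h\<rceil>)"
    let ?k = "\<lambda>i. nat \<lceil>snd i / h\<rceil>"
    let ?C = "{\<omega> \<in> space P. \<forall>i\<in>J. relabel \<sigma> (chain (?V \<omega>) (?k i) (part_restr n (fst i))) = z i}"
    let ?C' = "{\<omega> \<in> space P. \<forall>i\<in>J. chain (?V \<omega>) (?k i) (part_restr n (relabel \<sigma> (fst i))) = z i}"
    obtain G where G: "G \<in> events" "1 - prob G \<le> ?err"
      "AE \<omega> in P. \<omega> \<in> G \<longrightarrow> (\<forall>i\<in>J. part_restr n (X (fst i) (snd i) \<omega>) =
         chain (?V \<omega>) (?k i) (part_restr n (fst i)))"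
      using driven_path_chain_whp_uniform[where J = J and h = h and t = snd and T = T
          and X = "\<lambda>i. X (fst i)" and x = "\<lambda>i _. fst i" and n = n, OF J(1) h times _ T(1)] path
      by blast
    have "\<bar>prob ?A - prob ?C\<bar> \<le> 1 - prob G"
    proof (rule abs_prob_diff_le[OF evA _ G(1)])
      show "?C \<in> events" by (rule hit_cells_event[OF h])
      show "AE \<omega> in P. \<omega> \<in> G \<longrightarrow> (\<omega> \<in> ?A \<longleftrightarrow> \<omega> \<in> ?C)"
        using G(3) by eventually_elim (auto simp: part_restr_relabel[OF \<sigma>])
    qed
    moreover obtain G' where G': "G' \<in> events" "1 - prob G' \<le> ?err"
      "AE \<omega> in P. \<omega> \<in> G' \<longrightarrow> (\<forall>i\<in>J. part_restr n (X (relabel \<sigma> (fst i)) (snd i) \<omega>) =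
         chain (?V \<omega>) (?k i) (part_restr n (relabel \<sigma> (fst i))))"
      using driven_path_chain_whp_uniform[where J = J and h = h and t = snd and T = T
          and X = "\<lambda>i. X (relabel \<sigma> (fst i))" and x = "\<lambda>i _. relabel \<sigma> (fst i)" and n = n,
          OF J(1) h times _ T(1)] path
      by blast
    have "\<bar>prob ?A' - prob ?C'\<bar> \<le> 1 - prob G'"
    proof (rule abs_prob_diff_le[OF evA' _ G'(1)])
      show "?C' \<in> events" by (rule hit_cells_event[OF h])
      show "AE \<omega> in P. \<omega> \<in> G' \<longrightarrow> (\<omega> \<in> ?A' \<longleftrightarrow> \<omega> \<in> ?C')"
        using G'(3) by eventually_elim auto
    qed
    moreover have "prob ?C = prob ?C'"
    proof -
      \<comment> \<open>The permutation moves from the outside of the chain into its marks and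
        initial state.\<close>
      have "?C = {\<omega> \<in> space P. \<forall>i\<in>J.
          chain (apsnd (conj_map n \<sigma>) ` ?V \<omega>) (?k i) (part_restr n (relabel \<sigma> (fst i))) = z i}"
        using chain_relabel[OF \<sigma> hit_cells_subset part_restr_in]
        by (simp add: part_restr_relabel[OF \<sigma>])
      then show ?thesis
        using prob_hit_cells_conj[OF inv \<sigma> h,
            of "\<lambda>V. \<forall>i\<in>J. chain V (?k i) (part_restr n (relabel \<sigma> (fst i))) = z i"]
        by simp
    qed
    ultimately have "\<bar>prob ?A - prob ?A'\<bar> \<le> (1 - prob G) + (1 - prob G')" by linarith
    also have "\<dots> \<le> ?err + ?err" using G(2) G'(2) by (rule add_mono)
    finally have "\<bar>prob ?A - prob ?A'\<bar> \<le> ?err + ?err" .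
    then show ?thesis by (rule half)
  qed
  then have "\<bar>prob ?A - prob ?A'\<bar> / 2 \<le> 0" by (rule le_zero_if_le_mesh_error)
  then show ?thesis by simp
qed

text \<open>By independence this is \<open>1 - exp (- h * q f)\<close> times the product of
  \<open>exp (- h * q g)\<close> over the other labels \<open>g\<close>, where \<open>q\<close> is
  the rate. In the closed form \<open>R\<close> does not depend on \<open>f\<close>, so it cancels
  when two labels are compared.\<close>

lemma prob_first_step:
  assumes "0 < h" "f \<in> labels n"
  defines "R \<equiv> \<Sum>g\<in>labels n. measure \<phi> (level n g)"
  shows "prob {\<omega> \<in> space P. hit_cells n h 1 \<omega> = {(0, f)}} =
    exp (- h * R) * (exp (h * measure \<phi> (level n f)) - 1)"
proof -
  let ?L = "labels n :: ('k part \<Rightarrow> 'k part) set"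
  let ?q = "\<lambda>g. measure \<phi> (level n g)"
  have "prob {\<omega> \<in> space P. hit_cells n h 1 \<omega> = {(0, f)}} =
      (\<Prod>p\<in>{..<1} \<times> ?L. if p \<in> {(0, f)} then 1 - exp (- measure \<nu> (cell n h p))
        else exp (- measure \<nu> (cell n h p)))"
  proof (rule prob_hits_eq)
    show "finite ({..<1::nat} \<times> ?L)" by (simp add: finite_labels)
    show "disjoint_family_on (cell n h) ({..<1} \<times> ?L)" by (rule disjoint_cells[OF \<open>0 < h\<close>])
  qed (use assms cell_props[OF \<open>0 < h\<close>] in auto)
  also have "\<dots> = (\<Prod>g\<in>?L. if g = f then 1 - exp (- h * ?q g) else exp (- h * ?q g))"
    by (rule prod.reindex_bij_witness[where i = "\<lambda>g. (0, g)" and j = snd])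
      (auto simp: cell_props[OF \<open>0 < h\<close>])
  also have "\<dots> = (1 - exp (- h * ?q f)) * (\<Prod>g\<in>?L - {f}. exp (- h * ?q g))"
    using assms(2) by (subst prod.remove[of _ f]) (auto simp: finite_labels intro!: prod.cong)
  also have "(\<Prod>g\<in>?L - {f}. exp (- h * ?q g)) = exp (- h * (R - ?q f))"
  proof -
    have "(\<Sum>g\<in>?L - {f}. - h * ?q g) = - h * (\<Sum>g\<in>?L - {f}. ?q g)"
      by (rule sum_distrib_left[symmetric])
    also have "(\<Sum>g\<in>?L - {f}. ?q g) = R - ?q f"
      using assms(2) by (simp add: R_def sum_diff1 finite_labels)
    finally have "- h * (R - ?q f) = (\<Sum>g\<in>?L - {f}. - h * ?q g)" ..
    then show ?thesis by (simp only: exp_sum finite_Diff finite_labels)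
  qed
  also have "(1 - exp (- h * ?q f)) * exp (- h * (R - ?q f)) = exp (- h * R) * (exp (h * ?q f) - 1)"
    by (simp add: algebra_simps flip: exp_add)
  finally show ?thesis .
qed

text \<open>Watching all states of level \<open>n\<close> simultaneously reveals the map applied up
  to time \<open>h\<close>. For a one-step chain it equals \<open>f\<close> iff \<open>f\<close> is
  the only mark.\<close>

lemma prob_path_map:
  assumes h: "0 < h" and f: "f \<in> labels n"
    and path: "\<And>x. AE \<omega> in P. driven_path (S \<omega>) x (\<lambda>t. X x t \<omega>)"
    and X: "\<And>x t. 0 \<le> t \<Longrightarrow> X x t \<in> P \<rightarrow>\<^sub>M part_space"
  defines "R \<equiv> \<Sum>g\<in>labels n. measure \<phi> (level n g)"
  shows "\<bar>prob {\<omega> \<in> space P. \<forall>x\<in>parts_on n. part_restr n (X x h \<omega>) = f x} -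
      exp (- h * R) * (exp (h * measure \<phi> (level n f)) - 1)\<bar> \<le> 2 * (total_rate n * h)\<^sup>2"
proof -
  let ?A = "{\<omega> \<in> space P. \<forall>x\<in>parts_on n. part_restr n (X x h \<omega>) = f x}"
  let ?C = "{\<omega> \<in> space P. hit_cells n h 1 \<omega> = {(0, f)}}"
  \<comment> \<open>With \<open>t = T = h\<close> the gap to the grid is zero and
    \<open>T / h + 1\<close> equals 2.\<close>
  obtain G where G: "G \<in> events" "1 - prob G \<le> 2 * (total_rate n * h)\<^sup>2"
    "AE \<omega> in P. \<omega> \<in> G \<longrightarrow> (\<forall>x\<in>parts_on n. part_restr n (X x h \<omega>) =
       chain (hit_cells n h 1 \<omega>) 1 (part_restr n x))"
    using driven_path_chain_whp[where J = "parts_on n" and h = h and t = "\<lambda>_. h" and T = h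
        and X = X and x = "\<lambda>x _. x" and n = n, OF finite_parts_on h _ _ less_imp_le[OF h]] h path
    by auto
  have iff: "(\<forall>x\<in>parts_on n. chain V 1 x = f x) \<longleftrightarrow> V = {(0, f)}"
    if V: "V \<subseteq> {..<1} \<times> labels n" for V
  proof
    assume *: "\<forall>x\<in>parts_on n. chain V 1 x = f x"
    have f': "f \<in> parts_on n \<rightarrow>\<^sub>E parts_on n" "f \<noteq> id_on n" using f by (auto simp: labels_def)
    \<comment> \<open>No mark, or several, would leave every state fixed, but \<open>id_on n\<close>
      is not a label.\<close>
    have "is_singleton (V `` {0})"
    proof (rule ccontr)
      assume "\<not> is_singleton (V `` {0})"
      then have "f = id_on n" using * by (intro PiE_ext[OF f'(1) id_on_funcset]) (simp add: id_on_def)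
      then show False using f'(2) by simp
    qed
    then obtain g where g: "V `` {0} = {g}" by (auto simp: is_singleton_def)
    then have "g \<in> labels n" using V by blast
    then have "g \<in> parts_on n \<rightarrow>\<^sub>E parts_on n" by (simp add: labels_def)
    then have "f = g" using * g by (intro PiE_ext[OF f'(1)]) auto
    moreover have "V = {0} \<times> V `` {0}" using V by auto
    ultimately show "V = {(0, f)}" using g by simp
  next
    assume "V = {(0, f)}"
    then have "V `` {0} = {f}" by auto
    then show "\<forall>x\<in>parts_on n. chain V 1 x = f x" by simp
  qed
  have "\<bar>prob ?A - prob ?C\<bar> \<le> 1 - prob G"
  proof (rule abs_prob_diff_le[OF _ _ G(1)])
    show "?A \<in> events"
      using part_restr_All_event[OF finite_parts_on, where X = "\<lambda>x. X x h" and M = P and B = "\<lambda>x. {f x}"] X h by simp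
    show "?C \<in> events" by (rule hit_cells_event[OF h])
    show "AE \<omega> in P. \<omega> \<in> G \<longrightarrow> (\<omega> \<in> ?A \<longleftrightarrow> \<omega> \<in> ?C)"
      using G(3)
    proof eventually_elim
      case (elim \<omega>)
      have "hit_cells n h 1 \<omega> \<subseteq> {..<1} \<times> labels n" by (auto simp: hits_def)
      from iff[OF this] elim show ?case by (simp add: part_restr_id)
    qed
  qed
  then show ?thesis using G(2) prob_first_step[OF h f] unfolding R_def by simp
qed

text \<open>Exchangeability equates the probabilities that the states at time \<open>h\<close>
  result from \<open>f\<close> and from its conjugate; their first-order terms in \<open>h\<close>
  are the two rates.\<close>

lemma rates_invariant_if_exchangeable:
  assumes path: "\<And>x. AE \<omega> in P. driven_path (S \<omega>) x (\<lambda>t. X x t \<omega>)"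
    and X: "\<And>x t. 0 \<le> t \<Longrightarrow> X x t \<in> P \<rightarrow>\<^sub>M part_space"
    and exch: "exchangeable_system P X"
  shows "rates_invariant \<phi>"
  unfolding rates_invariant_def
proof (intro allI impI)
  fix n \<sigma> and f :: "'k part \<Rightarrow> 'k part"
  assume \<sigma>: "\<sigma> permutes {..<n}" and f: "f \<in> labels n"
  let ?c = "conj_map n \<sigma>"
  define R where "R = (\<Sum>g\<in>labels n. measure \<phi> (level n g :: ('k part \<Rightarrow> 'k part) set))"
  have fin: "finitary_perm \<sigma>" using permutes_finitary_perm[OF \<sigma>] .
  show "measure \<phi> (level n (?c f)) = measure \<phi> (level n f)"
  proof (rule rates_eqI)
    fix h :: real assume h: "0 < h"
    let ?A = "\<lambda>f. {\<omega> \<in> space P. \<forall>x\<in>parts_on n. part_restr n (X x h \<omega>) = f x}"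
    let ?I = "UNIV \<times> {0..} :: ('k part \<times> real) set" and ?J = "parts_on n \<times> {h} :: ('k part \<times> real) set"
    \<comment> \<open>The targets \<open>relabel \<sigma> (f x)\<close> make the relabelled family
      say that all states moved by \<open>f\<close>, and the other one, after the substitution of
      \<open>relabel (inv \<sigma>) x\<close> for \<open>x\<close>, that they moved by the
      conjugate.\<close>
    have "prob {\<omega> \<in> space P. \<forall>i\<in>?J. part_restr n ((case i of (x, t) \<Rightarrow> \<lambda>\<omega>. relabel \<sigma> (X x t \<omega>)) \<omega>) \<in>
          {relabel \<sigma> (f (fst i))}} =
        prob {\<omega> \<in> space P. \<forall>i\<in>?J. part_restr n ((case i of (x, t) \<Rightarrow> \<lambda>\<omega>. X (relabel \<sigma> x) t \<omega>) \<omega>) \<in>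
          {relabel \<sigma> (f (fst i))}}"
    proof (rule law_eqD)
      show "(case i of (x, t) \<Rightarrow> \<lambda>\<omega>. relabel \<sigma> (X x t \<omega>)) \<in> P \<rightarrow>\<^sub>M part_space" if "i \<in> ?I" for i
        using that measurable_compose[OF X relabel_measurable[OF fin]] by (cases i) auto
      show "(case i of (x, t) \<Rightarrow> \<lambda>\<omega>. X (relabel \<sigma> x) t \<omega>) \<in> P \<rightarrow>\<^sub>M part_space" if "i \<in> ?I" for i
        using that X by (cases i) auto
      show "law P ?I (\<lambda>(x, t) \<omega>. relabel \<sigma> (X x t \<omega>)) = law P ?I (\<lambda>(x, t) \<omega>. X (relabel \<sigma> x) t \<omega>)"
        using exch fin unfolding exchangeable_system_def by blast
      show "finite ?J" by (simp add: finite_parts_on)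
      show "?J \<subseteq> ?I" using h by auto
    qed
    moreover have "(\<forall>x\<in>parts_on n. part_restr n (relabel \<sigma> (X x h \<omega>)) = relabel \<sigma> (f x)) \<longleftrightarrow>
        (\<forall>x\<in>parts_on n. part_restr n (X x h \<omega>) = f x)" for \<omega>
      by (simp add: part_restr_relabel[OF \<sigma>] relabel_eq_iff[OF \<sigma>] relabel_inv(2)[OF \<sigma>])
    moreover have "(\<forall>x\<in>parts_on n. part_restr n (X (relabel \<sigma> x) h \<omega>) = relabel \<sigma> (f x)) \<longleftrightarrow>
        (\<forall>x\<in>parts_on n. part_restr n (X x h \<omega>) = ?c f x)" for \<omega>
    proof
      assume *: "\<forall>x\<in>parts_on n. part_restr n (X (relabel \<sigma> x) h \<omega>) = relabel \<sigma> (f x)"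
      show "\<forall>x\<in>parts_on n. part_restr n (X x h \<omega>) = ?c f x"
      proof
        fix x :: "'k part" assume x: "x \<in> parts_on n"
        then have "relabel (inv \<sigma>) x \<in> parts_on n" by (rule relabel_in_parts_on[OF permutes_inv[OF \<sigma>]])
        from bspec[OF * this] show "part_restr n (X x h \<omega>) = ?c f x"
          using x by (simp add: relabel_inv(1)[OF \<sigma>] conj_map_def)
      qed
    next
      assume *: "\<forall>x\<in>parts_on n. part_restr n (X x h \<omega>) = ?c f x"
      show "\<forall>x\<in>parts_on n. part_restr n (X (relabel \<sigma> x) h \<omega>) = relabel \<sigma> (f x)"
      proof
        fix x :: "'k part" assume x: "x \<in> parts_on n"
        from bspec[OF * relabel_in_parts_on[OF \<sigma> x]]
        show "part_restr n (X (relabel \<sigma> x) h \<omega>) = relabel \<sigma> (f x)"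
          by (simp add: conj_map_relabel[OF \<sigma> x])
      qed
    qed
    ultimately have "prob (?A f) = prob (?A (?c f))" by simp
    then have "\<bar>exp (- h * R) * (exp (h * measure \<phi> (level n (?c f))) - 1) -
        exp (- h * R) * (exp (h * measure \<phi> (level n f)) - 1)\<bar> \<le> 4 * (total_rate n * h)\<^sup>2"
      using prob_path_map[OF h f path X] prob_path_map[OF h conj_map_labels[OF \<sigma> f] path X]
      unfolding R_def by linarith
    then have "exp (- h * R) * \<bar>exp (h * measure \<phi> (level n (?c f))) - exp (h * measure \<phi> (level n f))\<bar>
        \<le> 4 * (total_rate n * h)\<^sup>2"
      unfolding right_diff_distrib[symmetric] by (simp add: abs_mult)
    \<comment> \<open>Clearing the common factor \<open>exp (- h * R)\<close> gives the form of
      \<open>rates_eqI\<close>; its constant 4 is twice the 2 of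
      \<open>prob_path_map\<close>.\<close>
    then have "exp (h * R) * (exp (- h * R) *
          \<bar>exp (h * measure \<phi> (level n (?c f))) - exp (h * measure \<phi> (level n f))\<bar>) \<le>
        exp (h * R) * (4 * (total_rate n * h)\<^sup>2)"
      by (intro mult_left_mono) auto
    moreover have "exp (h * R) * (exp (- h * R) * u) = u" for u
      by (simp flip: exp_add mult.assoc)
    ultimately show "\<bar>exp (h * measure \<phi> (level n (?c f))) - exp (h * measure \<phi> (level n f))\<bar> \<le>
        4 * (total_rate n * h)\<^sup>2 * exp (h * R)"
      by (simp only: mult.commute[of _ "exp (h * R)"])
  qed simp_all
qed

lemma exchangeable_if_rates_invariant:
  assumes path: "\<And>x. AE \<omega> in P. driven_path (S \<omega>) x (\<lambda>t. X x t \<omega>)"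
    and X: "\<And>x t. 0 \<le> t \<Longrightarrow> X x t \<in> P \<rightarrow>\<^sub>M part_space"
    and inv: "rates_invariant \<phi>"
  shows "exchangeable_system P X"
  unfolding exchangeable_system_def
proof (intro allI impI)
  fix \<sigma> assume fin: "finitary_perm \<sigma>"
  obtain N where N: "\<And>n. N \<le> n \<Longrightarrow> \<sigma> permutes {..<n}" using finitary_perm_permutes[OF fin] by blast
  show "law P (UNIV \<times> {0..}) (\<lambda>(x, t) \<omega>. relabel \<sigma> (X x t \<omega>)) =
      law P (UNIV \<times> {0..}) (\<lambda>(x, t) \<omega>. X (relabel \<sigma> x) t \<omega>)"
  proof (rule law_eqI[where N = N])
    fix i :: "'k part \<times> real" assume "i \<in> UNIV \<times> {0..}"
    then show "(case i of (x, t) \<Rightarrow> \<lambda>\<omega>. relabel \<sigma> (X x t \<omega>)) \<in> P \<rightarrow>\<^sub>M part_space"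
      "(case i of (x, t) \<Rightarrow> \<lambda>\<omega>. X (relabel \<sigma> x) t \<omega>) \<in> P \<rightarrow>\<^sub>M part_space"
      using measurable_compose[OF X relabel_measurable[OF fin]] X by (cases i; auto)+
  next
    fix n and J :: "('k part \<times> real) set" and z
    assume "N \<le> n" "finite J" "J \<subseteq> UNIV \<times> {0..}"
    then show "prob {\<omega> \<in> space P. \<forall>i\<in>J. part_restr n ((case i of (x, t) \<Rightarrow> \<lambda>\<omega>. relabel \<sigma> (X x t \<omega>)) \<omega>) = z i} =
        prob {\<omega> \<in> space P. \<forall>i\<in>J. part_restr n ((case i of (x, t) \<Rightarrow> \<lambda>\<omega>. X (relabel \<sigma> x) t \<omega>) \<omega>) = z i}"
      using rates_invariant_fidi[OF inv N path X, of n J z] by (simp add: case_prod_beta)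
  qed (rule prob_space_axioms)
qed

end

section \<open>Partition operators\<close>

text \<open>Constant partitions read off the columns: \<open>act M\<close> maps the partition of
  constant colour \<open>j\<close> to \<open>M j\<close>.\<close>

lemma lip_restr_act_eq_iff:
  "lip_restr n (act M) = lip_restr n (act N) \<longleftrightarrow> op_restr n M = op_restr n N"
proof
  assume *: "lip_restr n (act M) = lip_restr n (act N)"
  show "op_restr n M = op_restr n N"
  proof
    fix j
    have "part_restr n (act M (\<lambda>_. j)) = part_restr n (act N (\<lambda>_. j))"
      using * act_lip lip_restr_part_restr by metis
    then show "op_restr n M j = op_restr n N j" by (simp add: op_restr_def act_def)
  qed
next
  assume "op_restr n M = op_restr n N"
  then have "part_restr n (M j) = part_restr n (N j)" for j by (simp add: op_restr_def fun_eq_iff)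
  then have "part_restr n (act M x) = part_restr n (act N x)" for x
    by (simp add: part_restr_eq_iff act_def)
  then show "lip_restr n (act M) = lip_restr n (act N)" by (simp add: lip_restr_def)
qed

lemma lip_restr_act_mono:
  assumes "lip_restr m (act M) = lip_restr m (act N)" "n \<le> m"
  shows "lip_restr n (act M) = lip_restr n (act N)"
proof -
  have "part_restr n (M j) = part_restr n (N j)" for j
  proof -
    have "part_restr m (M j) = part_restr m (N j)"
      using assms(1) unfolding lip_restr_act_eq_iff by (simp add: op_restr_def fun_eq_iff)
    then show ?thesis using \<open>n \<le> m\<close> by (simp add: part_restr_eq_iff)
  qed
  then show ?thesis unfolding lip_restr_act_eq_iff by (simp add: op_restr_def)
qed

lemma lip_restr_act_op_id: "lip_restr n (act op_id) = id_on n"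
  by (auto simp: act_op_id lip_restr_def id_on_def part_restr_id)

lemma lip_restr_act_labels_iff: "lip_restr n (act M) \<in> labels n \<longleftrightarrow> lip_restr n (act M) \<noteq> id_on n"
  using lip_restr_funcset[OF act_lip] by (auto simp: labels_def)

text \<open>Acting as the identity at level \<open>m\<close> would imply the same at the coarser
  level \<open>n\<close>.\<close>

lemma lip_restr_act_labels_mono:
  assumes "lip_restr n (act M) \<in> labels n" "n \<le> m"
  shows "lip_restr m (act M) \<in> labels m"
  using assms lip_restr_act_mono[of m M op_id n]
  unfolding lip_restr_act_labels_iff lip_restr_act_op_id by blast

lemma op_relabel_inv:
  assumes "\<sigma> permutes A"
  shows "op_relabel \<sigma> (op_relabel (inv \<sigma>) M) = M" "op_relabel (inv \<sigma>) (op_relabel \<sigma> M) = M"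
  by (simp_all add: op_relabel_def relabel_inv[OF assms])

text \<open>Turns the image in the invariance condition into a preimage, to which measurability and
  \<open>distr\<close> apply.\<close>

lemma op_relabel_image_eq_vimage:
  assumes "\<sigma> permutes A"
  shows "op_relabel \<sigma> ` B = op_relabel (inv \<sigma>) -` B"
proof (intro equalityI subsetI)
  fix M assume "M \<in> op_relabel (inv \<sigma>) -` B"
  then have "M = op_relabel \<sigma> (op_relabel (inv \<sigma>) M)" "op_relabel (inv \<sigma>) M \<in> B"
    by (simp_all add: op_relabel_inv(1)[OF assms])
  then show "M \<in> op_relabel \<sigma> ` B" by (rule image_eqI)
qed (auto simp: op_relabel_inv(2)[OF assms])

text \<open>The bridge between the two notions of symmetry: relabelling the columns of an operator
  conjugates the map it induces, by \<open>act_relabel\<close>.\<close>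

lemma lip_restr_act_relabel:
  assumes \<sigma>: "\<sigma> permutes {..<n}"
  shows "lip_restr n (act (op_relabel \<sigma> M)) = conj_map n \<sigma> (lip_restr n (act M))"
proof
  fix x :: "'a part"
  show "lip_restr n (act (op_relabel \<sigma> M)) x = conj_map n \<sigma> (lip_restr n (act M)) x"
  proof (cases "x \<in> parts_on n")
    case True
    let ?y = "relabel (inv \<sigma>) x"
    have "act (op_relabel \<sigma> M) x = relabel \<sigma> (act M ?y)"
      using act_relabel[of \<sigma> M ?y] by (simp add: relabel_inv(1)[OF \<sigma>])
    moreover have "?y \<in> parts_on n" using True relabel_in_parts_on[OF permutes_inv[OF \<sigma>]] by blast
    ultimately show ?thesis
      using True by (simp add: lip_restr_def conj_map_def part_restr_relabel[OF \<sigma>])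
  qed (simp add: lip_restr_def conj_map_def)
qed

section \<open>Cylinder sets of operators\<close>

lemma space_op_space: "space op_space = UNIV"
  unfolding op_space_def by (rule space_measure_of) auto

lemma op_restr_vimage_sets: "op_restr n -` B \<in> sets op_space"
proof -
  have "op_restr n -` (B \<inter> operators_on n) \<inter> space op_space \<in> sets op_space"
    by (rule measurable_sets[OF op_restr_measurable]) simp
  moreover have "op_restr n -` (B \<inter> operators_on n) \<inter> space op_space = op_restr n -` B"
    using op_restr_in by (auto simp: space_op_space)
  ultimately show ?thesis by simp
qed

text \<open>Cylinders are described by the induced map instead of the restricted matrix because
  rates are indexed by maps; by \<open>lip_restr_act_eq_iff\<close> the same sets arise.\<close>

definition op_cylinder :: "nat \<Rightarrow> ('k part \<Rightarrow> 'k part) set \<Rightarrow> 'k operator set" where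
  "op_cylinder n C = {M. lip_restr n (act M) \<in> C}"

lemma op_cylinder_eq: "op_cylinder n C = op_restr n -` (op_restr n ` op_cylinder n C)"
proof (intro equalityI subsetI)
  fix M assume "M \<in> op_restr n -` (op_restr n ` op_cylinder n C)"
  then obtain N where "N \<in> op_cylinder n C" "op_restr n M = op_restr n N" by blast
  then show "M \<in> op_cylinder n C" by (simp add: op_cylinder_def flip: lip_restr_act_eq_iff)
qed auto

lemma op_cylinder_sets: "op_cylinder n C \<in> sets op_space"
  by (subst op_cylinder_eq) (rule op_restr_vimage_sets)

lemma op_restr_vimage_eq_cylinder:
  "op_restr n -` B = op_cylinder n ((\<lambda>M. lip_restr n (act M)) ` (op_restr n -` B))"
  by (auto simp: op_cylinder_def lip_restr_act_eq_iff)

text \<open>The induced map at level \<open>m\<close> determines the one at level \<open>n\<close>.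
  This brings two cylinders, or a cylinder and a permutation, to a common level.\<close>

lemma op_cylinder_refine:
  assumes "n \<le> m"
  shows "op_cylinder n C = op_cylinder m ((\<lambda>M. lip_restr m (act M)) ` op_cylinder n C)"
proof (intro equalityI subsetI)
  fix M assume "M \<in> op_cylinder m ((\<lambda>M. lip_restr m (act M)) ` op_cylinder n C)"
  then obtain N where "N \<in> op_cylinder n C" "lip_restr m (act M) = lip_restr m (act N)"
    unfolding op_cylinder_def[of m] by blast
  then show "M \<in> op_cylinder n C"
    using lip_restr_act_mono[OF _ assms, of M N] by (simp add: op_cylinder_def)
qed (auto simp: op_cylinder_def)

lemma op_relabel_vimage_cylinder:
  assumes "\<sigma> permutes {..<n}" "C \<subseteq> parts_on n \<rightarrow>\<^sub>E parts_on n"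
  shows "op_relabel (inv \<sigma>) -` op_cylinder n C = op_cylinder n (conj_map n \<sigma> ` C)"
proof -
  let ?c = "conj_map n \<sigma>" and ?d = "conj_map n (inv \<sigma>)"
  note cd = conj_map_inv[OF assms(1)] conj_map_inv'[OF assms(1)]
  have "?d (lip_restr n (act M)) \<in> C \<longleftrightarrow> lip_restr n (act M) \<in> ?c ` C" for M
  proof
    assume "?d (lip_restr n (act M)) \<in> C"
    moreover have "lip_restr n (act M) = ?c (?d (lip_restr n (act M)))"
      by (rule cd(2)[OF lip_restr_funcset[OF act_lip], symmetric])
    ultimately show "lip_restr n (act M) \<in> ?c ` C" by blast
  next
    assume "lip_restr n (act M) \<in> ?c ` C"
    then obtain f where f: "f \<in> C" "lip_restr n (act M) = ?c f" by blast
    then have "f \<in> parts_on n \<rightarrow>\<^sub>E parts_on n" using assms(2) by blast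
    then show "?d (lip_restr n (act M)) \<in> C" using f by (simp add: cd(1))
  qed
  then show ?thesis
    by (auto simp: op_cylinder_def lip_restr_act_relabel[OF permutes_inv[OF assms(1)]])
qed

lemma op_relabel_measurable:
  assumes "finitary_perm \<sigma>"
  shows "op_relabel (inv \<sigma>) \<in> op_space \<rightarrow>\<^sub>M op_space"
proof -
  obtain N where N: "\<And>n. N \<le> n \<Longrightarrow> \<sigma> permutes {..<n}" using finitary_perm_permutes[OF assms] by blast
  have "op_relabel (inv \<sigma>) -` (op_restr n -` B) \<in> sets op_space" for n B
  proof -
    define p where "p = max n N"
    have \<sigma>: "\<sigma> permutes {..<p}" by (rule N) (simp add: p_def)
    let ?D = "(\<lambda>M. lip_restr p (act M)) ` (op_restr n -` B)"
    have "op_restr n -` B = op_cylinder n ((\<lambda>M. lip_restr n (act M)) ` (op_restr n -` B))"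
      by (rule op_restr_vimage_eq_cylinder)
    also have "\<dots> = op_cylinder p ((\<lambda>M. lip_restr p (act M)) ` \<dots>)"
      by (rule op_cylinder_refine) (simp add: p_def)
    also have "(\<lambda>M. lip_restr p (act M)) `
        op_cylinder n ((\<lambda>M. lip_restr n (act M)) ` (op_restr n -` B)) = ?D"
      by (simp flip: op_restr_vimage_eq_cylinder)
    finally have eq: "op_restr n -` B = op_cylinder p ?D" .
    have "?D \<subseteq> parts_on p \<rightarrow>\<^sub>E parts_on p"
    proof
      fix f assume "f \<in> ?D"
      then obtain M where "f = lip_restr p (act M)" by blast
      then show "f \<in> parts_on p \<rightarrow>\<^sub>E parts_on p" by (simp only: lip_restr_funcset[OF act_lip])
    qed
    then have "op_relabel (inv \<sigma>) -` op_cylinder p ?D = op_cylinder p (conj_map p \<sigma> ` ?D)"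
      by (rule op_relabel_vimage_cylinder[OF \<sigma>])
    then show ?thesis by (subst eq) (simp only: op_cylinder_sets)
  qed
  note vimage = this
  show ?thesis
  proof (rule measurable_sigma_sets)
    show "sets op_space = sigma_sets UNIV {op_restr n -` B | n B. B \<subseteq> operators_on n}"
      unfolding op_space_def by (rule sets_measure_of) (simp only: Pow_UNIV subset_UNIV)
    fix A :: "'a operator set" assume "A \<in> {op_restr n -` B | n B. B \<subseteq> operators_on n}"
    then obtain n B where "A = op_restr n -` B" by (elim CollectE exE conjE)
    then show "op_relabel (inv \<sigma>) -` A \<inter> space op_space \<in> sets op_space"
      by (simp only: vimage space_op_space Int_UNIV_right)
  qed (simp_all only: Pow_UNIV subset_UNIV UNIV_I Pi_UNIV)
qed

text \<open>Generators are restricted to cylinders that avoid the identity at their level, because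
  these have finite mass. They all miss \<open>op_id\<close>, so \<open>{op_id}\<close> is added to
  cover the space; it is the complement of the union of all label cylinders.\<close>

lemma sigma_sets_op_cylinders:
  "sets op_space = sigma_sets UNIV (insert {op_id} {op_cylinder n C | n C. N \<le> n \<and> C \<subseteq> labels n})"
    (is "_ = sigma_sets UNIV ?E")
proof (rule antisym)
  have "{op_id} = (UNIV :: 'a operator set) - (\<Union>n. op_cylinder n (labels n))"
  proof -
    have "M = op_id" if M: "\<forall>n. lip_restr n (act M) \<notin> labels n" for M :: "'a operator"
    proof -
      have "op_restr n M = op_restr n op_id" for n
        using M unfolding lip_restr_act_labels_iff lip_restr_act_op_id[symmetric] lip_restr_act_eq_iff
        by blast
      then have "part_restr n (M j) = part_restr n (op_id j)" for n j by (simp add: op_restr_def fun_eq_iff)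
      then have "\<forall>i<n. M j i = op_id j i" for n j by (simp only: part_restr_eq_iff)
      then show ?thesis by (intro ext) blast
    qed
    then show ?thesis by (auto simp: op_cylinder_def lip_restr_act_op_id labels_def)
  qed
  moreover have "(UNIV :: 'a operator set) - (\<Union>n. op_cylinder n (labels n)) \<in> sets op_space"
    using sets.compl_sets[of "\<Union>n. op_cylinder n (labels n)" op_space] op_cylinder_sets
    by (auto simp: space_op_space)
  ultimately have "?E \<subseteq> sets op_space" using op_cylinder_sets by auto
  then show "sigma_sets UNIV ?E \<subseteq> sets op_space"
    using sets.sigma_sets_subset[of ?E op_space] by (simp add: space_op_space)
next
  have "op_restr n -` B \<in> sigma_sets UNIV ?E" for n and B :: "'a operator set"
  proof -
    define p where "p = max n N"
    define D where "D = (\<lambda>M. lip_restr p (act M)) ` (op_restr n -` B)"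
    have "op_restr n -` B = op_cylinder n ((\<lambda>M. lip_restr n (act M)) ` (op_restr n -` B))"
      by (rule op_restr_vimage_eq_cylinder)
    also have "\<dots> = op_cylinder p ((\<lambda>M. lip_restr p (act M)) ` \<dots>)"
      by (rule op_cylinder_refine) (simp add: p_def)
    also have "(\<lambda>M. lip_restr p (act M)) `
        op_cylinder n ((\<lambda>M. lip_restr n (act M)) ` (op_restr n -` B)) = D"
      by (simp add: D_def flip: op_restr_vimage_eq_cylinder)
    finally have eq: "op_restr n -` B = op_cylinder p D" .
    have cyl: "op_cylinder p C \<in> sigma_sets UNIV ?E" if "C \<subseteq> labels p" for C
    proof (rule sigma_sets.Basic, rule insertI2, rule CollectI)
      show "\<exists>n C'. op_cylinder p C = op_cylinder n C' \<and> N \<le> n \<and> C' \<subseteq> labels n"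
        using that by (intro exI[of _ p] exI[of _ C]) (simp add: p_def)
    qed
    show ?thesis
    proof (cases "id_on p \<in> D")
      case False
      have "lip_restr p (act M) \<in> D \<longleftrightarrow> lip_restr p (act M) \<in> D \<inter> labels p" for M :: "'a operator"
        using False lip_restr_act_labels_iff[of p M] unfolding Int_iff by metis
      then have "op_cylinder p D = op_cylinder p (D \<inter> labels p)"
        unfolding op_cylinder_def by (intro Collect_cong)
      then show ?thesis unfolding eq using cyl[of "D \<inter> labels p"] by simp
    next
      \<comment> \<open>This cylinder contains \<open>op_id\<close>, but its complement is a
        cylinder over labels.\<close>
      case True
      have "lip_restr p (act M) \<in> D \<longleftrightarrow> lip_restr p (act M) \<notin> labels p - D" for M :: "'a operator"
        using True lip_restr_act_labels_iff[of p M] unfolding Diff_iff by metis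
      then have "op_cylinder p D = UNIV - op_cylinder p (labels p - D)"
        unfolding op_cylinder_def by (intro set_eqI) (simp only: mem_Collect_eq Diff_iff UNIV_I simp_thms)
      then show ?thesis
        unfolding eq using sigma_sets.Compl[OF cyl[of "labels p - D"]] by simp
    qed
  qed
  then have "sigma_sets UNIV {op_restr n -` B | n B. B \<subseteq> operators_on n} \<subseteq> sigma_sets UNIV ?E"
    by (intro sigma_sets_mono subsetI) (elim CollectE exE conjE, simp only:)
  then show "sets op_space \<subseteq> sigma_sets UNIV ?E"
    unfolding op_space_def by (subst sets_measure_of) simp_all
qed

text \<open>Two cylinders are intersected at the larger level, where labels stay labels;
  \<open>{op_id}\<close> is disjoint from every label cylinder.\<close>

lemma Int_stable_op_cylinders:
  "Int_stable (insert {op_id} {op_cylinder n C | n C. N \<le> n \<and> C \<subseteq> labels n})"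
    (is "Int_stable ?E")
proof (rule Int_stableI)
  have cyl: "op_cylinder n C \<in> ?E" if "N \<le> n" "C \<subseteq> labels n" for n C
  proof (rule insertI2, rule CollectI)
    show "\<exists>n' C'. op_cylinder n C = op_cylinder n' C' \<and> N \<le> n' \<and> C' \<subseteq> labels n'"
      using that by (intro exI[of _ n] exI[of _ C]) simp
  qed
  have "op_cylinder N {} \<in> ?E" by (rule cyl) auto
  then have empty: "{} \<in> ?E" by (simp add: op_cylinder_def)
  have id: "op_id \<notin> op_cylinder n C" if "C \<subseteq> labels n" for n C
    using that by (auto simp: op_cylinder_def lip_restr_act_op_id labels_def)
  fix A B assume A: "A \<in> ?E" and B: "B \<in> ?E"
  show "A \<inter> B \<in> ?E"
  proof (cases "A = {op_id} \<or> B = {op_id}")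
    case True
    then have "A \<inter> B = {} \<or> A \<inter> B = {op_id}" by blast
    then show ?thesis using empty by auto
  next
    case False
    obtain n C where C: "A = op_cylinder n C" "N \<le> n" "C \<subseteq> labels n" using A False by blast
    obtain m D where D: "B = op_cylinder m D" "N \<le> m" "D \<subseteq> labels m" using B False by blast
    let ?p = "max n m"
    let ?l = "\<lambda>M. lip_restr ?p (act M)"
    have "A = op_cylinder ?p (?l ` op_cylinder n C)" "B = op_cylinder ?p (?l ` op_cylinder m D)"
      unfolding C(1) D(1) by (rule op_cylinder_refine, simp)+
    then have "A \<inter> B = op_cylinder ?p (?l ` op_cylinder n C \<inter> ?l ` op_cylinder m D)"
      by (auto simp: op_cylinder_def)
    moreover have "?l ` op_cylinder n C \<subseteq> labels ?p"
    proof
      fix f assume "f \<in> ?l ` op_cylinder n C"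
      then obtain M where M: "f = ?l M" "lip_restr n (act M) \<in> C" unfolding op_cylinder_def by blast
      then have "lip_restr n (act M) \<in> labels n" using C(3) by blast
      then show "f \<in> labels ?p" unfolding M(1) by (rule lip_restr_act_labels_mono) simp
    qed
    ultimately show ?thesis using cyl[of ?p "?l ` op_cylinder n C \<inter> ?l ` op_cylinder m D"] C(2)
      by (simp add: le_infI1 le_max_iff_disj)
  qed
qed

lemma inj_on_conj_map:
  assumes "\<sigma> permutes {..<n}"
  shows "inj_on (conj_map n \<sigma>) (labels n)"
  by (rule inj_on_inverseI[where g = "conj_map n (inv \<sigma>)"])
    (auto simp: labels_def conj_map_inv[OF assms])

section \<open>Recovering an operator from Lipschitz conjugates\<close>

lemma lip_maps_onD:
  assumes "f \<in> lip_maps_on n" "x \<in> parts_on n" "y \<in> parts_on n" "part_restr m x = part_restr m y"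
  shows "part_restr m (f x) = part_restr m (f y)"
  using assms unfolding lip_maps_on_def part_dist_le_iff by blast

lemma part_restr_1_eq_iff: "part_restr 1 x = part_restr 1 y \<longleftrightarrow> x 0 = y 0"
  by (simp add: part_restr_eq_iff)

text \<open>Conjugating with the transposition of \<open>0\<close> and \<open>i\<close> makes \<open>F x i\<close> the first coordinate.\<close>

lemma range_actI:
  assumes F: "F \<in> lip_maps"
    and conj: "\<And>n \<sigma>. \<sigma> permutes {..<n} \<Longrightarrow> conj_map n \<sigma> (lip_restr n F) \<in> lip_maps_on n"
  shows "F \<in> range act"
proof -
  have local: "F x i = F y i" if "x i = y i" for x y i
  proof -
    let ?n = "Suc i" and ?\<sigma> = "Transposition.transpose 0 i"
    have \<sigma>: "?\<sigma> permutes {..<?n}" by (rule permutes_swap_id) auto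
    let ?g = "conj_map ?n ?\<sigma> (lip_restr ?n F)"
    have g: "?g (relabel ?\<sigma> (part_restr ?n z)) = relabel ?\<sigma> (part_restr ?n (F z))" for z
      by (simp add: conj_map_relabel[OF \<sigma>] part_restr_in lip_restr_part_restr[OF F])
    have "part_restr 1 (relabel ?\<sigma> (part_restr ?n x)) = part_restr 1 (relabel ?\<sigma> (part_restr ?n y))"
      using that unfolding part_restr_1_eq_iff by (simp add: relabel_def part_restr_def)
    \<comment> \<open>At level 1 the Lipschitz condition says that the first coordinate of the image
      depends only on the first coordinate of the argument.\<close>
    then have "part_restr 1 (relabel ?\<sigma> (part_restr ?n (F x))) = part_restr 1 (relabel ?\<sigma> (part_restr ?n (F y)))"
      using lip_maps_onD[OF conj[OF \<sigma>] relabel_in_parts_on[OF \<sigma> part_restr_in]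
          relabel_in_parts_on[OF \<sigma> part_restr_in], of 1 x y]
      unfolding g by blast
    then show ?thesis unfolding part_restr_1_eq_iff by (simp add: relabel_def part_restr_def)
  qed
  \<comment> \<open>Since \<open>F x i\<close> depends only on \<open>x i\<close>, the argument may
    be replaced by the constant partition of colour \<open>x i\<close>; its image is the
    corresponding column.\<close>
  have "F = act (\<lambda>j. F (\<lambda>_. j))"
  proof (intro ext)
    fix x i show "F x i = act (\<lambda>j. F (\<lambda>_. j)) x i"
      unfolding act_def by (rule local) simp
  qed
  then show ?thesis by blast
qed

section \<open>The measure induced on operators\<close>

context lipschitz_driver
begin

text \<open>Being an operator is tested level by level: agreeing at every level with some operator,
  possibly a different one each time, is enough, and this is a countable intersection of
  cylinders.\<close>

lemma range_act_sets: "range act \<in> sets \<phi>"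
proof -
  have "(range act :: ('k part \<Rightarrow> 'k part) set) = (\<Inter>n. lip_restr n -` (lip_restr n ` range act) \<inter> lip_maps)"
  proof (intro equalityI subsetI)
    fix F :: "'k part \<Rightarrow> 'k part" assume "F \<in> range act"
    then show "F \<in> (\<Inter>n. lip_restr n -` (lip_restr n ` range act) \<inter> lip_maps)" using act_lip by auto
  next
    fix F :: "'k part \<Rightarrow> 'k part"
    assume *: "F \<in> (\<Inter>n. lip_restr n -` (lip_restr n ` range act) \<inter> lip_maps)"
    then have F: "F \<in> lip_maps" by blast
    have "\<exists>M. \<forall>x. F x i = M (x i) i" for i
    proof -
      obtain M :: "'k operator" where M: "lip_restr (Suc i) F = lip_restr (Suc i) (act M)"
        using * by blast
      have "F x i = M (x i) i" for x
      proof -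
        have "part_restr (Suc i) (F x) = part_restr (Suc i) (act M x)"
          using M lip_restr_part_restr[OF F] lip_restr_part_restr[OF act_lip] by metis
        then show ?thesis by (auto simp: part_restr_eq_iff act_def)
      qed
      then show ?thesis by blast
    qed
    then obtain M where "\<And>i x. F x i = M i (x i) i" by metis
    \<comment> \<open>Diagonal choice: row position \<open>i\<close> is taken from the operator that
      matches \<open>F\<close> at level \<open>Suc i\<close>.\<close>
    then have "F = act (\<lambda>j i. M i j i)" by (simp add: act_def fun_eq_iff)
    then show "F \<in> range act" by blast
  qed
  also have "\<dots> \<in> sets \<phi>" using lip_restr_vimage_sets by (intro sets.countable_INT) auto
  finally show ?thesis .
qed

lemma sets_op_measure: "sets (op_measure \<phi>) = sets op_space"
  by (simp add: op_measure_def)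

text \<open>Measurability of \<open>range act\<close> lets the restricted measure be evaluated in
  \<phi> itself.\<close>

lemma emeasure_op_measure:
  assumes "A \<in> sets op_space"
  shows "emeasure (op_measure \<phi>) A = emeasure \<phi> (act ` A)"
proof -
  have act: "act ` A \<subseteq> range act" by blast
  have "emeasure (op_measure \<phi>) A =
      emeasure (restrict_space \<phi> (range act)) (the_inv act -` A \<inter> space (restrict_space \<phi> (range act)))"
    unfolding op_measure_def by (rule emeasure_distr[OF the_inv_act_measurable[OF sets_phi] assms])
  also have "the_inv act -` A \<inter> space (restrict_space \<phi> (range act)) = act ` A"
    using act_lip by (auto simp: space_restrict_space space_phi the_inv_f_f[OF inj_act])
  also have "emeasure (restrict_space \<phi> (range act)) (act ` A) = emeasure \<phi> (act ` A)"
    by (rule emeasure_restrict_space[OF _ act]) (use range_act_sets in auto)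
  finally show ?thesis .
qed

lemma emeasure_op_measure_op_id: "emeasure (op_measure \<phi>) {op_id} = 0"
proof (cases "{op_id} \<in> sets (op_measure \<phi>)")
  case True
  then show ?thesis using emeasure_op_measure emeasure_id by (simp add: sets_op_measure act_op_id)
qed (rule emeasure_notin_sets)

lemma emeasure_op_measure_nontrivial:
  "emeasure (op_measure \<phi>) (op_cylinder n (labels n)) < \<infinity>"
proof -
  have "emeasure (op_measure \<phi>) (op_cylinder n (labels n)) = emeasure \<phi> (act ` op_cylinder n (labels n))"
    by (rule emeasure_op_measure[OF op_cylinder_sets])
  also have "\<dots> \<le> emeasure \<phi> (active n)"
    using act_lip by (intro emeasure_mono active_sets) (auto simp: op_cylinder_def active_def labels_def)
  finally show ?thesis using emeasure_active[of n] by (rule order_le_less_trans)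
qed

text \<open>A restricted operator differs from the identity matrix iff its induced map is a label,
  so the mass is bounded by that of \<open>active n\<close>.\<close>

lemma emeasure_op_restr_nontrivial:
  "emeasure (distr (op_measure \<phi>) (count_space (operators_on n)) (op_restr n))
     {M \<in> operators_on n. M \<noteq> op_id_on n} < \<infinity>"
proof -
  have "op_restr n \<in> op_measure \<phi> \<rightarrow>\<^sub>M count_space (operators_on n)"
    using op_restr_measurable measurable_cong_sets[OF sets_op_measure refl] by blast
  then have "emeasure (distr (op_measure \<phi>) (count_space (operators_on n)) (op_restr n))
      {M \<in> operators_on n. M \<noteq> op_id_on n} =
    emeasure (op_measure \<phi>) (op_restr n -` {M \<in> operators_on n. M \<noteq> op_id_on n} \<inter> space (op_measure \<phi>))"
    by (rule emeasure_distr) simp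
  also have "op_restr n -` {M \<in> operators_on n. M \<noteq> op_id_on n} \<inter> space (op_measure \<phi>) =
      op_cylinder n (labels n)"
    unfolding op_cylinder_def lip_restr_act_labels_iff lip_restr_act_op_id[symmetric]
      lip_restr_act_eq_iff op_restr_op_id
    using op_restr_in by (auto simp: op_measure_def space_op_space)
  finally show ?thesis using emeasure_op_measure_nontrivial[of n] by simp
qed

text \<open>As \<phi> is carried by the operators, cutting the levels down to
  \<open>range act\<close> loses no mass. This identifies masses of cylinders with sums of
  rates.\<close>

lemma emeasure_op_cylinder:
  assumes ae: "AE F in \<phi>. F \<in> range act" and C: "C \<subseteq> labels n"
  shows "emeasure (op_measure \<phi>) (op_cylinder n C) = (\<Sum>f\<in>C. emeasure \<phi> (level n f))"
proof -
  have fin: "finite C" using C finite_labels finite_subset by blast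
  have act: "act ` op_cylinder n C = (\<Union>f\<in>C. level n f) \<inter> range act"
    using act_lip by (auto simp: op_cylinder_def level_def)
  have U: "(\<Union>f\<in>C. level n f) \<in> sets \<phi>" using fin level_sets by (intro sets.finite_UN) auto
  have "emeasure (op_measure \<phi>) (op_cylinder n C) = emeasure \<phi> ((\<Union>f\<in>C. level n f) \<inter> range act)"
    using emeasure_op_measure[OF op_cylinder_sets, of n C] unfolding act .
  also have "\<dots> = emeasure \<phi> (\<Union>f\<in>C. level n f)"
  proof (rule emeasure_eq_AE)
    show "AE F in \<phi>. F \<in> (\<Union>f\<in>C. level n f) \<inter> range act \<longleftrightarrow> F \<in> (\<Union>f\<in>C. level n f)"
      using ae by eventually_elim blast
  qed (use U range_act_sets in auto)
  also have "\<dots> = (\<Sum>f\<in>C. emeasure \<phi> (level n f))"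
    by (rule sum_emeasure[symmetric])
      (use fin level_sets in \<open>auto simp: disjoint_family_on_def level_def\<close>)
  finally show ?thesis .
qed

lemma emeasure_level_eq_iff:
  assumes "f \<in> labels n" "g \<in> labels n"
  shows "emeasure \<phi> (level n f) = emeasure \<phi> (level n g) \<longleftrightarrow> measure \<phi> (level n f) = measure \<phi> (level n g)"
proof -
  have "emeasure \<phi> (level n f) = ennreal (measure \<phi> (level n f))" if "f \<in> labels n" for f
    using emeasure_level[OF that] by (intro emeasure_eq_ennreal_measure) auto
  then show ?thesis using assms by simp
qed

text \<open>The exceptional maps lie in the levels of labels with a conjugate that is not Lipschitz.
  Each level number admits finitely many permutations and labels, so these null levels form a
  countable union. The identity is no label, but all its conjugates are Lipschitz.\<close>

lemma AE_range_act:
  assumes inv: "rates_invariant \<phi>"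
  shows "AE F in \<phi>. F \<in> range act"
proof -
  define Z :: "nat \<Rightarrow> (nat \<Rightarrow> nat) \<Rightarrow> ('k part \<Rightarrow> 'k part) set"
    where "Z n \<sigma> = {f \<in> labels n. conj_map n \<sigma> f \<notin> lip_maps_on n}" for n \<sigma>
  have countable_perms: "countable {\<sigma>. \<sigma> permutes {..<n::nat}}" for n
    by (rule countable_finite[OF finite_permutations]) simp
  have countable_Z: "countable (Z n \<sigma>)" for n \<sigma>
    by (rule countable_finite) (simp add: Z_def finite_labels)
  have "level n f \<in> null_sets \<phi>" if \<sigma>: "\<sigma> permutes {..<n}" and f: "f \<in> Z n \<sigma>" for n \<sigma> f
  proof -
    have f': "f \<in> labels n" "conj_map n \<sigma> f \<notin> lip_maps_on n" using f by (simp_all add: Z_def)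
    have "level n (conj_map n \<sigma> f) = {}"
    proof (rule equals0I)
      fix F assume "F \<in> level n (conj_map n \<sigma> f)"
      then have "F \<in> lip_maps" "lip_restr n F = conj_map n \<sigma> f" by (simp_all add: level_def)
      then show False using lip_restr_in[of F n] f'(2) by simp
    qed
    then have "measure \<phi> (level n f) = 0"
      using inv \<sigma> f'(1) unfolding rates_invariant_def by (metis measure_empty)
    moreover have "emeasure \<phi> (level n f) = ennreal (measure \<phi> (level n f))"
      using emeasure_level[OF f'(1)] by (intro emeasure_eq_ennreal_measure) auto
    ultimately show ?thesis using level_sets by (simp add: null_setsI)
  qed
  then have "(\<Union>n. \<Union>\<sigma>\<in>{\<sigma>. \<sigma> permutes {..<n}}. \<Union>f\<in>Z n \<sigma>. level n f) \<in> null_sets \<phi>"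
    by (intro null_sets_UN' countable_perms countable_Z) simp_all
  then have "AE F in \<phi>. F \<notin> (\<Union>n. \<Union>\<sigma>\<in>{\<sigma>. \<sigma> permutes {..<n}}. \<Union>f\<in>Z n \<sigma>. level n f)"
    by (rule AE_not_in)
  then show ?thesis using AE_space
  proof eventually_elim
    case (elim F)
    then have F: "F \<in> lip_maps" by (simp add: space_phi)
    show ?case
    proof (rule range_actI[OF F])
      fix n \<sigma> assume \<sigma>: "\<sigma> permutes {..<n::nat}"
      show "conj_map n \<sigma> (lip_restr n F) \<in> lip_maps_on n"
      proof (rule ccontr)
        assume *: "conj_map n \<sigma> (lip_restr n F) \<notin> lip_maps_on n"
        then have "lip_restr n F \<noteq> id_on n"
          using conj_map_id_on[OF \<sigma>] lip_restr_in[OF id_lip, of n] unfolding lip_restr_id by metis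
        then have "lip_restr n F \<in> Z n \<sigma>"
          using * lip_restr_funcset[OF F] by (simp add: Z_def labels_def)
        moreover have "F \<in> level n (lip_restr n F)" using F by (simp add: level_def)
        ultimately show False using elim(1) \<sigma> by blast
      qed
    qed
  qed
qed

text \<open>The measure and its image under the inverse relabelling are compared on the generator of
  label cylinders. There they are sums of rates over \<open>C\<close> and over its conjugate, equal
  term by term.\<close>

lemma op_measure_relabel:
  assumes inv: "rates_invariant \<phi>" and fin: "finitary_perm \<sigma>" and A: "A \<in> sets op_space"
  shows "emeasure (op_measure \<phi>) A = emeasure (op_measure \<phi>) (op_relabel \<sigma> ` A)"
proof -
  obtain N where N: "\<And>n. N \<le> n \<Longrightarrow> \<sigma> permutes {..<n}" using finitary_perm_permutes[OF fin] by blast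
  note ae = AE_range_act[OF inv]
  define \<mu> where "\<mu> = op_measure \<phi>"
  define \<mu>' where "\<mu>' = distr \<mu> op_space (op_relabel (inv \<sigma>))"
  have meas: "op_relabel (inv \<sigma>) \<in> \<mu> \<rightarrow>\<^sub>M op_space"
    using op_relabel_measurable[OF fin] measurable_cong_sets[OF sets_op_measure refl] unfolding \<mu>_def by blast
  have space: "space \<mu> = UNIV" by (simp add: \<mu>_def op_measure_def space_op_space)
  have \<mu>': "emeasure \<mu>' B = emeasure \<mu> (op_relabel \<sigma> ` B)" if "B \<in> sets op_space" for B
    using emeasure_distr[OF meas that]
    by (simp add: \<mu>'_def space op_relabel_image_eq_vimage[OF N[OF order_refl]])
  let ?E = "insert {op_id} {op_cylinder n C | n C. N \<le> n \<and> C \<subseteq> (labels n :: ('k part \<Rightarrow> 'k part) set)}"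
  \<comment> \<open>An exhaustion by sets of finite measure: the null set \<open>{op_id}\<close>,
    then the operators acting nontrivially at level \<open>N + n\<close>.\<close>
  let ?A = "\<lambda>i. case i of 0 \<Rightarrow> {op_id} | Suc n \<Rightarrow> op_cylinder (N + n) (labels (N + n) :: ('k part \<Rightarrow> 'k part) set)"
  have id: "op_relabel \<sigma> ` {op_id} = {op_id}"
    by (auto simp: op_relabel_def op_id_def relabel_def comp_def)
  have sE: "sets op_space = sigma_sets UNIV ?E" by (rule sigma_sets_op_cylinders)
  have "\<mu> = \<mu>'"
  proof (rule measure_eqI_generator_eq[where \<Omega> = UNIV and E = ?E and A = ?A])
    show "Int_stable ?E" by (rule Int_stable_op_cylinders)
    show "sets \<mu> = sigma_sets UNIV ?E" unfolding \<mu>_def sets_op_measure by (rule sE)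
    show "sets \<mu>' = sigma_sets UNIV ?E" unfolding \<mu>'_def sets_distr by (rule sE)
    show "range ?A \<subseteq> ?E"
    proof (rule image_subsetI)
      fix i show "?A i \<in> ?E"
      proof (cases i)
        case (Suc n)
        have "op_cylinder (N + n) (labels (N + n)) \<in> {op_cylinder n C | n C. N \<le> n \<and> C \<subseteq> labels n}"
          by (intro CollectI exI[of _ "N + n"] exI[of _ "labels (N + n)"]) simp
        then show ?thesis unfolding Suc nat.case by (rule insertI2)
      qed simp
    qed
    show "(\<Union>i. ?A i) = UNIV"
    proof (intro equalityI subsetI UNIV_I)
      fix M :: "'k operator"
      show "M \<in> (\<Union>i. ?A i)"
      proof (cases "M = op_id")
        case True
        then show ?thesis by (intro UN_I[of 0]) simp_all
      next
        case False
        then have "act M \<noteq> id" using inj_act by (metis act_op_id injD)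
        then obtain n where "act M \<in> active n" using in_active[OF act_lip] by blast
        then have "lip_restr n (act M) \<in> labels n" unfolding lip_restr_act_labels_iff by (simp add: active_def)
        then have "lip_restr (N + n) (act M) \<in> labels (N + n)" by (rule lip_restr_act_labels_mono) simp
        then show ?thesis by (intro UN_I[of "Suc n"]) (simp_all add: op_cylinder_def)
      qed
    qed
    show "emeasure \<mu> (?A i) \<noteq> \<infinity>" for i
      using emeasure_op_measure_op_id emeasure_op_measure_nontrivial
      by (cases i) (simp_all add: \<mu>_def less_top)
    fix B assume "B \<in> ?E"
    then consider "B = {op_id}" | n C where "B = op_cylinder n C" "N \<le> n" "C \<subseteq> labels n" by blast
    then show "emeasure \<mu> B = emeasure \<mu>' B"
    proof cases
      case 1
      have "{op_id :: 'k operator} \<in> sets op_space" unfolding sE by (rule sigma_sets.Basic) simp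
      from \<mu>'[OF this] show ?thesis unfolding 1 id by simp
    next
      case 2
      note \<sigma> = N[OF 2(2)]
      have C: "conj_map n \<sigma> ` C \<subseteq> labels n" using 2(3) by (intro image_subsetI conj_map_labels[OF \<sigma>]) blast
      have sub: "C \<subseteq> parts_on n \<rightarrow>\<^sub>E parts_on n" using 2(3) unfolding labels_def by blast
      have "emeasure \<mu>' B = emeasure \<mu> (op_relabel \<sigma> ` op_cylinder n C)"
        unfolding 2(1) by (rule \<mu>'[OF op_cylinder_sets])
      also have "op_relabel \<sigma> ` op_cylinder n C = op_cylinder n (conj_map n \<sigma> ` C)"
        unfolding op_relabel_image_eq_vimage[OF \<sigma>] by (rule op_relabel_vimage_cylinder[OF \<sigma> sub])
      also have "emeasure \<mu> \<dots> = (\<Sum>f\<in>conj_map n \<sigma> ` C. emeasure \<phi> (level n f))"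
        unfolding \<mu>_def by (rule emeasure_op_cylinder[OF ae C])
      also have "\<dots> = (\<Sum>f\<in>C. emeasure \<phi> (level n (conj_map n \<sigma> f)))"
        by (subst sum.reindex[OF inj_on_subset[OF inj_on_conj_map[OF \<sigma>] 2(3)]]) simp
      also have "\<dots> = (\<Sum>f\<in>C. emeasure \<phi> (level n f))"
      proof (rule sum.cong[OF refl])
        fix f assume "f \<in> C"
        then have f: "f \<in> labels n" using 2(3) by blast
        then have "measure \<phi> (level n (conj_map n \<sigma> f)) = measure \<phi> (level n f)"
          using inv \<sigma> unfolding rates_invariant_def by blast
        then show "emeasure \<phi> (level n (conj_map n \<sigma> f)) = emeasure \<phi> (level n f)"
          using emeasure_level_eq_iff[OF conj_map_labels[OF \<sigma> f] f] by simp
      qed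
      also have "\<dots> = emeasure \<mu> B"
        unfolding \<mu>_def 2(1) by (rule emeasure_op_cylinder[OF ae 2(3), symmetric])
      finally show ?thesis by simp
    qed
  qed simp
  then have "emeasure \<mu> A = emeasure \<mu>' A" by simp
  also have "\<dots> = emeasure \<mu> (op_relabel \<sigma> ` A)" by (rule \<mu>'[OF A])
  finally show ?thesis by (simp add: \<mu>_def)
qed

text \<open>The cylinder over the single label \<open>f\<close> has mass equal to the rate of
  \<open>f\<close>, and relabelling carries it to the cylinder over the conjugate.\<close>

lemma rates_invariantI:
  assumes ae: "AE F in \<phi>. F \<in> range act"
    and inv: "\<And>\<sigma> A. finitary_perm \<sigma> \<Longrightarrow> A \<in> sets op_space \<Longrightarrow>
      emeasure (op_measure \<phi>) A = emeasure (op_measure \<phi>) (op_relabel \<sigma> ` A)"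
  shows "rates_invariant \<phi>"
  unfolding rates_invariant_def
proof (intro allI impI)
  fix n \<sigma> and f :: "'k part \<Rightarrow> 'k part"
  assume \<sigma>: "\<sigma> permutes {..<n}" and f: "f \<in> labels n"
  note f' = conj_map_labels[OF \<sigma> f]
  have "emeasure \<phi> (level n f) = emeasure (op_measure \<phi>) (op_cylinder n {f})"
    using emeasure_op_cylinder[OF ae, of "{f}" n] f by simp
  also have "\<dots> = emeasure (op_measure \<phi>) (op_relabel \<sigma> ` op_cylinder n {f})"
    by (rule inv[OF permutes_finitary_perm[OF \<sigma>] op_cylinder_sets])
  also have "op_relabel \<sigma> ` op_cylinder n {f} = op_cylinder n {conj_map n \<sigma> f}"
    using op_relabel_vimage_cylinder[OF \<sigma>, of "{f}"] f
    by (simp add: op_relabel_image_eq_vimage[OF \<sigma>] labels_def)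
  also have "emeasure (op_measure \<phi>) \<dots> = emeasure \<phi> (level n (conj_map n \<sigma> f))"
    using emeasure_op_cylinder[OF ae, of "{conj_map n \<sigma> f}" n] f' by simp
  finally show "measure \<phi> (level n (conj_map n \<sigma> f)) = measure \<phi> (level n f)"
    unfolding emeasure_level_eq_iff[OF f f'] by simp
qed

section \<open>Random initial states\<close>

text \<open>Unlike the path, its chain approximation is an explicit function of the restricted
  initial state and of finitely many hits, so independence factorises its law over the values
  \<open>y\<close>. Each factor is then compared with the system member started from
  \<open>y\<close>.\<close>

lemma prob_process_mixture:
  assumes x0: "x0 \<in> P \<rightarrow>\<^sub>M part_space"
    and indep: "indep_set {x0 -` A \<inter> space P | A. A \<in> sets part_space}
      {S -` B \<inter> space P | B. B \<in> sets (config_space \<nu>)}"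
    and Y: "\<And>t. 0 \<le> t \<Longrightarrow> Y t \<in> P \<rightarrow>\<^sub>M part_space"
    and path_Y: "AE \<omega> in P. driven_path (S \<omega>) (x0 \<omega>) (\<lambda>t. Y t \<omega>)"
    and X: "\<And>x t. 0 \<le> t \<Longrightarrow> X x t \<in> P \<rightarrow>\<^sub>M part_space"
    and path_X: "\<And>x. AE \<omega> in P. driven_path (S \<omega>) x (\<lambda>t. X x t \<omega>)"
    and J: "finite J" "J \<subseteq> {0..}"
  shows "prob {\<omega> \<in> space P. \<forall>t\<in>J. part_restr n (Y t \<omega>) = z t} =
    (\<Sum>y\<in>parts_on n. prob {\<omega> \<in> space P. part_restr n (x0 \<omega>) = y} *
      prob {\<omega> \<in> space P. \<forall>t\<in>J. part_restr n (X y t \<omega>) = z t})"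
    (is "prob ?A = (\<Sum>y\<in>_. ?p y * prob (?B y))")
proof -
  define T where "T = Max (insert 0 J)"
  have T: "0 \<le> T" "\<forall>t\<in>J. 0 \<le> t \<and> t \<le> T" using J by (auto simp: T_def)
  \<comment> \<open>One error for \<open>Y\<close> and one for every possible restricted initial
    state.\<close>
  let ?m = "1 + real (card (parts_on n :: 'k part set))"
  have evA: "?A \<in> events"
    using part_restr_All_event[OF J(1), where X = Y and M = P and B = "\<lambda>t. {z t}" and n = n] Y T(2) by simp
  have evB: "?B y \<in> events" for y
    using part_restr_All_event[OF J(1), where X = "X y" and M = P and B = "\<lambda>t. {z t}" and n = n] X T(2)
    by simp
  have scale: "u / ?m \<le> v" if "u \<le> ?m * v" for u v :: real
    using that by (simp add: divide_le_eq mult.commute)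
  have "\<bar>prob ?A - (\<Sum>y\<in>parts_on n. ?p y * prob (?B y))\<bar> / ?m \<le>
      card J * (total_rate n * h) + (T / h + 1) * (total_rate n * h)\<^sup>2" if h: "0 < h" for h
  proof -
    define err where "err = card J * (total_rate n * h) + (T / h + 1) * (total_rate n * h)\<^sup>2"
    let ?V = "hit_cells n h (nat \<lceil>T / h\<rceil>)"
    let ?k = "\<lambda>t. nat \<lceil>t / h\<rceil>"
    let ?C = "{\<omega> \<in> space P. \<forall>t\<in>J. chain (?V \<omega>) (?k t) (part_restr n (x0 \<omega>)) = z t}"
    let ?D = "\<lambda>y. {\<omega> \<in> space P. \<forall>t\<in>J. chain (?V \<omega>) (?k t) y = z t}"
    let ?x = "\<lambda>y. {\<omega> \<in> space P. part_restr n (x0 \<omega>) = y}"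
    have evD: "?D y \<in> events" for y by (rule hit_cells_event[OF h])
    have evx: "?x y \<in> events" for y using part_restr_event[OF x0, of n "{y}"] by simp
    have C: "?C = (\<Union>y\<in>parts_on n. ?x y \<inter> ?D y)" using part_restr_in by auto
    have evC: "?C \<in> events" unfolding C using evD evx finite_parts_on by (intro sets.finite_UN) auto
    have "prob (?x y \<inter> ?D y) = ?p y * prob (?D y)" for y
    proof (rule indep_setD[OF indep])
      have "?x y = x0 -` (part_restr n -` {y}) \<inter> space P" by auto
      then show "?x y \<in> {x0 -` A \<inter> space P | A. A \<in> sets part_space}"
        using part_restr_vimage_sets by blast
      have "{C \<in> Pow (space \<nu>). \<forall>t\<in>J. chain (hits (cell n h) ({..<nat \<lceil>T / h\<rceil>} \<times> labels n) C) (?k t) y = z t}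
          \<in> sets (config_space \<nu>)"
        by (rule hits_config_sets) (use cell_props[OF h] in \<open>auto simp: finite_labels\<close>)
      moreover have "?D y = S -` {C \<in> Pow (space \<nu>).
          \<forall>t\<in>J. chain (hits (cell n h) ({..<nat \<lceil>T / h\<rceil>} \<times> labels n) C) (?k t) y = z t} \<inter> space P"
        by (rule hits_event_eq)
      ultimately show "?D y \<in> {S -` B \<inter> space P | B. B \<in> sets (config_space \<nu>)}" by blast
    qed
    moreover have "prob ?C = (\<Sum>y\<in>parts_on n. prob (?x y \<inter> ?D y))"
      unfolding C using finite_parts_on evD evx
      by (intro finite_measure_finite_Union) (auto simp: disjoint_family_on_def)
    ultimately have probC: "prob ?C = (\<Sum>y\<in>parts_on n. ?p y * prob (?D y))" by simp
    obtain G where G: "G \<in> events" "1 - prob G \<le> err"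
      "AE \<omega> in P. \<omega> \<in> G \<longrightarrow> (\<forall>t\<in>J. part_restr n (Y t \<omega>) = chain (?V \<omega>) (?k t) (part_restr n (x0 \<omega>)))"
      using driven_path_chain_whp_uniform[where J = J and h = h and t = "\<lambda>t. t" and T = T
          and X = "\<lambda>_. Y" and x = "\<lambda>_. x0" and n = n, OF J(1) h T(2) _ T(1)] path_Y
      unfolding err_def by blast
    have "\<bar>prob ?A - prob ?C\<bar> \<le> 1 - prob G"
    proof (rule abs_prob_diff_le[OF evA evC G(1)])
      show "AE \<omega> in P. \<omega> \<in> G \<longrightarrow> (\<omega> \<in> ?A \<longleftrightarrow> \<omega> \<in> ?C)"
        using G(3) by eventually_elim auto
    qed
    then have AC: "\<bar>prob ?A - prob ?C\<bar> \<le> err" using G(2) by linarith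
    have BD: "\<bar>prob (?D y) - prob (?B y)\<bar> \<le> err" if y: "y \<in> parts_on n" for y
    proof -
      obtain G where G: "G \<in> events" "1 - prob G \<le> err"
        "AE \<omega> in P. \<omega> \<in> G \<longrightarrow> (\<forall>t\<in>J. part_restr n (X y t \<omega>) = chain (?V \<omega>) (?k t) (part_restr n y))"
        using driven_path_chain_whp_uniform[where J = J and h = h and t = "\<lambda>t. t" and T = T
            and X = "\<lambda>_. X y" and x = "\<lambda>_ _. y" and n = n, OF J(1) h T(2) _ T(1)] path_X
        unfolding err_def by blast
      have "\<bar>prob (?D y) - prob (?B y)\<bar> \<le> 1 - prob G"
      proof (rule abs_prob_diff_le[OF evD evB G(1)])
        show "AE \<omega> in P. \<omega> \<in> G \<longrightarrow> (\<omega> \<in> ?D y \<longleftrightarrow> \<omega> \<in> ?B y)"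
          using G(3) by eventually_elim (auto simp: part_restr_id[OF y])
      qed
      then show ?thesis using G(2) by linarith
    qed
    have "\<bar>prob ?C - (\<Sum>y\<in>parts_on n. ?p y * prob (?B y))\<bar> =
        \<bar>\<Sum>y\<in>parts_on n. ?p y * (prob (?D y) - prob (?B y))\<bar>"
      by (simp add: probC sum_subtractf right_diff_distrib)
    also have "\<dots> \<le> (\<Sum>y\<in>parts_on n. \<bar>?p y * (prob (?D y) - prob (?B y))\<bar>)" by (rule sum_abs)
    also have "\<dots> \<le> (\<Sum>y\<in>(parts_on n :: 'k part set). err)"
    proof (rule sum_mono)
      fix y :: "'k part" assume y: "y \<in> parts_on n"
      have "\<bar>?p y * (prob (?D y) - prob (?B y))\<bar> = ?p y * \<bar>prob (?D y) - prob (?B y)\<bar>"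
        by (simp add: abs_mult)
      also have "\<dots> \<le> 1 * \<bar>prob (?D y) - prob (?B y)\<bar>" by (intro mult_right_mono) auto
      finally show "\<bar>?p y * (prob (?D y) - prob (?B y))\<bar> \<le> err" using BD[OF y] by linarith
    qed
    finally have "\<bar>prob ?C - (\<Sum>y\<in>parts_on n. ?p y * prob (?B y))\<bar> \<le> card (parts_on n :: 'k part set) * err"
      by simp
    with AC have "\<bar>prob ?A - (\<Sum>y\<in>parts_on n. ?p y * prob (?B y))\<bar> \<le> err + card (parts_on n :: 'k part set) * err"
      by linarith
    also have "\<dots> = ?m * err" by (simp add: algebra_simps)
    finally show ?thesis unfolding err_def by (rule scale)
  qed
  then have "\<bar>prob ?A - (\<Sum>y\<in>parts_on n. ?p y * prob (?B y))\<bar> / ?m \<le> 0"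
    by (rule le_zero_if_le_mesh_error)
  moreover have "0 < ?m" by (simp add: add_pos_nonneg)
  ultimately have "\<bar>prob ?A - (\<Sum>y\<in>parts_on n. ?p y * prob (?B y))\<bar> \<le> 0"
    by (simp only: divide_le_0_iff) linarith
  then show ?thesis by simp
qed

lemma part_restr_relabel_eq_iff:
  assumes "\<sigma> permutes {..<n}"
  shows "part_restr n (relabel \<sigma> x) = y \<longleftrightarrow> part_restr n x = relabel (inv \<sigma>) y"
  by (simp add: part_restr_relabel[OF assms] relabel_eq_iff[OF assms])

text \<open>In the mixture over \<open>y\<close>, exchangeability of the initial state makes the
  weights invariant under \<open>y \<mapsto> relabel \<sigma> y\<close>, and invariance of the rates
  moves \<sigma> from the observed states to \<open>y\<close>. Reindexing the sum by this bijection
  gives the claim.\<close>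

lemma exchangeable_process_if_state:
  assumes x0: "x0 \<in> P \<rightarrow>\<^sub>M part_space"
    and indep: "indep_set {x0 -` A \<inter> space P | A. A \<in> sets part_space}
      {S -` B \<inter> space P | B. B \<in> sets (config_space \<nu>)}"
    and Y: "\<And>t. 0 \<le> t \<Longrightarrow> Y t \<in> P \<rightarrow>\<^sub>M part_space"
    and path_Y: "AE \<omega> in P. driven_path (S \<omega>) (x0 \<omega>) (\<lambda>t. Y t \<omega>)"
    and X: "\<And>x t. 0 \<le> t \<Longrightarrow> X x t \<in> P \<rightarrow>\<^sub>M part_space"
    and path_X: "\<And>x. AE \<omega> in P. driven_path (S \<omega>) x (\<lambda>t. X x t \<omega>)"
    and exch: "exchangeable_system P X" and state: "exchangeable_state P x0"
  shows "exchangeable_process P Y"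
  unfolding exchangeable_process_def
proof (intro allI impI)
  fix \<sigma> assume fin: "finitary_perm \<sigma>"
  obtain N where N: "\<And>n. N \<le> n \<Longrightarrow> \<sigma> permutes {..<n}" using finitary_perm_permutes[OF fin] by blast
  note inv = rates_invariant_if_exchangeable[OF path_X X exch]
  show "law P {0..} (\<lambda>t \<omega>. relabel \<sigma> (Y t \<omega>)) = law P {0..} Y"
  proof (rule law_eqI[where N = N])
    show "(\<lambda>\<omega>. relabel \<sigma> (Y t \<omega>)) \<in> P \<rightarrow>\<^sub>M part_space" if "t \<in> {0..}" for t
      using measurable_compose[OF Y relabel_measurable[OF fin]] that by simp
    show "Y t \<in> P \<rightarrow>\<^sub>M part_space" if "t \<in> {0..}" for t using Y that by simp
    fix n and J :: "real set" and z
    assume n: "N \<le> n" and J: "finite J" "J \<subseteq> {0..}"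
    note \<sigma> = N[OF n]
    let ?p = "\<lambda>y. prob {\<omega> \<in> space P. part_restr n (x0 \<omega>) = y}"
    let ?q = "\<lambda>y z. prob {\<omega> \<in> space P. \<forall>t\<in>J. part_restr n (X y t \<omega>) = z t}"
    have mix: "prob {\<omega> \<in> space P. \<forall>t\<in>J. part_restr n (Y t \<omega>) = z t} = (\<Sum>y\<in>parts_on n. ?p y * ?q y z)" for z
      by (rule prob_process_mixture[OF x0 indep Y path_Y X path_X J])
    have p: "?p y = ?p (relabel \<sigma> y)" for y
    proof -
      have "prob (x0 -` (part_restr n -` {relabel \<sigma> y}) \<inter> space P) =
          measure (distr P part_space x0) (part_restr n -` {relabel \<sigma> y})"
        by (rule measure_distr[OF x0 part_restr_vimage_sets, symmetric])
      also have "distr P part_space x0 = distr P part_space (\<lambda>\<omega>. relabel \<sigma> (x0 \<omega>))"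
        using state fin unfolding exchangeable_state_def by simp
      also have "measure \<dots> (part_restr n -` {relabel \<sigma> y}) =
          prob ((\<lambda>\<omega>. relabel \<sigma> (x0 \<omega>)) -` (part_restr n -` {relabel \<sigma> y}) \<inter> space P)"
        by (rule measure_distr[OF measurable_compose[OF x0 relabel_measurable[OF fin]] part_restr_vimage_sets])
      also have "(\<lambda>\<omega>. relabel \<sigma> (x0 \<omega>)) -` (part_restr n -` {relabel \<sigma> y}) \<inter> space P =
          {\<omega> \<in> space P. part_restr n (x0 \<omega>) = y}"
        by (auto simp: part_restr_relabel_eq_iff[OF \<sigma>] relabel_inv(2)[OF \<sigma>])
      also have "x0 -` (part_restr n -` {relabel \<sigma> y}) \<inter> space P =
          {\<omega> \<in> space P. part_restr n (x0 \<omega>) = relabel \<sigma> y}" by auto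
      finally show ?thesis by simp
    qed
    have q: "?q y (\<lambda>t. relabel (inv \<sigma>) (z t)) = ?q (relabel \<sigma> y) z" for y
    proof -
      let ?J = "{y} \<times> J"
      have "?q y (\<lambda>t. relabel (inv \<sigma>) (z t)) =
          prob {\<omega> \<in> space P. \<forall>i\<in>?J. part_restr n (relabel \<sigma> (X (fst i) (snd i) \<omega>)) = z (snd i)}"
        by (simp add: part_restr_relabel_eq_iff[OF \<sigma>])
      also have "\<dots> = prob {\<omega> \<in> space P. \<forall>i\<in>?J. part_restr n (X (relabel \<sigma> (fst i)) (snd i) \<omega>) = z (snd i)}"
        by (rule rates_invariant_fidi[OF inv \<sigma> path_X X]) (use J in auto)
      finally show ?thesis by simp
    qed
    have "prob {\<omega> \<in> space P. \<forall>t\<in>J. part_restr n (relabel \<sigma> (Y t \<omega>)) = z t} =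
        prob {\<omega> \<in> space P. \<forall>t\<in>J. part_restr n (Y t \<omega>) = relabel (inv \<sigma>) (z t)}"
      by (simp add: part_restr_relabel_eq_iff[OF \<sigma>])
    also have "\<dots> = (\<Sum>y\<in>parts_on n. ?p (relabel \<sigma> y) * ?q (relabel \<sigma> y) z)"
      unfolding mix q by (rule sum.cong[OF refl]) (simp only: p[symmetric])
    also have "\<dots> = (\<Sum>y\<in>parts_on n. ?p y * ?q y z)"
      by (rule sum.reindex_bij_witness[where i = "relabel (inv \<sigma>)" and j = "relabel \<sigma>"])
        (simp_all add: relabel_inv[OF \<sigma>] relabel_in_parts_on[OF \<sigma>]
          relabel_in_parts_on[OF permutes_inv[OF \<sigma>]])
    also have "\<dots> = prob {\<omega> \<in> space P. \<forall>t\<in>J. part_restr n (Y t \<omega>) = z t}" by (rule mix[symmetric])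
    finally show "prob {\<omega> \<in> space P. \<forall>t\<in>J. part_restr n (relabel \<sigma> (Y t \<omega>)) = z t} =
        prob {\<omega> \<in> space P. \<forall>t\<in>J. part_restr n (Y t \<omega>) = z t}" .
  qed (rule prob_space_axioms)
qed

end

text \<open>The process at time 0 is almost surely the initial state, so it suffices to take the
  marginal of the two path laws there.\<close>

lemma exchangeable_state_if_process:
  assumes x0: "x0 \<in> P \<rightarrow>\<^sub>M part_space"
    and Y: "\<And>t. 0 \<le> t \<Longrightarrow> Y t \<in> P \<rightarrow>\<^sub>M part_space"
    and path: "AE \<omega> in P. driven_path (S \<omega>) (x0 \<omega>) (\<lambda>t. Y t \<omega>)"
    and exch: "exchangeable_process P Y"
  shows "exchangeable_state P x0"
  unfolding exchangeable_state_def
proof (intro allI impI)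
  fix \<sigma> assume fin: "finitary_perm \<sigma>"
  have start: "AE \<omega> in P. Y 0 \<omega> = x0 \<omega>"
    using path
  proof eventually_elim
    case (elim \<omega>)
    then have "part_restr n (Y 0 \<omega>) = part_restr n (x0 \<omega>)" for n by (simp add: driven_path_def)
    then have "\<forall>i<n. Y 0 \<omega> i = x0 \<omega> i" for n by (simp only: part_restr_eq_iff)
    then show ?case by (intro ext) blast
  qed
  have marginal: "distr (law P {0..} Z) part_space (\<lambda>f. f 0) = distr P part_space (Z 0)"
    if Z: "\<And>t. 0 \<le> t \<Longrightarrow> Z t \<in> P \<rightarrow>\<^sub>M part_space" for Z :: "real \<Rightarrow> 'a \<Rightarrow> 'b part"
  proof -
    have "(\<lambda>f. f 0) \<in> Pi\<^sub>M {0::real..} (\<lambda>_. part_space) \<rightarrow>\<^sub>M part_space"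
      by (rule measurable_component_singleton) simp
    moreover have "(\<lambda>\<omega>. \<lambda>t\<in>{0..}. Z t \<omega>) \<in> P \<rightarrow>\<^sub>M Pi\<^sub>M {0..} (\<lambda>_. part_space)"
      by (rule law_family_measurable) (use Z in simp)
    ultimately show ?thesis unfolding law_def by (simp add: distr_distr comp_def)
  qed
  have relabel: "(\<lambda>\<omega>. relabel \<sigma> (Y t \<omega>)) \<in> P \<rightarrow>\<^sub>M part_space" if "0 \<le> t" for t
    using measurable_compose[OF Y[OF that] relabel_measurable[OF fin]] .
  have "distr P part_space (\<lambda>\<omega>. relabel \<sigma> (x0 \<omega>)) = distr P part_space (\<lambda>\<omega>. relabel \<sigma> (Y 0 \<omega>))"
  proof (rule distr_cong_AE)
    show "AE \<omega> in P. relabel \<sigma> (x0 \<omega>) = relabel \<sigma> (Y 0 \<omega>)"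
      using start by eventually_elim simp
    show "(\<lambda>\<omega>. relabel \<sigma> (x0 \<omega>)) \<in> P \<rightarrow>\<^sub>M part_space"
      by (rule measurable_compose[OF x0 relabel_measurable[OF fin]])
  qed (use relabel[of 0] in auto)
  also have "\<dots> = distr (law P {0..} (\<lambda>t \<omega>. relabel \<sigma> (Y t \<omega>))) part_space (\<lambda>f. f 0)"
    by (rule marginal[OF relabel, symmetric])
  also have "law P {0..} (\<lambda>t \<omega>. relabel \<sigma> (Y t \<omega>)) = law P {0..} Y"
    using exch fin unfolding exchangeable_process_def by blast
  also have "distr (law P {0..} Y) part_space (\<lambda>f. f 0) = distr P part_space (Y 0)"
    by (rule marginal[OF Y])
  also have "\<dots> = distr P part_space x0"
    by (rule distr_cong_AE) (use start x0 Y[of 0] in auto)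
  finally show "distr P part_space (\<lambda>\<omega>. relabel \<sigma> (x0 \<omega>)) = distr P part_space x0" .
qed

theorem theorem4p1:
  fixes P :: "'w measure"
    and \<phi> :: "('k::finite part \<Rightarrow> 'k part) measure"
    and S :: "'w \<Rightarrow> (real \<times> ('k part \<Rightarrow> 'k part)) set"
    and \<Lambda> :: "'k part \<Rightarrow> real \<Rightarrow> 'w \<Rightarrow> 'k part"
  assumes "lipschitz_partition_system P \<phi> S \<Lambda>"
  shows "(exchangeable_system P \<Lambda> \<longleftrightarrow>
      (AE F in \<phi>. F \<in> range act) \<and>
      (emeasure (op_measure \<phi>) {op_id} = 0 \<and>
       emeasure (distr (op_measure \<phi>) (count_space (operators_on 2)) (op_restr 2))
         {M \<in> operators_on 2. M \<noteq> op_id_on 2} < \<infinity>) \<and>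
      (\<forall>\<sigma>. finitary_perm \<sigma> \<longrightarrow>
        (\<forall>A\<in>sets op_space.
          emeasure (op_measure \<phi>) A = emeasure (op_measure \<phi>) (op_relabel \<sigma> ` A)))) \<and>
    (exchangeable_system P \<Lambda> \<longrightarrow>
      (\<forall>x\<^sub>0 X. lipschitz_partition_process P \<phi> S x\<^sub>0 X \<longrightarrow>
        (exchangeable_process P X \<longleftrightarrow> exchangeable_state P x\<^sub>0)))"
proof -
  have sys: "lipschitz_partition_process P \<phi> S (\<lambda>_. x) (\<Lambda> x)" for x
    using assms by (simp add: lipschitz_partition_system_def)
  have driver: "directing_measure \<phi>"
    "poisson_point_process P (restrict_space lborel {0..} \<Otimes>\<^sub>M \<phi>) S"
    using sys unfolding lipschitz_partition_process_def by blast+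
  then have "prob_space P" by (simp add: poisson_point_process_def)
  then interpret lipschitz_driver P \<phi> S
    using driver by (intro lipschitz_driver.intro lipschitz_driver_axioms.intro)
  have meas: "\<Lambda> x t \<in> P \<rightarrow>\<^sub>M part_space" if "0 \<le> t" for x t
    using sys[of x] that by (simp add: lipschitz_partition_process_def)
  have path: "AE \<omega> in P. driven_path (S \<omega>) x (\<lambda>t. \<Lambda> x t \<omega>)" for x
    using sys[of x] by (simp add: lipschitz_partition_process_def)
  have exch_iff: "exchangeable_system P \<Lambda> \<longleftrightarrow> rates_invariant \<phi>"
    using rates_invariant_if_exchangeable[OF path meas] exchangeable_if_rates_invariant[OF path meas]
    by blast
  have rates_iff: "rates_invariant \<phi> \<longleftrightarrow> (AE F in \<phi>. F \<in> range act) \<and>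
      (\<forall>\<sigma>. finitary_perm \<sigma> \<longrightarrow> (\<forall>A\<in>sets op_space.
        emeasure (op_measure \<phi>) A = emeasure (op_measure \<phi>) (op_relabel \<sigma> ` A)))"
    using AE_range_act op_measure_relabel rates_invariantI by blast
  have "exchangeable_process P X \<longleftrightarrow> exchangeable_state P x\<^sub>0"
    if exch: "exchangeable_system P \<Lambda>" and X: "lipschitz_partition_process P \<phi> S x\<^sub>0 X" for x\<^sub>0 X
  proof -
    have x0: "x\<^sub>0 \<in> P \<rightarrow>\<^sub>M part_space"
      and indep: "indep_set {x\<^sub>0 -` A \<inter> space P | A. A \<in> sets part_space}
        {S -` B \<inter> space P | B. B \<in> sets (config_space \<nu>)}"
      and Y: "\<And>t. 0 \<le> t \<Longrightarrow> X t \<in> P \<rightarrow>\<^sub>M part_space"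
      and path_X: "AE \<omega> in P. driven_path (S \<omega>) (x\<^sub>0 \<omega>) (\<lambda>t. X t \<omega>)"
      using X unfolding lipschitz_partition_process_def by auto
    show ?thesis
      using exchangeable_state_if_process[OF x0 Y path_X]
        exchangeable_process_if_state[OF x0 indep Y path_X meas path exch]
      by blast
  qed
  \<comment> \<open>The clauses on \<open>op_id\<close> and on level 2 are supplied by the directing
    measure; everything else passes through \<open>rates_invariant\<close>.\<close>
  then show ?thesis
    using exch_iff rates_iff emeasure_op_measure_op_id emeasure_op_restr_nontrivial[of 2] by blast
qed

end
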